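(* Let $(\mathcal A,\varphi,\varphi_2)$ be a second-order probability space and let $X\in M_d(\mathcal A)$ be a matricial second-order (MSO) semicircular element with covariance $\sigma:[d]^2\times[d]^2\to\mathbb R$. Let $G_S$, $G_D$, $H$ and $G_A$ be the associated single-line Cauchy transform, double-line Cauchy transform, function $H$, and annular Cauchy transform (formal power series in the entries of $a^{-1}$ and $b^{-1}$). Then $$G_A(a,b)=\Theta\Big(G_D(a,a^{\mathrm T})\Big\{\Theta[H(a,b)]+\Phi\big[H(a,b)^\Gamma\,(G_S(a)\otimes G_S(b))^\Gamma\,H(a,b)^\Gamma\big]\Big\}G_D(b,b^{\mathrm T})^{\mathrm T}\Big).$$
   Context: $[n]=\{1,\dots,n\}$, $M_d=M_d(\mathbb C)$. Second-order probability space $(\mathcal A,\varphi,\varphi_2)$: a unital complex algebra $\mathcal A$ (with involution), a tracial linear functional $\varphi$ with $\varphi(1)=1$, and a bilinear functional $\varphi_2:\mathcal A\times\mathcal A\to\mathbb C$, tracial in each argument, with $\varphi_2(a,1)=\varphi_2(1,a)=0$. Pairings: $NC_2(n)$ is the set of non-crossing pairings of $[n]$, $NC_2(0)=\{\emptyset\}$. A pairing $\pi$ is also viewed as the permutation exchanging the elements of each pair. Let $\gamma_{m,n}$ be the permutation of $[m+n]$ with cycles $(1,\dots,m)$ and $(m+1,\dots,m+n)$. $NC_2(m,n)$ ($m,n\ge1$), the annular non-crossing pairings, is the set of pairings $\pi$ of $[m+n]$ such that $\gamma_{m,n}\pi$ has exactly $(m+n)/2$ cycles and some pair $\{u,v\}\in\pi$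 satisfies $u\le m<v$. Write $SP_n=NC_2(n)$, $SP=\bigcup_{n\ge0}SP_n$; $DP_{m,n}=\{(m,n,\pi):\pi\in NC_2(m+n)\}$ for $m,n\ge0$ (elements abbreviated to $\pi$), $DP=\bigcup_{m,n\ge0}DP_{m,n}$; $DP^{||}=\bigcup_{m,n\ge1}\{\pi\in DP_{m,n}:\{1,m+n\},\{m,m+1\}\in\pi\}$; $AP_{m,n}=NC_2(m,n)$, $AP=\bigcup_{m,n\ge1}AP_{m,n}$ (disjoint union over $(m,n)$). MSO semicircular element with covariance $\sigma$: $X\in M_d(\mathcal A)$ with $X(p,q)=X(q,p)$ for all $p,q$, whose entries are selfadjoint and form a second-order semicircular family with covariance $\sigma$: for all $m,n\ge1$ and pairs of indices $c'_1,\dots,c'_m,c''_1,\dots,c''_n\in[d]^2$, with $c_s=c'_s$ for $s\le m$ and $c_s=c''_{s-m}$ for $s>m$, $\varphi(\prod_{w=1}^mX(c'_w))=\sum_{\pi\in NC_2(m)}\prod_{\{u,v\}\in\pi}\sigma(c'_u;c'_v)$ and $\varphi_2(\prod_{w=1}^mX(c'_w),\prod_{w=1}^nX(c''_w))=\sum_{\pi\in NC_2(m,n)}\prod_{\{u,v\}\in\pi}\sigma(c_u;c_v)$ (products in order). In particular $\sigma(p,q;r,s)=\sigma(p,q;s,r)=\sigma(q,p;r,s)=\sigma(q,p;s,r)$. Matrix notation: for a $d^2\times d^2$ matrix $A$, $A(p,q;r,s)=A((p-1)d+r,(q-1)d+s)$, $p,q,r,s\in[d]$; $(A\otimes B)(p,q;r,s)=A(p,q)B(r,s)$.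 $\Theta(A)(p,q;r,s)=A(p,r;q,s)$, $A^\Gamma(p,q;r,s)=A(p,q;s,r)$, $\Phi(A)=\Theta(A^\Gamma)$; ${}^{\mathrm T}$ is the usual transpose. Cumulants. For $\pi\in SP_n$ and $a_0,\dots,a_n\in M_d$: $\kappa_\pi(a_0,\dots,a_n)(p,q)=\sum_{i_1,\dots,i_n,j_1,\dots,j_n=1}^d\big[\prod_{w=0}^na_w(j_w,i_{w+1})\big]\prod_{\{u,v\}\in\pi}\sigma(i_u,j_u;i_v,j_v)$ with $j_0=p$, $i_{n+1}=q$. For $\pi\in DP_{m,n}$ or $\pi\in AP_{m,n}$ and $\mathbf a=(a_0,\dots,a_m)$, $\mathbf b=(b_0,\dots,b_n)$: $$\kappa_\pi(\mathbf a;\mathbf b)(p,q;r,s)=\sum\Big[\prod_{w=0}^ma_w(j'_w,i'_{w+1})\Big]\Big[\prod_{w=0}^nb_{n-w}^{\mathrm T}(j''_w,i''_{w+1})\Big]\prod_{\{u,v\}\in\pi}\sigma(i_u,j_u;i_v,j_v),$$ the sum over all $i'_1,\dots,i'_m,j'_1,\dots,j'_m,i''_1,\dots,i''_n,j''_1,\dots,j''_n\in[d]$, with $j'_0=p$, $i'_{m+1}=q$, $j''_0=s$, $i''_{n+1}=r$, and $i_t=i'_t$, $j_t=j'_t$ for $t\le m$, $i_t=i''_{t-m}$, $j_t=j''_{t-m}$ for $t>m$. Write $\kappa_\pi(a)=\kappa_\pi(a,\dots,a)$ and $\kappa_\pi(a;b)=\kappa_\pi(a,\dots,a;b,\dots,b)$.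 Cauchy transforms (matrices over the ring of formal power series in the entries of $a^{-1}$ and $b^{-1}$): $G_S(a)=\sum_{\pi\in SP}\kappa_\pi(a^{-1})$, $G_D(a,b)=\sum_{\pi\in DP}\kappa_\pi(a^{-1};b^{-1})$, $G_A(a,b)=\sum_{\pi\in AP}\kappa_\pi(a^{-1};b^{-1})$, and $H(a,b)=\sum_{\pi\in DP^{||}}\kappa_\pi(I_d,a^{-1},\dots,a^{-1},I_d;I_d,b^{-1},\dots,b^{-1},I_d)$. *)

theory Defs
  imports
    "HOL-Analysis.Analysis"
    "HOL-Library.Multiset"
    "HOL-Library.Disjoint_Sets"
    "HOL-Combinatorics.Orbits"
begin

section \<open>Multivariate formal power series\<close>

text \<open>
  Commutative formal power series with complex coefficients. A monomial is the
  multiset of its variables, so that multiplication of monomials is multiset union.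
\<close>

typedef 'v mps = "UNIV :: ('v multiset \<Rightarrow> complex) set"
  morphisms mps_coeff Abs_mps ..

setup_lifting type_definition_mps

lemma mps_eqI: "(\<And>M. mps_coeff f M = mps_coeff g M) \<Longrightarrow> f = g"
  by transfer auto

definition splits :: "'v multiset \<Rightarrow> ('v multiset \<times> 'v multiset) set" where
  "splits M = {(A, B). A + B = M}"

lemma finite_submultisets: "finite {A. A \<subseteq># M}"
proof (induction M)
  case empty
  then show ?case by simp
next
  case (add x M)
  have "{A. A \<subseteq># add_mset x M} \<subseteq> {A. A \<subseteq># M} \<union> add_mset x ` {A. A \<subseteq># M}"
  proof
    fix A assume "A \<in> {A. A \<subseteq># add_mset x M}"
    then have A: "A \<subseteq># add_mset x M" by simp
    show "A \<in> {A. A \<subseteq># M} \<union> add_mset x ` {A. A \<subseteq># M}"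
    proof (cases "x \<in># A")
      case True
      then have "A = add_mset x (A - {#x#})" by simp
      moreover from this A have "A - {#x#} \<subseteq># M"
        by (metis mset_subset_eq_add_mset_cancel)
      ultimately show ?thesis by blast
    next
      case False
      then have "A \<subseteq># M"
        using A by (metis subset_eq_diff_conv diff_single_trivial add_mset_add_single)
      then show ?thesis by blast
    qed
  qed
  then show ?case using add by (meson finite_UnI finite_imageI finite_subset)
qed

lemma finite_splits: "finite (splits M)"
proof -
  have "splits M \<subseteq> {A. A \<subseteq># M} \<times> {A. A \<subseteq># M}"
    by (auto simp: splits_def)
  then show ?thesis using finite_submultisets finite_subset by blast
qed

lemma splits_empty: "splits {#} = {({#}, {#})}"
  by (auto simp: splits_def)

instantiation mps :: (type) comm_ring_1
begin

lift_definition zero_mps :: "'a mps" is "\<lambda>_. 0" .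
lift_definition one_mps :: "'a mps" is "\<lambda>M. if M = {#} then 1 else 0" .
lift_definition plus_mps :: "'a mps \<Rightarrow> 'a mps \<Rightarrow> 'a mps" is "\<lambda>f g M. f M + g M" .
lift_definition minus_mps :: "'a mps \<Rightarrow> 'a mps \<Rightarrow> 'a mps" is "\<lambda>f g M. f M - g M" .
lift_definition uminus_mps :: "'a mps \<Rightarrow> 'a mps" is "\<lambda>f M. - f M" .
lift_definition times_mps :: "'a mps \<Rightarrow> 'a mps \<Rightarrow> 'a mps" is
  "\<lambda>f g M. \<Sum>(A, B)\<in>splits M. f A * g B" .

instance
proof
  fix f g h :: "'a mps"
  show "f + g + h = f + (g + h)" by transfer (auto simp: add.assoc)
  show "f + g = g + f" by transfer (auto simp: add.commute)
  show "0 + f = f" by transfer auto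
  show "- f + f = 0" by transfer auto
  show "f - g = f + - g" by transfer auto
  show "(0 :: 'a mps) \<noteq> 1" by transfer (metis zero_neq_one)
  show "(f + g) * h = f * h + g * h"
    by transfer (auto simp: algebra_simps sum.distrib split_beta)
  show "f * g = g * f"
  proof (transfer, rule ext)
    fix f g :: "'a multiset \<Rightarrow> complex" and M
    show "(\<Sum>(A, B)\<in>splits M. f A * g B) = (\<Sum>(A, B)\<in>splits M. g A * f B)"
      by (rule sum.reindex_bij_witness[of _ prod.swap prod.swap])
        (auto simp: splits_def add.commute)
  qed
  show "1 * f = f"
  proof (transfer, rule ext)
    fix f :: "'a multiset \<Rightarrow> complex" and M
    have "(\<Sum>(A, B)\<in>{({#} :: 'a multiset, M)}. (if A = {#} then 1 else 0) * f B)
        = (\<Sum>(A, B)\<in>splits M. (if A = {#} then 1 else 0) * f B)"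
      by (rule sum.mono_neutral_left[OF finite_splits]) (auto simp: splits_def split: if_splits)
    then show "(\<Sum>(A, B)\<in>splits M. (if A = {#} then 1 else 0) * f B) = f M" by simp
  qed
  show "f * g * h = f * (g * h)"
  proof (transfer, rule ext)
    fix f g h :: "'a multiset \<Rightarrow> complex" and M
    have "(\<Sum>(A, B)\<in>splits M. (\<Sum>(C, D)\<in>splits A. f C * g D) * h B)
        = (\<Sum>x\<in>splits M. \<Sum>y\<in>splits (fst x). f (fst y) * g (snd y) * h (snd x))"
      by (simp add: split_beta sum_distrib_right)
    also have "\<dots> = (\<Sum>(x, y)\<in>(SIGMA x:splits M. splits (fst x)). f (fst y) * g (snd y) * h (snd x))"
      by (rule sum.Sigma) (auto simp: finite_splits)
    also have "\<dots> = (\<Sum>(x, y)\<in>(SIGMA x:splits M. splits (snd x)). f (fst x) * (g (fst y) * h (snd y)))"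
      by (rule sum.reindex_bij_witness
          [of _ "\<lambda>(x, y). ((fst x + fst y, snd y), (fst x, fst y))"
                "\<lambda>(x, y). ((fst y, snd y + snd x), (snd y, snd x))"])
        (auto simp: splits_def add.assoc mult.assoc)
    also have "\<dots> = (\<Sum>x\<in>splits M. \<Sum>y\<in>splits (snd x). f (fst x) * (g (fst y) * h (snd y)))"
      by (rule sum.Sigma[symmetric]) (auto simp: finite_splits)
    also have "\<dots> = (\<Sum>(A, B)\<in>splits M. f A * (\<Sum>(C, D)\<in>splits B. g C * h D))"
      by (simp add: split_beta sum_distrib_left)
    finally show "(\<Sum>(A, B)\<in>splits M. (\<Sum>(C, D)\<in>splits A. f C * g D) * h B)
        = (\<Sum>(A, B)\<in>splits M. f A * (\<Sum>(C, D)\<in>splits B. g C * h D))" .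
  qed
qed

end

instantiation mps :: (type) real_algebra_1
begin

lift_definition scaleR_mps :: "real \<Rightarrow> 'a mps \<Rightarrow> 'a mps" is "\<lambda>c f M. c *\<^sub>R f M" .

instance
proof
  fix c d :: real and f g :: "'a mps"
  show "c *\<^sub>R (f + g) = c *\<^sub>R f + c *\<^sub>R g" by transfer (auto simp: algebra_simps)
  show "(c + d) *\<^sub>R f = c *\<^sub>R f + d *\<^sub>R f" by transfer (auto simp: algebra_simps)
  show "c *\<^sub>R d *\<^sub>R f = (c * d) *\<^sub>R f" by transfer auto
  show "1 *\<^sub>R f = f" by transfer auto
  show "c *\<^sub>R f * g = c *\<^sub>R (f * g)"
    by transfer (auto simp: scaleR_sum_right split_beta)
  show "f * c *\<^sub>R g = c *\<^sub>R (f * g)"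
    by transfer (auto simp: scaleR_sum_right split_beta)
qed

end

lift_definition mps_var :: "'v \<Rightarrow> 'v mps" is "\<lambda>v M. if M = {#v#} then 1 else 0" .

text \<open>
  Coefficientwise sum of a possibly infinite family; it is the sum in the formal topology
  when every monomial occurs in only finitely many members of the family.
\<close>

definition mps_locally_finite :: "('i \<Rightarrow> 'v mps) \<Rightarrow> 'i set \<Rightarrow> bool" where
  "mps_locally_finite f S \<longleftrightarrow> (\<forall>M. finite {s \<in> S. mps_coeff (f s) M \<noteq> 0})"

lift_definition mps_sum :: "('i \<Rightarrow> 'v mps) \<Rightarrow> 'i set \<Rightarrow> 'v mps" is
  "\<lambda>f S M. \<Sum>s | s \<in> S \<and> f s M \<noteq> 0. f s M" .


section \<open>Non-crossing pairings\<close>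

definition pairings :: "nat \<Rightarrow> nat set set set" where
  "pairings n = {\<pi>. partition_on {1..n} \<pi> \<and> (\<forall>B\<in>\<pi>. card B = 2)}"

definition NC2 :: "nat \<Rightarrow> nat set set set" where
  "NC2 n = {\<pi> \<in> pairings n.
     \<not> (\<exists>a b c d. a < b \<and> b < c \<and> c < d \<and> {a, c} \<in> \<pi> \<and> {b, d} \<in> \<pi>)}"

definition pairing_perm :: "nat set set \<Rightarrow> nat \<Rightarrow> nat" where
  "pairing_perm \<pi> k = (if k \<in> \<Union>\<pi> then (THE l. l \<noteq> k \<and> {k, l} \<in> \<pi>) else k)"

definition annular_cycle :: "nat \<Rightarrow> nat \<Rightarrow> nat \<Rightarrow> nat" where
  "annular_cycle m n k =
     (if k = m then 1 else if k = m + n then m + 1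
      else if 1 \<le> k \<and> k < m + n then k + 1 else k)"

definition num_cycles :: "nat \<Rightarrow> (nat \<Rightarrow> nat) \<Rightarrow> nat" where
  "num_cycles N f = card (orbit f ` {1..N})"

definition NC2_annular :: "nat \<Rightarrow> nat \<Rightarrow> nat set set set" where
  "NC2_annular m n = {\<pi> \<in> pairings (m + n).
     2 * num_cycles (m + n) (annular_cycle m n \<circ> pairing_perm \<pi>) = m + n \<and>
     (\<exists>u v. {u, v} \<in> \<pi> \<and> u \<le> m \<and> m < v)}"

definition SP :: "(nat \<times> nat set set) set" where
  "SP = {(n, \<pi>). \<pi> \<in> NC2 n}"

definition DP :: "(nat \<times> nat \<times> nat set set) set" where
  "DP = {(m, n, \<pi>). \<pi> \<in> NC2 (m + n)}"

definition DP_par :: "(nat \<times> nat \<times> nat set set) set" where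
  "DP_par = {(m, n, \<pi>). 1 \<le> m \<and> 1 \<le> n \<and> \<pi> \<in> NC2 (m + n) \<and>
     {1, m + n} \<in> \<pi> \<and> {m, m + 1} \<in> \<pi>}"

definition AP :: "(nat \<times> nat \<times> nat set set) set" where
  "AP = {(m, n, \<pi>). 1 \<le> m \<and> 1 \<le> n \<and> \<pi> \<in> NC2_annular m n}"

text \<open>
  The weight \<open>\<sigma>(c\<^sub>u; c\<^sub>v)\<close> of a pair \<open>{u, v}\<close> is read with \<open>u < v\<close>. For the covariance
  of a semicircular family the order is immaterial, since \<open>\<phi>\<close> is tracial.
\<close>

definition pairing_weight ::
    "('d \<times> 'd \<Rightarrow> 'd \<times> 'd \<Rightarrow> real) \<Rightarrow> nat set set \<Rightarrow> (nat \<Rightarrow> 'd \<times> 'd) \<Rightarrow> real" where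
  "pairing_weight \<sigma> \<pi> c = (\<Prod>B\<in>\<pi>. \<sigma> (c (Min B)) (c (Max B)))"


section \<open>Second-order probability spaces and semicircular elements\<close>

locale second_order_probability_space = vector_space scale
  for scale :: "complex \<Rightarrow> 'a::ring_1 \<Rightarrow> 'a" +
  fixes star :: "'a \<Rightarrow> 'a"
    and \<phi> :: "'a \<Rightarrow> complex"
    and \<phi>2 :: "'a \<Rightarrow> 'a \<Rightarrow> complex"
  assumes scale_mult_left: "scale c x * y = scale c (x * y)"
    and scale_mult_right: "x * scale c y = scale c (x * y)"
    and star_star: "star (star x) = x"
    and star_add: "star (x + y) = star x + star y"
    and star_scale: "star (scale c x) = scale (cnj c) (star x)"
    and star_mult: "star (x * y) = star y * star x"
    and phi_linear: "Vector_Spaces.linear scale (*) \<phi>"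
    and phi_one: "\<phi> 1 = 1"
    and phi_tracial: "\<phi> (x * y) = \<phi> (y * x)"
    and phi2_linear_left: "Vector_Spaces.linear scale (*) (\<lambda>x. \<phi>2 x z)"
    and phi2_linear_right: "Vector_Spaces.linear scale (*) (\<lambda>x. \<phi>2 z x)"
    and phi2_tracial_left: "\<phi>2 (x * y) z = \<phi>2 (y * x) z"
    and phi2_tracial_right: "\<phi>2 z (x * y) = \<phi>2 z (y * x)"
    and phi2_one_left: "\<phi>2 1 z = 0"
    and phi2_one_right: "\<phi>2 z 1 = 0"

definition entry_word :: "'a::ring_1^'d^'d \<Rightarrow> (nat \<Rightarrow> 'd \<times> 'd) \<Rightarrow> nat \<Rightarrow> 'a" where
  "entry_word X c m = prod_list (map (\<lambda>w. X $ fst (c w) $ snd (c w)) [1..<Suc m])"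

definition mso_semicircular ::
    "('a::ring_1 \<Rightarrow> 'a) \<Rightarrow> ('a \<Rightarrow> complex) \<Rightarrow> ('a \<Rightarrow> 'a \<Rightarrow> complex) \<Rightarrow>
     ('d::finite \<times> 'd \<Rightarrow> 'd \<times> 'd \<Rightarrow> real) \<Rightarrow> 'a^'d^'d \<Rightarrow> bool" where
  "mso_semicircular star \<phi> \<phi>2 \<sigma> X \<longleftrightarrow>
     (\<forall>p q. X $ p $ q = X $ q $ p) \<and>
     (\<forall>p q. star (X $ p $ q) = X $ p $ q) \<and>
     (\<forall>m\<ge>1. \<forall>c. \<phi> (entry_word X c m) = (\<Sum>\<pi>\<in>NC2 m. of_real (pairing_weight \<sigma> \<pi> c))) \<and>
     (\<forall>m\<ge>1. \<forall>n\<ge>1. \<forall>c' c''.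
        \<phi>2 (entry_word X c' m) (entry_word X c'' n) =
        (\<Sum>\<pi>\<in>NC2_annular m n.
           of_real (pairing_weight \<sigma> \<pi> (\<lambda>s. if s \<le> m then c' s else c'' (s - m)))))"


section \<open>Matrix notation\<close>

text \<open>
  A \<open>d\<^sup>2 \<times> d\<^sup>2\<close> matrix is indexed by pairs, the row index \<open>(p - 1) d + r\<close> becoming \<open>(p, r)\<close>
  and the column index \<open>(q - 1) d + s\<close> becoming \<open>(q, s)\<close>; hence
  \<open>A(p, q; r, s)\<close> is \<open>A $ (p, r) $ (q, s)\<close>.
\<close>

type_synonym ('r, 'd) dmat = "'r^('d \<times> 'd)^('d \<times> 'd)"

definition dentry :: "('r, 'd::finite) dmat \<Rightarrow> 'd \<Rightarrow> 'd \<Rightarrow> 'd \<Rightarrow> 'd \<Rightarrow> 'r" where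
  "dentry A p q r s = A $ (p, r) $ (q, s)"

definition dmatrix :: "('d \<Rightarrow> 'd \<Rightarrow> 'd \<Rightarrow> 'd \<Rightarrow> 'r) \<Rightarrow> ('r, 'd::finite) dmat" where
  "dmatrix f = (\<chi> x y. f (fst x) (fst y) (snd x) (snd y))"

lemma dentry_dmatrix [simp]: "dentry (dmatrix f) p q r s = f p q r s"
  by (simp add: dentry_def dmatrix_def)

definition kronecker :: "'r::times^'d^'d \<Rightarrow> 'r^'d^'d \<Rightarrow> ('r, 'd::finite) dmat" where
  "kronecker A B = dmatrix (\<lambda>p q r s. A $ p $ q * B $ r $ s)"

definition Theta :: "('r, 'd::finite) dmat \<Rightarrow> ('r, 'd) dmat" where
  "Theta A = dmatrix (\<lambda>p q r s. dentry A p r q s)"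

definition Gamma_transpose :: "('r, 'd::finite) dmat \<Rightarrow> ('r, 'd) dmat" where
  "Gamma_transpose A = dmatrix (\<lambda>p q r s. dentry A p q s r)"

definition Phi :: "('r, 'd::finite) dmat \<Rightarrow> ('r, 'd) dmat" where
  "Phi A = Theta (Gamma_transpose A)"


section \<open>Cumulants\<close>

definition index_maps :: "nat \<Rightarrow> (nat \<Rightarrow> 'd) set" where
  "index_maps n = {1..n} \<rightarrow>\<^sub>E UNIV"

text \<open>The boundary indices \<open>j\<^sub>0\<close> and \<open>i\<^sub>n\<^sub>+\<^sub>1\<close> are set to \<open>p\<close> and \<open>q\<close>.\<close>

definition line_product ::
    "nat \<Rightarrow> (nat \<Rightarrow> 'r::comm_ring_1^'d^'d) \<Rightarrow> (nat \<Rightarrow> 'd) \<Rightarrow> (nat \<Rightarrow> 'd) \<Rightarrow> 'd \<Rightarrow> 'd \<Rightarrow> 'r" where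
  "line_product n a i j p q = (\<Prod>w=0..n. a w $ (j(0 := p)) w $ (i(n + 1 := q)) (w + 1))"

definition kappa_single ::
    "('d \<times> 'd \<Rightarrow> 'd \<times> 'd \<Rightarrow> real) \<Rightarrow> nat \<Rightarrow> nat set set \<Rightarrow>
     (nat \<Rightarrow> 'r::{comm_ring_1,real_algebra_1}^'d^'d) \<Rightarrow> 'r^'d::finite^'d" where
  "kappa_single \<sigma> n \<pi> a =
     (\<chi> p q. \<Sum>i\<in>index_maps n. \<Sum>j\<in>index_maps n.
        line_product n a i j p q * of_real (pairing_weight \<sigma> \<pi> (\<lambda>t. (i t, j t))))"

definition kappa_double ::
    "('d \<times> 'd \<Rightarrow> 'd \<times> 'd \<Rightarrow> real) \<Rightarrow> nat \<Rightarrow> nat \<Rightarrow> nat set set \<Rightarrow>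
     (nat \<Rightarrow> 'r::{comm_ring_1,real_algebra_1}^'d^'d) \<Rightarrow> (nat \<Rightarrow> 'r^'d^'d) \<Rightarrow>
     ('r, 'd::finite) dmat" where
  "kappa_double \<sigma> m n \<pi> a b =
     dmatrix (\<lambda>p q r s.
       \<Sum>i'\<in>index_maps m. \<Sum>j'\<in>index_maps m. \<Sum>i''\<in>index_maps n. \<Sum>j''\<in>index_maps n.
         line_product m a i' j' p q *
         line_product n (\<lambda>w. transpose (b (n - w))) i'' j'' s r *
         of_real (pairing_weight \<sigma> \<pi>
           (\<lambda>t. if t \<le> m then (i' t, j' t) else (i'' (t - m), j'' (t - m)))))"


section \<open>Cauchy transforms\<close>

text \<open>
  The transforms are functions of \<open>x = a\<^sup>-\<^sup>1\<close> and \<open>y = b\<^sup>-\<^sup>1\<close>, with entries in a ring of power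
  series. Substituting \<open>a\<^sup>T\<close> for an argument \<open>a\<close> amounts to replacing \<open>x\<close> by \<open>transpose x\<close>.
\<close>

definition matrix_mps_sum :: "('i \<Rightarrow> 'v mps^'m^'n) \<Rightarrow> 'i set \<Rightarrow> 'v mps^'m^'n" where
  "matrix_mps_sum f S = (\<chi> k l. mps_sum (\<lambda>s. f s $ k $ l) S)"

definition G_S :: "('d \<times> 'd \<Rightarrow> 'd \<times> 'd \<Rightarrow> real) \<Rightarrow> 'v mps^'d^'d \<Rightarrow> 'v mps^'d::finite^'d" where
  "G_S \<sigma> x = matrix_mps_sum (\<lambda>(n, \<pi>). kappa_single \<sigma> n \<pi> (\<lambda>_. x)) SP"

definition G_D :: "('d \<times> 'd \<Rightarrow> 'd \<times> 'd \<Rightarrow> real) \<Rightarrow> 'v mps^'d^'d \<Rightarrow> 'v mps^'d^'d \<Rightarrow>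
    ('v mps, 'd::finite) dmat" where
  "G_D \<sigma> x y = matrix_mps_sum (\<lambda>(m, n, \<pi>). kappa_double \<sigma> m n \<pi> (\<lambda>_. x) (\<lambda>_. y)) DP"

definition G_A :: "('d \<times> 'd \<Rightarrow> 'd \<times> 'd \<Rightarrow> real) \<Rightarrow> 'v mps^'d^'d \<Rightarrow> 'v mps^'d^'d \<Rightarrow>
    ('v mps, 'd::finite) dmat" where
  "G_A \<sigma> x y = matrix_mps_sum (\<lambda>(m, n, \<pi>). kappa_double \<sigma> m n \<pi> (\<lambda>_. x) (\<lambda>_. y)) AP"

definition flank :: "nat \<Rightarrow> 'r::{zero,one}^'d^'d \<Rightarrow> nat \<Rightarrow> 'r^'d^'d" where
  "flank n x w = (if w = 0 \<or> w = n then mat 1 else x)"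

definition H :: "('d \<times> 'd \<Rightarrow> 'd \<times> 'd \<Rightarrow> real) \<Rightarrow> 'v mps^'d^'d \<Rightarrow> 'v mps^'d^'d \<Rightarrow>
    ('v mps, 'd::finite) dmat" where
  "H \<sigma> x y = matrix_mps_sum (\<lambda>(m, n, \<pi>). kappa_double \<sigma> m n \<pi> (flank m x) (flank n y)) DP_par"

text \<open>The entries of \<open>a\<^sup>-\<^sup>1\<close> and \<open>b\<^sup>-\<^sup>1\<close> as independent indeterminates.\<close>

definition a_inv :: "('d \<times> 'd + 'd \<times> 'd) mps^'d^'d" where
  "a_inv = (\<chi> p q. mps_var (Inl (p, q)))"

definition b_inv :: "('d \<times> 'd + 'd \<times> 'd) mps^'d^'d" where
  "b_inv = (\<chi> p q. mps_var (Inr (p, q)))"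


section \<open>The defining families are locally finite\<close>

definition mps_homogeneous :: "nat \<Rightarrow> 'v mps \<Rightarrow> bool" where
  "mps_homogeneous k f \<longleftrightarrow> (\<forall>M. mps_coeff f M \<noteq> 0 \<longrightarrow> size M = k)"

lemma mps_homogeneous_0: "mps_homogeneous k 0"
  by (simp add: mps_homogeneous_def zero_mps.rep_eq)

lemma mps_homogeneous_1: "mps_homogeneous 0 1"
  by (simp add: mps_homogeneous_def one_mps.rep_eq)

lemma mps_homogeneous_var: "mps_homogeneous (Suc 0) (mps_var v)"
  by (simp add: mps_homogeneous_def mps_var.rep_eq)

lemma mps_homogeneous_add:
  "mps_homogeneous k f \<Longrightarrow> mps_homogeneous k g \<Longrightarrow> mps_homogeneous k (f + g)"
  unfolding mps_homogeneous_def by (metis add.right_neutral plus_mps.rep_eq)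

lemma mps_homogeneous_sum:
  "(\<And>s. s \<in> S \<Longrightarrow> mps_homogeneous k (f s)) \<Longrightarrow> mps_homogeneous k (sum f S)"
  by (induction S rule: infinite_finite_induct)
    (auto simp: mps_homogeneous_0 intro: mps_homogeneous_add)

lemma mps_homogeneous_mult:
  assumes "mps_homogeneous k f" "mps_homogeneous l g"
  shows "mps_homogeneous (k + l) (f * g)"
  unfolding mps_homogeneous_def
proof (intro allI impI)
  fix M assume "mps_coeff (f * g) M \<noteq> 0"
  then obtain A B where "(A, B) \<in> splits M" "mps_coeff f A * mps_coeff g B \<noteq> 0"
    unfolding times_mps.rep_eq by (metis (no_types, lifting) sum.neutral split_beta prod.collapse)
  then show "size M = k + l"
    using assms by (auto simp: mps_homogeneous_def splits_def)
qed

lemma mps_homogeneous_prod: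
  "finite S \<Longrightarrow> (\<And>s. s \<in> S \<Longrightarrow> mps_homogeneous (e s) (f s)) \<Longrightarrow>
    mps_homogeneous (sum e S) (prod f S)"
  by (induction S rule: finite_induct) (auto simp: mps_homogeneous_1 intro: mps_homogeneous_mult)

lemma mps_homogeneous_of_real: "mps_homogeneous 0 (of_real c)"
  by (simp add: mps_homogeneous_def of_real_def scaleR_mps.rep_eq one_mps.rep_eq)

lemma mps_homogeneous_line_product:
  assumes "\<And>w p q. w \<le> n \<Longrightarrow> mps_homogeneous (e w) (a w $ p $ q)"
  shows "mps_homogeneous (\<Sum>w=0..n. e w) (line_product n a i j p q)"
  unfolding line_product_def by (rule mps_homogeneous_prod) (auto intro: assms)

lemma mps_homogeneous_kappa_single:
  assumes "\<And>w p q. w \<le> n \<Longrightarrow> mps_homogeneous (e w) (a w $ p $ q)"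
  shows "mps_homogeneous (\<Sum>w=0..n. e w) (kappa_single \<sigma> n \<pi> a $ p $ q)"
  using mps_homogeneous_mult[OF mps_homogeneous_line_product[of n e a, OF assms] mps_homogeneous_of_real]
  by (auto simp: kappa_single_def intro!: mps_homogeneous_sum)

lemma mps_homogeneous_kappa_double:
  assumes "\<And>w p q. w \<le> m \<Longrightarrow> mps_homogeneous (e w) (a w $ p $ q)"
    and "\<And>w p q. w \<le> n \<Longrightarrow> mps_homogeneous (e' w) (b w $ p $ q)"
  shows "mps_homogeneous ((\<Sum>w=0..m. e w) + (\<Sum>w=0..n. e' (n - w)))
    (kappa_double \<sigma> m n \<pi> a b $ k $ l)"
proof -
  have 1: "mps_homogeneous (\<Sum>w=0..m. e w) (line_product m a i j p q)" for i j p q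
    by (rule mps_homogeneous_line_product) (rule assms)
  have 2: "mps_homogeneous (\<Sum>w=0..n. e' (n - w))
      (line_product n (\<lambda>w. transpose (b (n - w))) i j p q)" for i j p q
    by (rule mps_homogeneous_line_product) (auto simp: transpose_def intro: assms)
  show ?thesis
    using mps_homogeneous_mult[OF mps_homogeneous_mult[OF 1 2] mps_homogeneous_of_real]
    by (auto simp: kappa_double_def dmatrix_def intro!: mps_homogeneous_sum)
qed

lemma finite_pairings: "finite (pairings n)"
proof -
  have "pairings n \<subseteq> Pow (Pow {1..n})"
    by (auto simp: pairings_def partition_on_def)
  then show ?thesis by (simp add: finite_subset)
qed

lemma mps_locally_finiteI:
  assumes "\<And>s. s \<in> S \<Longrightarrow> mps_homogeneous (deg s) (f s)" "\<And>k. finite {s \<in> S. deg s = k}"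
  shows "mps_locally_finite f S"
  unfolding mps_locally_finite_def
proof
  fix M
  have "{s \<in> S. mps_coeff (f s) M \<noteq> 0} \<subseteq> {s \<in> S. deg s = size M}"
    using assms(1) unfolding mps_homogeneous_def by fastforce
  then show "finite {s \<in> S. mps_coeff (f s) M \<noteq> 0}"
    using assms(2) finite_subset by blast
qed

lemma finite_pairing_triples:
  assumes "S \<subseteq> {(m, n, \<pi>). \<pi> \<in> pairings (m + n)}"
  shows "finite {s \<in> S. (case s of (m, n, \<pi>) \<Rightarrow> m + n) = k}"
proof (rule finite_subset)
  show "{s \<in> S. (case s of (m, n, \<pi>) \<Rightarrow> m + n) = k} \<subseteq> {..k} \<times> {..k} \<times> pairings k"
    using assms by auto
  show "finite ({..k} \<times> {..k} \<times> pairings k)" by (simp add: finite_pairings)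
qed

context
  fixes x y :: "'v mps^'d::finite^'d"
  assumes x: "\<And>p q. mps_homogeneous (Suc 0) (x $ p $ q)"
    and y: "\<And>p q. mps_homogeneous (Suc 0) (y $ p $ q)"
begin

lemma G_S_locally_finite:
  "mps_locally_finite (\<lambda>s. (case s of (n, \<pi>) \<Rightarrow> kappa_single \<sigma> n \<pi> (\<lambda>_. x)) $ p $ q) SP"
proof (rule mps_locally_finiteI[where deg = "\<lambda>s. fst s + 1"])
  fix s assume "s \<in> SP"
  show "mps_homogeneous (fst s + 1) ((case s of (n, \<pi>) \<Rightarrow> kappa_single \<sigma> n \<pi> (\<lambda>_. x)) $ p $ q)"
    using mps_homogeneous_kappa_single[of "fst s" "\<lambda>_. 1" "\<lambda>_. x" \<sigma> "snd s" p q] x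
    by (auto simp: split_beta)
next
  fix k
  have "{s \<in> SP. fst s + 1 = k} \<subseteq> {..k} \<times> pairings (k - 1)"
    by (auto simp: SP_def NC2_def)
  then show "finite {s \<in> SP. fst s + 1 = k}"
    by (rule finite_subset) (simp add: finite_pairings)
qed

lemma kappa_double_locally_finite:
  assumes "S \<subseteq> {(m, n, \<pi>). \<pi> \<in> pairings (m + n)}"
  shows "mps_locally_finite
    (\<lambda>s. (case s of (m, n, \<pi>) \<Rightarrow> kappa_double \<sigma> m n \<pi> (\<lambda>_. x) (\<lambda>_. y)) $ k $ l) S"
proof (rule mps_locally_finiteI[where deg = "\<lambda>s. (case s of (m, n, \<pi>) \<Rightarrow> m + n) + 2"])
  fix s
  show "mps_homogeneous ((case s of (m, n, \<pi>) \<Rightarrow> m + n) + 2)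
    ((case s of (m, n, \<pi>) \<Rightarrow> kappa_double \<sigma> m n \<pi> (\<lambda>_. x) (\<lambda>_. y)) $ k $ l)"
    using mps_homogeneous_kappa_double[of "fst s" "\<lambda>_. 1" "\<lambda>_. x" "fst (snd s)" "\<lambda>_. 1" "\<lambda>_. y"
        \<sigma> "snd (snd s)" k l] x y
    by (auto simp: split_beta)
next
  fix k
  have "{s \<in> S. (case s of (m, n, \<pi>) \<Rightarrow> m + n) + 2 = k}
      \<subseteq> {s \<in> S. (case s of (m, n, \<pi>) \<Rightarrow> m + n) = k - 2}" by auto
  then show "finite {s \<in> S. (case s of (m, n, \<pi>) \<Rightarrow> m + n) + 2 = k}"
    using finite_pairing_triples[OF assms] finite_subset by blast
qed

lemma G_D_locally_finite:
  "mps_locally_finite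
    (\<lambda>s. (case s of (m, n, \<pi>) \<Rightarrow> kappa_double \<sigma> m n \<pi> (\<lambda>_. x) (\<lambda>_. y)) $ k $ l) DP"
  by (rule kappa_double_locally_finite) (auto simp: DP_def NC2_def)

lemma G_A_locally_finite:
  "mps_locally_finite
    (\<lambda>s. (case s of (m, n, \<pi>) \<Rightarrow> kappa_double \<sigma> m n \<pi> (\<lambda>_. x) (\<lambda>_. y)) $ k $ l) AP"
  by (rule kappa_double_locally_finite) (auto simp: AP_def NC2_annular_def)

lemma H_locally_finite:
  "mps_locally_finite
    (\<lambda>s. (case s of (m, n, \<pi>) \<Rightarrow> kappa_double \<sigma> m n \<pi> (flank m x) (flank n y)) $ k $ l) DP_par"
proof (rule mps_locally_finiteI[where deg = "\<lambda>s. (case s of (m, n, \<pi>) \<Rightarrow> m + n) - 2"])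
  have deg: "(\<Sum>w=0..m. if w = 0 \<or> w = m then 0 else Suc 0) = m - 1" for m :: nat
  proof -
    have "(\<Sum>w=0..m. if w = 0 \<or> w = m then 0 else Suc 0) = (\<Sum>w\<in>{0<..<m}. Suc 0)"
      by (rule sum.mono_neutral_cong_right) auto
    then show ?thesis by simp
  qed
  have deg': "(\<Sum>w=0..m. if m - w = 0 \<or> m - w = m then 0 else Suc 0) = m - 1" for m :: nat
    using sum.atLeastAtMost_rev[of "\<lambda>w. if w = 0 \<or> w = m then 0 else Suc 0" 0 m] deg[of m] by simp
  have flank: "mps_homogeneous (if w = 0 \<or> w = m then 0 else Suc 0) (flank m z w $ p $ q)"
    if "\<And>p q. mps_homogeneous (Suc 0) (z $ p $ q)" for w m p q and z :: "'v mps^'d^'d"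
    using that by (auto simp: flank_def mat_def mps_homogeneous_0 mps_homogeneous_1)
  fix s assume "s \<in> DP_par"
  then obtain m n \<pi> where s: "s = (m, n, \<pi>)" "1 \<le> m" "1 \<le> n"
    by (auto simp: DP_par_def)
  have "mps_homogeneous ((m - 1) + (n - 1)) (kappa_double \<sigma> m n \<pi> (flank m x) (flank n y) $ k $ l)"
    using mps_homogeneous_kappa_double[of m "\<lambda>w. if w = 0 \<or> w = m then 0 else Suc 0" "flank m x"
        n "\<lambda>w. if w = 0 \<or> w = n then 0 else Suc 0" "flank n y" \<sigma> \<pi> k l,
        OF flank[OF x] flank[OF y], unfolded deg deg'] .
  moreover have "(m - 1) + (n - 1) = m + n - 2" using s by simp
  ultimately show "mps_homogeneous ((case s of (m, n, \<pi>) \<Rightarrow> m + n) - 2)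
    ((case s of (m, n, \<pi>) \<Rightarrow> kappa_double \<sigma> m n \<pi> (flank m x) (flank n y)) $ k $ l)"
    using s(1) by simp
next
  fix k
  have *: "DP_par \<subseteq> {(m, n, \<pi>). \<pi> \<in> pairings (m + n)}"
    by (auto simp: DP_par_def NC2_def)
  have "{s \<in> DP_par. (case s of (m, n, \<pi>) \<Rightarrow> m + n) - 2 = k}
      \<subseteq> {s \<in> DP_par. (case s of (m, n, \<pi>) \<Rightarrow> m + n) = k + 2}"
    by (auto simp: DP_par_def)
  then show "finite {s \<in> DP_par. (case s of (m, n, \<pi>) \<Rightarrow> m + n) - 2 = k}"
    using finite_pairing_triples[OF *] finite_subset by blast
qed

end

end

theory Submission
  imports Defs "HOL-Combinatorics.Cycles"
begin

text \<open>
  Let \<open>e\<close> and \<open>a\<close> denote the sums over planar and annular pairings, as functions of a word of index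
  pairs and of a pair of such words. The cycle count in the definition of an annular pairing is an Euler
  characteristic, and removing the pair of the first letter either cuts a circle in two or fuses
  the two circles. Hence both functions obey a recursion on the first letter, and the statement reduces
  to an identity between functions of words: an annular pairing is cut at its first and last
  through strings, seen from the base point of the first circle. What remains outside them is planar
  on each circle, and gives the two factors \<open>G_D\<close>. Between them, either the strings of both circles
  occur in opposite orders (\<open>H\<close>), or the base point of the second circle separates the strings into
  two such groups with a planar gap between them on each circle (\<open>H\<close>, \<open>G_S \<otimes> G_S\<close>, \<open>H\<close>). Since a
  product of matrices along a concatenation of words splits at the cuts, the word
  identity turns into the matrix identity.
\<close>

section \<open>Cycle counts and pairings\<close>

text \<open>The Euler count is rigid: for one, two or three connected circles of total length N,
  twice the number of loops is at most N + 2, N and N - 2. Equality therefore decides which pieces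
  may stay linked after a pair is removed, and the cycle condition becomes an exact recursion
  without any drawing in the plane. The obstacle is the second base point. Fusing the circles along
  a string from \<open>x\<close> to \<open>y\<close> leaves the word \<open>w @ v @ u\<close>, in
  which the second circle has been reopened at \<open>y\<close> and its own base point is hidden
  between \<open>v\<close> and \<open>u\<close>. Strings ending in \<open>v\<close> have passed that
  point; exposing them takes a further decomposition of a disc moment of three words, and they are
  the source of the term quadratic in \<open>H\<close>. The identity matrices at the ends of
  \<open>H\<close> come from counting factors: a line with n letters carries n + 1 matrices, so
  where two lines meet at a block of through strings each matrix must be assigned to one side only.
  Convergence is a matter of grading: all rearrangements of series happen inside finite pieces with
  fixed words or fixed word lengths.\<close>

abbreviation (input) "swp \<equiv> Transposition.transpose"
abbreviation (input) "cyc \<equiv> cycle_of_list"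

section \<open>Orbits of a permutation composed with a transposition\<close>

definition cycles_on :: "'a set \<Rightarrow> ('a \<Rightarrow> 'a) \<Rightarrow> nat" where
  "cycles_on S f = card (orbit f ` S)"

text \<open>The transposition splices \<open>x\<close> into the cycle of \<open>a\<close>: whatever
  \<open>f\<close> sent to \<open>a\<close> now goes to \<open>x\<close>, and \<open>x\<close>,
  which \<open>f\<close> fixes, goes on to \<open>a\<close>. Erasing \<open>x\<close> from a new
  orbit gives the old one back.\<close>

lemma orbit_transpose_comp:
  assumes f: "f permutes S" and xS: "x \<notin> S" and aS: "a \<in> S" and yS: "y \<in> S"
  shows "orbit (swp x a \<circ> f) y - {x} = orbit f y"
proof -
  let ?g = "swp x a \<circ> f"
  have fx: "f x = x" using f xS by (simp add: permutes_not_in)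
  have gx: "?g x = a" by (simp add: fx)
  have gy: "?g z = (if f z = a then x else f z)" if "z \<in> S" for z
    using that f xS by (metis comp_apply permutes_in_image transpose_apply_other transpose_apply_second)
  have orbS: "orbit f y \<subseteq> S" using permutes_orbit_subset[OF f yS] .
  have 1: "(z \<noteq> x \<and> z \<in> orbit f y) \<or> (z = x \<and> a \<in> orbit f y)" if "z \<in> orbit ?g y" for z using that
  proof (induction rule: orbit.induct)
    case base
    have "f y \<in> orbit f y" by (rule orbit.base)
    moreover from this have "f y \<noteq> x" using orbS xS by blast
    ultimately show ?case unfolding gy[OF yS] by (cases "f y = a") simp_all
  next
    case (step z)
    then show ?case
    proof (elim disjE conjE)
      assume z: "z \<in> orbit f y"
      then have fz: "f z \<in> orbit f y" by (rule orbit.step)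
      moreover from this have "f z \<noteq> x" using orbS xS by blast
      moreover have "z \<in> S" using z orbS by blast
      ultimately show ?thesis unfolding gy[OF \<open>z \<in> S\<close>] by (cases "f z = a") simp_all
    next
      assume "z = x" "a \<in> orbit f y"
      moreover have "a \<noteq> x" using aS xS by blast
      ultimately show ?thesis using gx by simp
    qed
  qed
  have next_in: "f z \<in> orbit ?g y" if "z \<in> S" "?g z \<in> orbit ?g y" for z
  proof (cases "f z = a")
    case True
    then have "x \<in> orbit ?g y" using gy[OF that(1)] that(2) by simp
    then have "?g x \<in> orbit ?g y" by (rule orbit.step)
    then show ?thesis using gx True by simp
  next
    case False then show ?thesis using gy[OF that(1)] that(2) by simp
  qed
  have 2: "z \<in> orbit ?g y" if "z \<in> orbit f y" for z using that
  proof (induction rule: orbit.induct)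
    case base
    show ?case by (rule next_in[OF yS orbit.base])
  next
    case (step z)
    have "z \<in> S" using step.hyps orbS by blast
    then show ?case by (rule next_in[OF _ orbit.step[OF step.IH]])
  qed
  show ?thesis using 1 2 orbS xS by blast
qed

lemma orbit_eq_orbit:
  assumes "f permutes S" "finite S" "y \<in> orbit f x"
  shows "orbit f y = orbit f x"
  by (metis assms cyclic_on_orbit orbit_cyclic_eq3)

lemma self_in_orbit:
  assumes "f permutes S" "finite S"
  shows "x \<in> orbit f x"
  using assms permutation_permutes permutation_self_in_orbit by metis

lemma cycles_on_insert_fixed:
  assumes f: "f permutes S" and fin: "finite S" and x: "x \<notin> S"
  shows "cycles_on (insert x S) f = Suc (cycles_on S f)"
proof -
  have "orbit f x = {x}" using permutes_not_in[OF f x] by (simp add: orbit_eq_singleton_iff)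
  moreover have "orbit f y \<subseteq> S" if "y \<in> S" for y using permutes_orbit_subset[OF f that] .
  ultimately have "orbit f x \<notin> orbit f ` S" using x by force
  then show ?thesis using fin by (simp add: cycles_on_def)
qed

text \<open>Splicing lengthens one cycle and creates none. Since \<open>x\<close> lies in the orbit
  of \<open>a\<close>, erasing \<open>x\<close> is a bijection between the orbits after and
  before.\<close>

lemma cycles_on_transpose_comp:
  assumes f: "f permutes S" and fin: "finite S" and xS: "x \<notin> S" and aS: "a \<in> S"
  shows "cycles_on (insert x S) (swp x a \<circ> f) = cycles_on S f"
proof -
  let ?g = "swp x a \<circ> f"
  have g: "?g permutes insert x S"
    by (rule permutes_compose[OF permutes_subset[OF f]]) (use aS in \<open>auto intro: permutes_swap_id\<close>)
  have gx: "?g x = a" using f xS by (simp add: permutes_not_in)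
  have "a \<in> orbit ?g x" using orbit.base[of ?g x] gx by simp
  then have "orbit ?g x = orbit ?g a" using orbit_eq_orbit[OF g] fin by auto
  then have im: "orbit ?g ` insert x S = orbit ?g ` S" using aS by auto
  have rm: "orbit ?g y - {x} = orbit f y" if "y \<in> S" for y using orbit_transpose_comp[OF f xS aS that] .
  have "bij_betw (\<lambda>A. A - {x}) (orbit ?g ` S) (orbit f ` S)" unfolding bij_betw_def
  proof
    show "(\<lambda>A. A - {x}) ` orbit ?g ` S = orbit f ` S" using rm by (auto simp: image_image)
    show "inj_on (\<lambda>A. A - {x}) (orbit ?g ` S)"
    proof (rule inj_onI)
      fix A B assume A: "A \<in> orbit ?g ` S" and B: "B \<in> orbit ?g ` S" and eq: "A - {x} = B - {x}"
      obtain y z where yz: "y \<in> S" "z \<in> S" "A = orbit ?g y" "B = orbit ?g z" using A B by auto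
      have "y \<in> orbit ?g z" using self_in_orbit[OF f fin, of y] rm[OF yz(1)] eq yz by blast
      then show "A = B" using orbit_eq_orbit[OF g] fin yz by simp
    qed
  qed
  then show ?thesis unfolding cycles_on_def im by (rule bij_betw_same_card)
qed

text \<open>For nonempty \<open>B\<close> the head \<open>x\<close> is spliced in by a transposition
  and costs nothing; for \<open>B = []\<close> it is a fixed point whose cycle disappears with it.
  The correction 1 is what the count of empty circles in \<open>loops\<close> absorbs.\<close>

lemma cycles_on_delete:
  assumes G: "G permutes S" and fin: "finite S" and xS: "x \<notin> S" and B: "set B \<subseteq> S"
  shows "cycles_on (insert x S) (cyc (x # B) \<circ> G) =
    cycles_on S (cyc B \<circ> G) + (if B = [] then 1 else 0)"
proof (cases B)
  case Nil
  then show ?thesis using cycles_on_insert_fixed[OF G fin xS] by simp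
next
  case (Cons b B')
  have "cyc B \<circ> G permutes S"
    by (rule permutes_compose[OF G permutes_subset[OF cycle_permutes B]])
  from cycles_on_transpose_comp[OF this fin xS, of b] B Cons show ?thesis by (simp add: comp_assoc)
qed

section \<open>Cutting and fusing cycles by a transposition\<close>

lemma cycle_of_list_append_rotate:
  assumes "distinct (u @ v)"
  shows "cyc (u @ v) = cyc (v @ u)"
proof -
  have "rotate (length u) (u @ v) = v @ u" by (simp add: rotate_append)
  then show ?thesis using cycle_of_list_rotate_independent[OF assms, of "length u"] by simp
qed

lemma cycle_of_list_append:
  "cyc (A @ s # B) = cyc (A @ [s]) \<circ> cyc (s # B)"
proof (induction A)
  case (Cons x A)
  then show ?case by (cases A) (auto simp: comp_assoc)
qed simp

lemma cycle_of_list_conj_transpose: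
  assumes "x \<notin> set B" "s \<notin> set B" "distinct B"
  shows "swp x s \<circ> cyc (s # B) \<circ> swp x s = cyc (x # B)"
proof -
  have "map (swp x s) B = B" using assms(1,2) by (intro map_idI) (metis transpose_apply_other)
  then show ?thesis using conjugation_of_cycle[of "s # B" "swp x s"] assms by simp
qed

text \<open>A transposition of two points of one cycle cuts the cycle in two. The points
  \<open>s\<close> and \<open>x\<close> end up as heads of the two lists, ready to be removed by
  \<open>cycles_on_delete\<close>.\<close>

lemma cycle_of_list_split:
  assumes "distinct (x # A @ s # B)"
  shows "cyc (x # A @ s # B) \<circ> swp x s = cyc (s # A) \<circ> cyc (x # B)"
proof -
  have tt: "swp x s \<circ> swp x s = id" by simp
  have "cyc ((x # A) @ s # B) = cyc ((x # A) @ [s]) \<circ> cyc (s # B)"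
    by (rule cycle_of_list_append)
  also have "cyc ((x # A) @ [s]) = cyc (s # x # A)"
    using cycle_of_list_append_rotate[of "x # A" "[s]"] assms by auto
  also have "\<dots> = swp x s \<circ> cyc (x # A)" by (simp add: transpose_commute)
  also have "cyc (x # A) = swp x s \<circ> cyc (s # A) \<circ> swp x s"
    using cycle_of_list_conj_transpose[of x A s] assms by auto
  also have "swp x s \<circ> (swp x s \<circ> cyc (s # A) \<circ> swp x s)
     = cyc (s # A) \<circ> swp x s" by (simp add: fun_eq_iff)
  finally have "cyc ((x # A) @ s # B) \<circ> swp x s =
      cyc (s # A) \<circ> swp x s \<circ> cyc (s # B) \<circ> swp x s" by (rule arg_cong)
  then have "cyc (x # A @ s # B) \<circ> swp x s =
      cyc (s # A) \<circ> (swp x s \<circ> cyc (s # B) \<circ> swp x s)"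
    by (simp only: append_Cons comp_assoc)
  moreover have "swp x s \<circ> cyc (s # B) \<circ> swp x s = cyc (x # B)"
    by (rule cycle_of_list_conj_transpose) (use assms in auto)
  ultimately show ?thesis by (simp only:)
qed

lemma cycle_of_list_merge:
  assumes "distinct (x # B @ s # w)"
  shows "cyc (x # w) \<circ> cyc (s # B) \<circ> swp x s = cyc (x # B @ s # w)"
proof -
  have "cyc (s # B) \<circ> cyc (x # w) = cyc (x # w) \<circ> cyc (s # B)"
    by (rule cycles_commute) (use assms in auto)
  then have "cyc (x # B @ s # w) \<circ> swp x s
      = cyc (x # w) \<circ> cyc (s # B)"
    using cycle_of_list_split[OF assms] by (rule trans[OF _ , rotated])
  then have "cyc (x # w) \<circ> cyc (s # B) \<circ> swp x s
     = cyc (x # B @ s # w) \<circ> swp x s \<circ> swp x s" by (simp only:)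
  then show ?thesis by (simp only: comp_assoc transpose_comp_involutory comp_id)
qed

section \<open>Pairings of arbitrary label sets, as they remain after removing pairs\<close>

definition pairings_on :: "nat set \<Rightarrow> nat set set set" where
  "pairings_on S = {\<pi>. partition_on S \<pi> \<and> (\<forall>B\<in>\<pi>. card B = 2)}"

lemma pairings_eq: "pairings n = pairings_on {1..n}"
  by (simp add: pairings_def pairings_on_def)

lemma pairings_onD:
  assumes "\<pi> \<in> pairings_on S"
  shows "\<Union>\<pi> = S" "\<And>B. B \<in> \<pi> \<Longrightarrow> card B = 2" "\<And>B. B \<in> \<pi> \<Longrightarrow> B \<subseteq> S"
    "\<And>B C x. B \<in> \<pi> \<Longrightarrow> C \<in> \<pi> \<Longrightarrow> x \<in> B \<Longrightarrow> x \<in> C \<Longrightarrow> B = C"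
  using assms by (auto simp: pairings_on_def partition_on_def disjoint_def)

lemma pairings_onI:
  assumes "\<Union>\<pi> = S" "\<And>B. B \<in> \<pi> \<Longrightarrow> card B = 2"
    "\<And>B C x. B \<in> \<pi> \<Longrightarrow> C \<in> \<pi> \<Longrightarrow> x \<in> B \<Longrightarrow> x \<in> C \<Longrightarrow> B = C"
  shows "\<pi> \<in> pairings_on S"
proof -
  have "{} \<notin> \<pi>" using assms(2) by force
  moreover have "disjoint \<pi>" unfolding disjoint_def using assms(3) by blast
  ultimately show ?thesis using assms by (auto simp: pairings_on_def partition_on_def)
qed

lemma pairings_on_empty: "pairings_on {} = {{}}"
  by (auto simp: pairings_on_def partition_on_def)

lemma finite_pairings_on: "finite S \<Longrightarrow> finite (pairings_on S)"
  by (rule finite_subset[of _ "Pow (Pow S)"]) (auto simp: pairings_on_def partition_on_def)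

lemma pairings_on_block:
  assumes "\<pi> \<in> pairings_on S" "B \<in> \<pi>"
  obtains x y where "B = {x, y}" "x \<noteq> y" "x \<in> S" "y \<in> S"
  using pairings_onD(2,3)[OF assms(1,2)] by (metis card_2_iff insert_subset)

lemma pairings_on_partner:
  assumes "\<pi> \<in> pairings_on S" "x \<in> S"
  obtains y where "{x, y} \<in> \<pi>" "x \<noteq> y" "y \<in> S"
proof -
  obtain B where B: "B \<in> \<pi>" "x \<in> B" using pairings_onD(1)[OF assms(1)] assms(2) by auto
  obtain u v where "B = {u, v}" "u \<noteq> v" "u \<in> S" "v \<in> S" using pairings_on_block[OF assms(1) B(1)] .
  then show ?thesis using that B by (cases "x = u") (auto simp: insert_commute)
qed

lemma pairings_on_pair:
  assumes "\<pi> \<in> pairings_on S" "{x, s} \<in> \<pi>"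
  shows "x \<noteq> s" "x \<in> S" "s \<in> S"
  using pairings_onD(2,3)[OF assms] by (auto simp: card_insert_if split: if_splits)

lemma pairings_on_remove:
  assumes "\<pi> \<in> pairings_on S" "{x, s} \<in> \<pi>"
  shows "\<pi> - {{x, s}} \<in> pairings_on (S - {x, s})"
proof (rule pairings_onI)
  show "\<Union> (\<pi> - {{x, s}}) = S - {x, s}"
  proof
    show "\<Union> (\<pi> - {{x, s}}) \<subseteq> S - {x, s}"
      using pairings_onD(1)[OF assms(1)] pairings_onD(4)[OF assms(1) _ assms(2)] by blast
    show "S - {x, s} \<subseteq> \<Union> (\<pi> - {{x, s}})" using pairings_onD(1)[OF assms(1)] by auto
  qed
qed (use pairings_onD[OF assms(1)] in blast)+

lemma pairings_on_insert:
  assumes "\<pi> \<in> pairings_on S" "x \<noteq> s" "x \<notin> S" "s \<notin> S"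
  shows "insert {x, s} \<pi> \<in> pairings_on (insert x (insert s S))"
proof (rule pairings_onI)
  show "\<Union> (insert {x, s} \<pi>) = insert x (insert s S)" using pairings_onD(1)[OF assms(1)] by auto
  show "\<And>B. B \<in> insert {x, s} \<pi> \<Longrightarrow> card B = 2" using pairings_onD(2)[OF assms(1)] assms(2) by auto
  show "\<And>B C z. B \<in> insert {x, s} \<pi> \<Longrightarrow> C \<in> insert {x, s} \<pi> \<Longrightarrow> z \<in> B \<Longrightarrow> z \<in> C \<Longrightarrow> B = C"
    using pairings_onD(3,4)[OF assms(1)] assms(3,4) by blast
qed

lemma pairings_on_union:
  assumes "\<pi> \<in> pairings_on S" "\<rho> \<in> pairings_on T" "S \<inter> T = {}"
  shows "\<pi> \<union> \<rho> \<in> pairings_on (S \<union> T)"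
proof (rule pairings_onI)
  show "\<Union> (\<pi> \<union> \<rho>) = S \<union> T" using pairings_onD(1)[OF assms(1)] pairings_onD(1)[OF assms(2)] by auto
  show "\<And>B. B \<in> \<pi> \<union> \<rho> \<Longrightarrow> card B = 2" using pairings_onD(2)[OF assms(1)] pairings_onD(2)[OF assms(2)] by auto
  fix B C z assume BC: "B \<in> \<pi> \<union> \<rho>" "C \<in> \<pi> \<union> \<rho>" "z \<in> B" "z \<in> C"
  have "D \<in> \<pi>" if "D \<in> \<pi> \<union> \<rho>" "z \<in> D" "z \<in> S" for D
    using that pairings_onD(3)[OF assms(2), of D] assms(3) by blast
  moreover have "D \<in> \<rho>" if "D \<in> \<pi> \<union> \<rho>" "z \<in> D" "z \<notin> S" for D
    using that pairings_onD(3)[OF assms(1), of D] by blast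
  ultimately show "B = C"
    using BC pairings_onD(4)[OF assms(1), of B C z] pairings_onD(4)[OF assms(2), of B C z] by metis
qed

lemma pairings_on_restrict:
  assumes "\<pi> \<in> pairings_on (S \<union> T)" "S \<inter> T = {}" "\<And>B. B \<in> \<pi> \<Longrightarrow> B \<subseteq> S \<or> B \<subseteq> T"
  shows "{B \<in> \<pi>. B \<subseteq> S} \<in> pairings_on S"
proof (rule pairings_onI)
  show "\<Union> {B \<in> \<pi>. B \<subseteq> S} = S" using pairings_onD(1)[OF assms(1)] assms(2,3) by fast
qed (use pairings_onD[OF assms(1)] in blast)+

lemma pairing_perm_pair:
  assumes "\<pi> \<in> pairings_on S" "{x, s} \<in> \<pi>"
  shows "pairing_perm \<pi> x = s"
proof -
  have "(THE l. l \<noteq> x \<and> {x, l} \<in> \<pi>) = s"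
  proof (rule the_equality)
    show "s \<noteq> x \<and> {x, s} \<in> \<pi>" using pairings_on_pair(1)[OF assms] assms(2) by auto
    fix l assume "l \<noteq> x \<and> {x, l} \<in> \<pi>"
    then have "{x, l} = {x, s}" using pairings_onD(4)[OF assms(1) _ assms(2), of _ x] by blast
    then show "l = s" using \<open>l \<noteq> x \<and> _\<close> by (auto simp: doubleton_eq_iff)
  qed
  then show ?thesis using assms by (auto simp: pairing_perm_def)
qed

lemma pairing_perm_outside:
  assumes "\<pi> \<in> pairings_on S" "x \<notin> S"
  shows "pairing_perm \<pi> x = x"
  using assms pairings_onD(1)[OF assms(1)] by (simp add: pairing_perm_def)

lemma pairing_perm_permutes:
  assumes "\<pi> \<in> pairings_on S"
  shows "pairing_perm \<pi> permutes S"
proof -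
  have inv: "pairing_perm \<pi> (pairing_perm \<pi> x) = x" for x
  proof (cases "x \<in> S")
    case True
    then obtain y where y: "{x, y} \<in> \<pi>" using pairings_on_partner[OF assms] by metis
    then have "{y, x} \<in> \<pi>" by (simp add: insert_commute)
    then show ?thesis using pairing_perm_pair[OF assms y] pairing_perm_pair[OF assms] by metis
  qed (simp add: pairing_perm_outside[OF assms])
  then show ?thesis unfolding permutes_def using pairing_perm_outside[OF assms] by metis
qed

lemma pairing_perm_remove:
  assumes \<pi>: "\<pi> \<in> pairings_on S" and xs: "{x, s} \<in> \<pi>"
  shows "pairing_perm \<pi> = swp x s \<circ> pairing_perm (\<pi> - {{x, s}})"
proof
  fix z
  let ?\<rho> = "\<pi> - {{x, s}}"
  have \<rho>: "?\<rho> \<in> pairings_on (S - {x, s})" by (rule pairings_on_remove[OF assms])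
  consider "z = x" | "z = s" | "z \<notin> S" | "z \<in> S - {x, s}" by auto
  then show "pairing_perm \<pi> z = (swp x s \<circ> pairing_perm ?\<rho>) z"
  proof cases
    case 1 then show ?thesis using pairing_perm_pair[OF assms] pairing_perm_outside[OF \<rho>] by simp
  next
    case 2 
    have "{s, x} \<in> \<pi>" using xs by (simp add: insert_commute)
    with 2 show ?thesis using pairing_perm_pair[OF \<pi>] pairing_perm_outside[OF \<rho>] by simp
  next
    case 3
    then have "z \<noteq> x" "z \<noteq> s" using pairings_on_pair[OF assms] by auto
    then show ?thesis using pairing_perm_outside[OF \<rho>] pairing_perm_outside[OF \<pi> 3] 3 by simp
  next
    case 4
    obtain y where y: "{z, y} \<in> ?\<rho>" "y \<in> S - {x, s}" using pairings_on_partner[OF \<rho> 4] by metis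
    then show ?thesis using pairing_perm_pair[OF \<rho> y(1)] pairing_perm_pair[OF \<pi>, of z y] by auto
  qed
qed

section \<open>Loop counts of a pairing on several circles\<close>

primrec circle_perm :: "'a list list \<Rightarrow> 'a \<Rightarrow> 'a" where
  "circle_perm [] = id"
| "circle_perm (w # R) = cyc w \<circ> circle_perm R"

text \<open>An empty circle counts as one loop: a circle whose letters have all been removed still
  bounds a face. With this convention removing a pair never changes the count.\<close>

definition loops :: "nat list list \<Rightarrow> nat set set \<Rightarrow> nat" where
  "loops cs \<pi> = cycles_on (set (concat cs)) (circle_perm cs \<circ> pairing_perm \<pi>) + count_list cs []"

lemma circle_perm_permutes: "circle_perm cs permutes set (concat cs)"
proof (induction cs)
  case (Cons w R)
  have "cyc w permutes set w \<union> set (concat R)" by (rule permutes_subset[OF cycle_permutes]) auto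
  moreover have "circle_perm R permutes set w \<union> set (concat R)" by (rule permutes_subset[OF Cons]) auto
  ultimately have "cyc w \<circ> circle_perm R permutes set w \<union> set (concat R)"
    by (rule permutes_compose[rotated])
  then show ?case by (simp only: circle_perm.simps concat.simps set_append)
qed (simp only: circle_perm.simps permutes_id)

lemma loops_swap:
  assumes "distinct (u @ v)"
  shows "loops (u # v # R) = loops (v # u # R)"
proof -
  have "cyc u \<circ> cyc v = cyc v \<circ> cyc u"
    by (rule cycles_commute) (use assms in auto)
  then have "circle_perm (u # v # R) = circle_perm (v # u # R)"
    by (simp only: circle_perm.simps comp_assoc[symmetric])
  moreover have "set (concat (u # v # R)) = set (concat (v # u # R))" by auto
  moreover have "count_list (u # v # R) [] = count_list (v # u # R) []" by simp
  ultimately show ?thesis by (intro ext) (simp only: loops_def)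
qed

lemma loops_rotate:
  assumes "distinct (u @ v)"
  shows "loops ((u @ v) # R) = loops ((v @ u) # R)"
proof -
  have "circle_perm ((u @ v) # R) = circle_perm ((v @ u) # R)"
    using cycle_of_list_append_rotate[OF assms] by simp
  moreover have "set (concat ((u @ v) # R)) = set (concat ((v @ u) # R))" by auto
  moreover have "count_list ((u @ v) # R) [] = count_list ((v @ u) # R) []" by auto
  ultimately show ?thesis by (intro ext) (simp only: loops_def)
qed

lemma loops_empty: "loops [[]] {} = 1"
  by (simp add: loops_def cycles_on_def)

lemma transpose_comp_permutes_commute:
  assumes "g permutes T" "x \<notin> T" "s \<notin> T"
  shows "g \<circ> swp x s = swp x s \<circ> g"
proof
  fix z
  show "(g \<circ> swp x s) z = (swp x s \<circ> g) z"
    using assms permutes_not_in[OF assms(1)] permutes_in_image[OF assms(1)]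
    by (metis comp_apply transpose_apply_first transpose_apply_second transpose_apply_other)
qed

text \<open>The transposition of the removed pair commutes past the circles that do not contain its
  ends, so it meets directly the cycles it has to cut or fuse.\<close>

lemma circle_perm_remove_pair:
  assumes \<pi>: "\<pi> \<in> pairings_on S" and xs: "{x, s} \<in> \<pi>"
    and R: "x \<notin> set (concat R)" "s \<notin> set (concat R)"
  shows "f \<circ> circle_perm R \<circ> pairing_perm \<pi> =
    f \<circ> swp x s \<circ> (circle_perm R \<circ> pairing_perm (\<pi> - {{x, s}}))"
  unfolding pairing_perm_remove[OF \<pi> xs] comp_assoc
  by (simp only: comp_assoc[symmetric] transpose_comp_permutes_commute[OF circle_perm_permutes R])

text \<open>The pair is a chord of its circle. Its transposition cuts the cycle at \<open>x\<close>
  and \<open>s\<close>; each of these then heads one of the two new cycles and is deleted, possibly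
  leaving an empty circle behind.\<close>

lemma loops_split:
  assumes d: "distinct (concat ((x # A @ s # B) # R))"
    and \<pi>: "\<pi> \<in> pairings_on (set (concat ((x # A @ s # B) # R)))" and xs: "{x, s} \<in> \<pi>"
  shows "loops ((x # A @ s # B) # R) \<pi> = loops (A # B # R) (\<pi> - {{x, s}})"
proof -
  define \<rho> where "\<rho> = pairing_perm (\<pi> - {{x, s}})"
  define S where "S = set A \<union> set B \<union> set (concat R)"
  define G where "G = circle_perm R \<circ> \<rho>"
  have S: "finite S" "x \<notin> S" "s \<notin> insert x S" "set A \<subseteq> S" "set B \<subseteq> S" using d by (auto simp: S_def)
  have "set (concat ((x # A @ s # B) # R)) - {x, s} = S" using d by (auto simp: S_def)
  then have \<rho>: "\<rho> permutes S"
    using pairing_perm_permutes[OF pairings_on_remove[OF \<pi> xs]] by (simp add: \<rho>_def)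
  have R: "circle_perm R permutes S" by (rule permutes_subset[OF circle_perm_permutes]) (auto simp: S_def)
  have G: "G permutes S" unfolding G_def by (rule permutes_compose[OF \<rho> R])
  have "cyc (x # B) permutes insert x S"
    by (rule permutes_subset[OF cycle_permutes]) (use S in auto)
  then have G': "cyc (x # B) \<circ> G permutes insert x S"
    by (rule permutes_compose[OF permutes_subset[OF G], rotated]) auto
  have G'': "cyc A \<circ> G permutes S"
    by (rule permutes_compose[OF G permutes_subset[OF cycle_permutes S(4)]])
  have comm: "cyc A \<circ> cyc (x # B) = cyc (x # B) \<circ> cyc A"
    by (rule cycles_commute) (use d in auto)
  have comm2: "cyc A \<circ> cyc B = cyc B \<circ> cyc A"
    by (rule cycles_commute) (use d in auto)
  have "circle_perm ((x # A @ s # B) # R) \<circ> pairing_perm \<pi> = cyc (x # A @ s # B) \<circ> swp x s \<circ> G"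
    unfolding circle_perm.simps G_def \<rho>_def by (rule circle_perm_remove_pair[OF \<pi> xs]) (use d in auto)
  also have "cyc (x # A @ s # B) \<circ> swp x s
      = cyc (s # A) \<circ> cyc (x # B)" by (rule cycle_of_list_split) (use d in auto)
  finally have 1: "circle_perm ((x # A @ s # B) # R) \<circ> pairing_perm \<pi>
      = cyc (s # A) \<circ> (cyc (x # B) \<circ> G)" by (simp only: comp_assoc)
  have "set (concat ((x # A @ s # B) # R)) = insert s (insert x S)" by (auto simp: S_def)
  then have "loops ((x # A @ s # B) # R) \<pi> =
      cycles_on (insert s (insert x S)) (cyc (s # A) \<circ> (cyc (x # B) \<circ> G))
        + count_list R []" unfolding loops_def 1 by simp
  also have "\<dots> = cycles_on (insert x S) (cyc A \<circ> (cyc (x # B) \<circ> G))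
      + (if A = [] then 1 else 0) + count_list R []" by (subst cycles_on_delete[OF G']) (use S in auto)
  also have "cyc A \<circ> (cyc (x # B) \<circ> G) = cyc (x # B) \<circ> (cyc A \<circ> G)"
    using comm by (simp add: comp_assoc[symmetric])
  also have "cycles_on (insert x S) \<dots> = cycles_on S (cyc B \<circ> (cyc A \<circ> G))
      + (if B = [] then 1 else 0)" by (subst cycles_on_delete[OF G'']) (use S in auto)
  also have "cyc B \<circ> (cyc A \<circ> G) = circle_perm (A # B # R) \<circ> \<rho>"
    using comm2 by (simp add: comp_assoc[symmetric] G_def)
  also have "cycles_on S (circle_perm (A # B # R) \<circ> \<rho>) + (if B = [] then 1 else 0)
      + (if A = [] then 1 else 0) + count_list R [] = loops (A # B # R) (\<pi> - {{x, s}})"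
    by (simp add: loops_def \<rho>_def S_def Un_assoc)
  finally show ?thesis .
qed

text \<open>A pair between two circles is a bridge, and its transposition fuses their cycles. Read
  from after \<open>s\<close>, the second circle is \<open>v @ u\<close>, which is why its parts
  return in exchanged order.\<close>

lemma loops_merge:
  assumes d: "distinct (concat ((x # w) # (u @ s # v) # R))"
    and \<pi>: "\<pi> \<in> pairings_on (set (concat ((x # w) # (u @ s # v) # R)))" and xs: "{x, s} \<in> \<pi>"
  shows "loops ((x # w) # (u @ s # v) # R) \<pi> = loops ((w @ v @ u) # R) (\<pi> - {{x, s}})"
proof -
  define B where "B = v @ u"
  define \<rho> where "\<rho> = pairing_perm (\<pi> - {{x, s}})"
  define S where "S = set w \<union> set B \<union> set (concat R)"
  define G where "G = circle_perm R \<circ> \<rho>"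
  have dB: "distinct (x # B @ s # w)" using d by (auto simp: B_def)
  have S: "finite S" "s \<notin> S" "x \<notin> insert s S" "set w \<subseteq> S" "set B \<subseteq> S" using d by (auto simp: S_def B_def)
  have SS: "set (concat ((x # w) # (u @ s # v) # R)) = insert x (insert s S)" by (auto simp: S_def B_def)
  then have "set (concat ((x # w) # (u @ s # v) # R)) - {x, s} = S" using S by auto
  then have \<rho>: "\<rho> permutes S"
    using pairing_perm_permutes[OF pairings_on_remove[OF \<pi> xs]] by (simp add: \<rho>_def)
  have R: "circle_perm R permutes S" by (rule permutes_subset[OF circle_perm_permutes]) (auto simp: S_def)
  have G: "G permutes S" unfolding G_def by (rule permutes_compose[OF \<rho> R])
  have Gs: "G permutes insert s S" by (rule permutes_subset[OF G]) auto
  have "circle_perm ((x # w) # (u @ s # v) # R) \<circ> pairing_perm \<pi>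
      = cyc (x # w) \<circ> cyc (u @ s # v) \<circ> swp x s \<circ> G"
    unfolding circle_perm.simps comp_assoc[of "cyc (x # w)", symmetric] G_def \<rho>_def
    by (rule circle_perm_remove_pair[OF \<pi> xs]) (use d in auto)
  also have "cyc (u @ s # v) = cyc (s # B)"
  proof -
    have "distinct (u @ s # v)" using d by auto
    then show ?thesis unfolding B_def using cycle_of_list_append_rotate[of u "s # v"] by simp
  qed
  also have "cyc (x # w) \<circ> cyc (s # B) \<circ> swp x s
      = cyc (x # B @ s # w)" by (rule cycle_of_list_merge[OF dB])
  finally have 1: "circle_perm ((x # w) # (u @ s # v) # R) \<circ> pairing_perm \<pi>
      = cyc (x # B @ s # w) \<circ> G" .
  have "loops ((x # w) # (u @ s # v) # R) \<pi> =
      cycles_on (insert x (insert s S)) (cyc (x # B @ s # w) \<circ> G) + count_list R []"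
    unfolding loops_def 1 SS by simp
  also have "\<dots> = cycles_on (insert s S) (cyc (B @ s # w) \<circ> G) + count_list R []"
    by (subst cycles_on_delete[OF Gs]) (use S in auto)
  also have "cyc (B @ s # w) = cyc (s # w @ B)"
    using cycle_of_list_append_rotate[of B "s # w"] dB by auto
  also have "cycles_on (insert s S) (cyc (s # w @ B) \<circ> G) =
      cycles_on S (cyc (w @ B) \<circ> G) + (if w @ B = [] then 1 else 0)"
    by (rule cycles_on_delete[OF G]) (use S in auto)
  also have "cyc (w @ B) \<circ> G = circle_perm ((w @ B) # R) \<circ> \<rho>" by (simp add: comp_assoc G_def)
  also have "cycles_on S (circle_perm ((w @ B) # R) \<circ> \<rho>) + (if w @ B = [] then 1 else 0) + count_list R []
      = loops ((w @ B) # R) (\<pi> - {{x, s}})" by (simp add: loops_def \<rho>_def S_def Un_assoc)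
  finally show ?thesis by (simp add: B_def)
qed

lemma cycles_on_union:
  assumes f: "f permutes S" and g: "g permutes T" and ST: "S \<inter> T = {}" and fin: "finite S" "finite T"
    and hf: "\<And>x. x \<in> S \<Longrightarrow> h x = f x" and hg: "\<And>x. x \<in> T \<Longrightarrow> h x = g x"
  shows "cycles_on (S \<union> T) h = cycles_on S f + cycles_on T g"
proof -
  have eqo: "orbit h x = orbit k x"
    if "k permutes U" "x \<in> U" "\<And>x. x \<in> U \<Longrightarrow> h x = k x" for k U x
    by (rule orbit_cong0[of x U]) (use that permutes_in_image[OF that(1)] in auto)
  have "orbit h ` S = orbit f ` S" "orbit h ` T = orbit g ` T" using eqo[OF f _ hf] eqo[OF g _ hg] by auto
  moreover have "orbit f ` S \<inter> orbit g ` T = {}"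
  proof -
    have "orbit f x \<noteq> orbit g y" if "x \<in> S" "y \<in> T" for x y
      using permutes_orbit_subset[OF f that(1)] permutes_orbit_subset[OF g that(2)]
        orbit.base[of f x] ST by blast
    then show ?thesis by blast
  qed
  ultimately show ?thesis unfolding cycles_on_def image_Un using fin by (simp add: card_Un_disjoint)
qed

lemma circle_perm_append: "circle_perm (cs @ ds) = circle_perm cs \<circ> circle_perm ds"
  by (induction cs) (auto simp: comp_assoc)

lemma loops_union:
  assumes \<pi>: "\<pi> \<in> pairings_on (set (concat cs))" and \<rho>: "\<rho> \<in> pairings_on (set (concat ds))"
    and dis: "set (concat cs) \<inter> set (concat ds) = {}"
  shows "loops (cs @ ds) (\<pi> \<union> \<rho>) = loops cs \<pi> + loops ds \<rho>"
proof -
  let ?S = "set (concat cs)" and ?T = "set (concat ds)"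
  have un: "\<pi> \<union> \<rho> \<in> pairings_on (?S \<union> ?T)" by (rule pairings_on_union[OF \<pi> \<rho> dis])
  have 1: "pairing_perm (\<pi> \<union> \<rho>) x = pairing_perm \<pi> x" if x: "x \<in> ?S" for x
  proof -
    obtain y where y: "{x, y} \<in> \<pi>" using pairings_on_partner[OF \<pi> x] by metis
    then show ?thesis using pairing_perm_pair[OF \<pi> y] pairing_perm_pair[OF un, of x y] by auto
  qed
  have 2: "pairing_perm (\<pi> \<union> \<rho>) x = pairing_perm \<rho> x" if x: "x \<in> ?T" for x
  proof -
    obtain y where y: "{x, y} \<in> \<rho>" using pairings_on_partner[OF \<rho> x] by metis
    then show ?thesis using pairing_perm_pair[OF \<rho> y] pairing_perm_pair[OF un, of x y] by auto
  qed
  have "cycles_on (?S \<union> ?T) (circle_perm (cs @ ds) \<circ> pairing_perm (\<pi> \<union> \<rho>)) =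
      cycles_on ?S (circle_perm cs \<circ> pairing_perm \<pi>) + cycles_on ?T (circle_perm ds \<circ> pairing_perm \<rho>)"
  proof (rule cycles_on_union)
    show "circle_perm cs \<circ> pairing_perm \<pi> permutes ?S"
      by (rule permutes_compose[OF pairing_perm_permutes[OF \<pi>] circle_perm_permutes])
    show "circle_perm ds \<circ> pairing_perm \<rho> permutes ?T"
      by (rule permutes_compose[OF pairing_perm_permutes[OF \<rho>] circle_perm_permutes])
    fix x
    show "(circle_perm (cs @ ds) \<circ> pairing_perm (\<pi> \<union> \<rho>)) x = (circle_perm cs \<circ> pairing_perm \<pi>) x"
      if x: "x \<in> ?S"
    proof -
      have "pairing_perm \<pi> x \<in> ?S" using permutes_in_image[OF pairing_perm_permutes[OF \<pi>]] x by blast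
      then have "circle_perm ds (pairing_perm \<pi> x) = pairing_perm \<pi> x"
        using permutes_not_in[OF circle_perm_permutes, of _ ds] dis by (metis disjoint_iff)
      then show ?thesis using 1[OF x] by (simp add: circle_perm_append)
    qed
    show "(circle_perm (cs @ ds) \<circ> pairing_perm (\<pi> \<union> \<rho>)) x = (circle_perm ds \<circ> pairing_perm \<rho>) x"
      if x: "x \<in> ?T"
    proof -
      have "circle_perm ds (pairing_perm \<rho> x) \<in> ?T"
        using x by (simp only: permutes_in_image[OF pairing_perm_permutes[OF \<rho>]]
          permutes_in_image[OF circle_perm_permutes])
      then have "circle_perm cs (circle_perm ds (pairing_perm \<rho> x)) = circle_perm ds (pairing_perm \<rho> x)"
        using permutes_not_in[OF circle_perm_permutes, of _ cs] dis by (metis disjoint_iff)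
      then show ?thesis using 2[OF x] by (simp add: circle_perm_append)
    qed
  qed (use dis in auto)
  moreover have "set (concat (cs @ ds)) = ?S \<union> ?T" by auto
  ultimately show ?thesis unfolding loops_def by simp
qed

section \<open>Linked circles and the Euler bounds\<close>

definition linked :: "nat set set \<Rightarrow> nat set \<Rightarrow> nat set \<Rightarrow> bool" where
  "linked \<pi> U V \<longleftrightarrow> (\<exists>x\<in>U. \<exists>y\<in>V. {x, y} \<in> \<pi>)"

lemma linked_commute: "linked \<pi> U V = linked \<pi> V U"
  unfolding linked_def by (metis insert_commute)

lemma linked_Un_right: "linked \<pi> U (V \<union> W) \<longleftrightarrow> linked \<pi> U V \<or> linked \<pi> U W"
  by (auto simp: linked_def)

lemma unlinked_split:
  assumes \<pi>: "\<pi> \<in> pairings_on (U \<union> V)" and dis: "U \<inter> V = {}" and unl: "\<not> linked \<pi> U V"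
  obtains \<pi>1 \<pi>2 where "\<pi> = \<pi>1 \<union> \<pi>2" "\<pi>1 \<in> pairings_on U" "\<pi>2 \<in> pairings_on V"
proof -
  have B: "B \<subseteq> U \<or> B \<subseteq> V" if BP: "B \<in> \<pi>" for B
  proof -
    obtain x y where xy: "B = {x, y}" "x \<in> U \<union> V" "y \<in> U \<union> V" using pairings_on_block[OF \<pi> BP] by metis
    then have "{x, y} \<in> \<pi>" "{y, x} \<in> \<pi>" using BP by (auto simp: insert_commute)
    then show ?thesis using xy unl unfolding linked_def by blast
  qed
  have "\<pi> = {B \<in> \<pi>. B \<subseteq> U} \<union> {B \<in> \<pi>. B \<subseteq> V}" using B by blast
  moreover have "{B \<in> \<pi>. B \<subseteq> U} \<in> pairings_on U" by (rule pairings_on_restrict[OF \<pi> dis B])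
  moreover have "{B \<in> \<pi>. B \<subseteq> V} \<in> pairings_on V"
    by (rule pairings_on_restrict[of _ _ U]) (use \<pi> dis B in \<open>auto simp: Un_commute\<close>)
  ultimately show ?thesis using that by blast
qed

lemma loops_swap2:
  assumes "distinct (u @ v)"
  shows "loops (a # u # v # R) = loops (a # v # u # R)"
proof -
  have "cyc u \<circ> cyc v = cyc v \<circ> cyc u"
    by (rule cycles_commute) (use assms in auto)
  then have "cyc u \<circ> (cyc v \<circ> circle_perm R) =
      cyc v \<circ> (cyc u \<circ> circle_perm R)" by (simp only: comp_assoc[symmetric])
  then have "circle_perm (a # u # v # R) = circle_perm (a # v # u # R)" by (simp only: circle_perm.simps)
  moreover have "set (concat (a # u # v # R)) = set (concat (a # v # u # R))" by auto
  moreover have "count_list (a # u # v # R) [] = count_list (a # v # u # R) []" by simp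
  ultimately show ?thesis by (intro ext) (simp only: loops_def)
qed

text \<open>Any pair between the two circles serves, since a rotation of the first circle brings its
  end to the front. Two letters vanish and no loop does, so each fusion lowers the bound on twice
  the number of loops by 2. The last clause keeps a further circle attached: a pair that reaches
  into \<open>R\<close> is not the removed one.\<close>

lemma loops_merge_linked:
  assumes d: "distinct (concat (w # w' # R))" and \<pi>: "\<pi> \<in> pairings_on (set (concat (w # w' # R)))"
    and l: "linked \<pi> (set w) (set w')"
  obtains z \<rho> where "distinct (concat (z # R))" "length z + 2 = length w + length w'"
    "\<rho> \<in> pairings_on (set (concat (z # R)))" "loops (w # w' # R) \<pi> = loops (z # R) \<rho>"
    "linked \<pi> (set w \<union> set w') (set (concat R)) \<Longrightarrow> linked \<rho> (set z) (set (concat R))"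
proof -
  obtain x s where xs: "x \<in> set w" "s \<in> set w'" "{x, s} \<in> \<pi>" using l by (auto simp: linked_def)
  obtain w1 w2 where w: "w = w1 @ x # w2" using split_list[OF xs(1)] by blast
  obtain u v where w': "w' = u @ s # v" using split_list[OF xs(2)] by blast
  let ?z = "(w2 @ w1) @ v @ u" and ?\<rho> = "\<pi> - {{x, s}}"
  have "loops (w # w' # R) = loops ((x # w2 @ w1) # (u @ s # v) # R)"
  proof -
    have "distinct (w1 @ x # w2)" using d by (auto simp: w)
    then show ?thesis using loops_rotate[of w1 "x # w2" "w' # R"] by (simp add: w w')
  qed
  moreover have "set (concat (w # w' # R)) = set (concat ((x # w2 @ w1) # (u @ s # v) # R))"
    by (auto simp: w w')
  moreover have d': "distinct (concat ((x # w2 @ w1) # (u @ s # v) # R))" using d by (auto simp: w w')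
  ultimately have "loops (w # w' # R) \<pi> = loops (?z # R) ?\<rho>"
    using loops_merge[of x "w2 @ w1" u s v R \<pi>] \<pi> xs(3) by simp
  moreover have "set (concat (w # w' # R)) - {x, s} = set (concat (?z # R))" using d' by (auto simp: w w')
  then have "?\<rho> \<in> pairings_on (set (concat (?z # R)))" using pairings_on_remove[OF \<pi> xs(3)] by simp
  moreover have "linked ?\<rho> (set ?z) (set (concat R))"
    if lR: "linked \<pi> (set w \<union> set w') (set (concat R))"
  proof -
    obtain p q where pq: "p \<in> set w \<union> set w'" "q \<in> set (concat R)" "{p, q} \<in> \<pi>"
      using lR unfolding linked_def by blast
    have q: "q \<noteq> x" "q \<noteq> s" using pq(2) d by (auto simp: w w')
    then have ne: "{p, q} \<noteq> {x, s}" by (auto simp: doubleton_eq_iff)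
    then have "p \<noteq> x" "p \<noteq> s" using pairings_onD(4)[OF \<pi> pq(3) xs(3), of p] by auto
    then have "p \<in> set ?z" using pq(1) by (auto simp: w w')
    then show ?thesis using pq ne unfolding linked_def by blast
  qed
  moreover have "length ?z + 2 = length w + length w'" by (simp add: w w')
  moreover have "distinct (concat (?z # R))" using d' by auto
  ultimately show ?thesis using that by blast
qed

text \<open>The Euler characteristic bounds for one disc, an annulus and a connected three-holed sphere.\<close>

lemma loops_disc_le:
  assumes "distinct w" "\<pi> \<in> pairings_on (set w)"
  shows "2 * loops [w] \<pi> \<le> length w + 2"
  using assms
proof (induction "length w" arbitrary: w \<pi> rule: less_induct)
  case less
  show ?case
  proof (cases w)
    case Nil
    then show ?thesis using less.prems by (simp add: pairings_on_empty loops_empty)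
  next
    case (Cons x w0)
    obtain y where y: "{x, y} \<in> \<pi>" "x \<noteq> y" "y \<in> set w"
      using pairings_on_partner[OF less.prems(2), of x] Cons by auto
    then obtain u v where w0: "w0 = u @ y # v" using Cons split_list[of y w0] by auto
    define \<rho> where "\<rho> = \<pi> - {{x, y}}"
    have w: "w = x # u @ y # v" using Cons w0 by simp
    have d: "distinct (u @ v)" using less.prems(1) by (auto simp: w)
    have "set w - {x, y} = set u \<union> set v" using less.prems(1) by (auto simp: w)
    then have \<rho>: "\<rho> \<in> pairings_on (set u \<union> set v)"
      using pairings_on_remove[OF less.prems(2) y(1)] by (simp add: \<rho>_def)
    have eq: "loops [w] \<pi> = loops [u, v] \<rho>"
      using loops_split[of x u y v "[]" \<pi>] less.prems y(1) by (simp add: w \<rho>_def)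
    show ?thesis
    proof (cases "linked \<rho> (set u) (set v)")
      case True
      \<comment> \<open>This is the case of positive genus. \<open>z\<close> has four letters fewer
        than \<open>w\<close> while the loop count is unchanged, so the bound holds with 4 to
        spare.\<close>
      have "distinct (concat (u # v # []))" "\<rho> \<in> pairings_on (set (concat (u # v # [])))" using d \<rho> by auto
      then obtain z \<rho>' where z: "distinct (concat [z])" "length z + 2 = length u + length v"
          "\<rho>' \<in> pairings_on (set (concat [z]))" "loops [u, v] \<rho> = loops [z] \<rho>'"
        using loops_merge_linked[OF _ _ True, of "[]"] by metis
      have "2 * loops [z] \<rho>' \<le> length z + 2" by (rule less.hyps) (use z in \<open>auto simp: w\<close>)
      then show ?thesis using z(2,4) eq by (simp add: w)
    next
      case False
      obtain \<rho>1 \<rho>2 where \<rho>12: "\<rho> = \<rho>1 \<union> \<rho>2" "\<rho>1 \<in> pairings_on (set u)" "\<rho>2 \<in> pairings_on (set v)"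
        using unlinked_split[OF \<rho> _ False] d by auto
      have "loops ([u] @ [v]) (\<rho>1 \<union> \<rho>2) = loops [u] \<rho>1 + loops [v] \<rho>2"
        by (rule loops_union) (use \<rho>12 d in auto)
      moreover have "2 * loops [u] \<rho>1 \<le> length u + 2" by (rule less.hyps) (use \<rho>12 d in \<open>auto simp: w\<close>)
      moreover have "2 * loops [v] \<rho>2 \<le> length v + 2" by (rule less.hyps) (use \<rho>12 d in \<open>auto simp: w\<close>)
      ultimately show ?thesis using eq \<rho>12(1) by (simp add: w)
    qed
  qed
qed

lemma loops_annulus_le:
  assumes "distinct (w @ w')" "\<pi> \<in> pairings_on (set w \<union> set w')" "linked \<pi> (set w) (set w')"
  shows "2 * loops [w, w'] \<pi> \<le> length w + length w'"
proof -
  have "distinct (concat (w # w' # []))" "\<pi> \<in> pairings_on (set (concat (w # w' # [])))" using assms by auto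
  then obtain z \<rho> where z: "distinct (concat [z])" "length z + 2 = length w + length w'"
      "\<rho> \<in> pairings_on (set (concat [z]))" "loops [w, w'] \<pi> = loops [z] \<rho>"
    using loops_merge_linked[OF _ _ assms(3), of "[]"] by metis
  then show ?thesis using loops_disc_le[of z \<rho>] by simp
qed

lemma loops_three_le:
  assumes d: "distinct (u @ v @ w)" and \<pi>: "\<pi> \<in> pairings_on (set u \<union> set v \<union> set w)"
    and l: "linked \<pi> (set u) (set v)" "linked \<pi> (set u) (set w)"
  shows "2 * loops [u, v, w] \<pi> + 2 \<le> length u + length v + length w"
proof -
  have "distinct (concat (u # v # [w]))" "\<pi> \<in> pairings_on (set (concat (u # v # [w])))"
    using d \<pi> by (auto simp: Un_assoc)
  then obtain z \<rho> where z: "distinct (concat (z # [w]))" "length z + 2 = length u + length v"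
      "\<rho> \<in> pairings_on (set (concat (z # [w])))" "loops (u # v # [w]) \<pi> = loops (z # [w]) \<rho>"
      "linked \<pi> (set u \<union> set v) (set (concat [w])) \<Longrightarrow> linked \<rho> (set z) (set (concat [w]))"
    using loops_merge_linked[OF _ _ l(1), of "[w]"] by metis
  have "linked \<rho> (set z) (set w)" using z(5) l(2) by (auto simp: linked_def)
  then have "2 * loops [z, w] \<rho> \<le> length z + length w" using loops_annulus_le[of z w \<rho>] z(1,3) by simp
  then show ?thesis using z(2,4) by simp
qed

section \<open>Genus zero: pairings that attain the Euler bounds\<close>

definition planar :: "nat list \<Rightarrow> nat set set set" where
  "planar w = {\<pi> \<in> pairings_on (set w). 2 * loops [w] \<pi> = length w + 2}"

definition annular :: "nat list \<Rightarrow> nat list \<Rightarrow> nat set set set" where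
  "annular w w' = {\<pi> \<in> pairings_on (set w \<union> set w').
     2 * loops [w, w'] \<pi> = length w + length w' \<and> linked \<pi> (set w) (set w')}"

lemma planar_Nil: "planar [] = {{}}"
  by (auto simp: planar_def pairings_on_empty loops_empty)

lemma planar_rotate: "distinct (u @ v) \<Longrightarrow> planar (u @ v) = planar (v @ u)"
  using loops_rotate[of u v "[]"] by (auto simp: planar_def Un_commute)

lemma annular_Nil: "annular [] w' = {}"
  by (auto simp: annular_def linked_def)

definition join_pair :: "nat \<Rightarrow> nat \<Rightarrow> nat set set set \<Rightarrow> nat set set set \<Rightarrow> nat set set set" where
  "join_pair x y P Q = (\<lambda>(\<pi>, \<rho>). insert {x, y} (\<pi> \<union> \<rho>)) ` (P \<times> Q)"

lemma join_pairI: "\<pi> \<in> P \<Longrightarrow> \<rho> \<in> Q \<Longrightarrow> insert {x, y} (\<pi> \<union> \<rho>) \<in> join_pair x y P Q"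
  by (auto simp: join_pair_def)

lemma remove_pair_split:
  assumes \<pi>: "\<pi> \<in> pairings_on S" and xy: "{x, y} \<in> \<pi>" and S: "S - {x, y} = T"
  shows "\<pi> - {{x, y}} \<in> pairings_on T" "\<pi> = insert {x, y} (\<pi> - {{x, y}})"
  using pairings_on_remove[OF \<pi> xy] xy S by auto

lemma insert_pair_union:
  assumes d: "distinct (x # u @ y # v)"
    and 12: "\<rho>1 \<in> pairings_on (set u)" "\<rho>2 \<in> pairings_on (set v)"
  shows "insert {x, y} (\<rho>1 \<union> \<rho>2) \<in> pairings_on (set (x # u @ y # v))" "{x, y} \<notin> \<rho>1 \<union> \<rho>2"
proof -
  have \<rho>: "\<rho>1 \<union> \<rho>2 \<in> pairings_on (set u \<union> set v)" by (rule pairings_on_union[OF 12]) (use d in auto)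
  then show "insert {x, y} (\<rho>1 \<union> \<rho>2) \<in> pairings_on (set (x # u @ y # v))"
    using pairings_on_insert[OF \<rho>, of x y] d by (auto simp: insert_commute)
  show "{x, y} \<notin> \<rho>1 \<union> \<rho>2" using pairings_onD(3)[OF \<rho>, of "{x, y}"] d by auto
qed

text \<open>Removing the pair leaves two circles with the same loop count. If they were linked, the
  annulus bound would keep the count too small; if not, the count is a sum of two disc counts whose
  bounds add up exactly to the required value, so both are attained.\<close>

lemma planar_step:
  assumes d: "distinct (x # u @ y # v)"
  shows "{\<pi> \<in> planar (x # u @ y # v). {x, y} \<in> \<pi>} = join_pair x y (planar u) (planar v)"
proof (intro equalityI subsetI)
  fix \<pi> assume "\<pi> \<in> {\<pi> \<in> planar (x # u @ y # v). {x, y} \<in> \<pi>}"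
  then have \<pi>: "\<pi> \<in> pairings_on (set (x # u @ y # v))" and xy: "{x, y} \<in> \<pi>"
    and n: "2 * loops [x # u @ y # v] \<pi> = length (x # u @ y # v) + 2"
    by (auto simp: planar_def)
  define \<rho> where "\<rho> = \<pi> - {{x, y}}"
  have "set (x # u @ y # v) - {x, y} = set u \<union> set v" using d by auto
  from remove_pair_split[OF \<pi> xy this]
  have \<rho>: "\<rho> \<in> pairings_on (set u \<union> set v)" "\<pi> = insert {x, y} \<rho>" by (simp_all add: \<rho>_def)
  have eq: "loops [x # u @ y # v] \<pi> = loops [u, v] \<rho>"
    using loops_split[of x u y v "[]" \<pi>] d \<pi> xy by (simp add: \<rho>_def)
  have "\<not> linked \<rho> (set u) (set v)" using loops_annulus_le[of u v \<rho>] d \<rho>(1) eq n by auto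
  then obtain \<rho>1 \<rho>2 where \<rho>12: "\<rho> = \<rho>1 \<union> \<rho>2" "\<rho>1 \<in> pairings_on (set u)" "\<rho>2 \<in> pairings_on (set v)"
    using unlinked_split[OF \<rho>(1)] d by auto
  have "loops ([u] @ [v]) (\<rho>1 \<union> \<rho>2) = loops [u] \<rho>1 + loops [v] \<rho>2" by (rule loops_union) (use \<rho>12 d in auto)
  moreover have "2 * loops [u] \<rho>1 \<le> length u + 2" by (rule loops_disc_le) (use \<rho>12 d in auto)
  moreover have "2 * loops [v] \<rho>2 \<le> length v + 2" by (rule loops_disc_le) (use \<rho>12 d in auto)
  ultimately have "\<rho>1 \<in> planar u" "\<rho>2 \<in> planar v" using eq n \<rho>12 by (auto simp: planar_def)
  then show "\<pi> \<in> join_pair x y (planar u) (planar v)" unfolding \<rho>(2) \<rho>12(1) by (rule join_pairI)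
next
  fix \<pi> assume "\<pi> \<in> join_pair x y (planar u) (planar v)"
  then obtain \<rho>1 \<rho>2 where \<pi>: "\<pi> = insert {x, y} (\<rho>1 \<union> \<rho>2)" and 12: "\<rho>1 \<in> planar u" "\<rho>2 \<in> planar v"
    by (auto simp: join_pair_def)
  have \<pi>S: "\<pi> \<in> pairings_on (set (x # u @ y # v))" and "{x, y} \<notin> \<rho>1 \<union> \<rho>2"
    using insert_pair_union[OF d, of \<rho>1 \<rho>2] 12 by (simp_all add: \<pi> planar_def)
  then have "loops [x # u @ y # v] \<pi> = loops [u, v] (\<rho>1 \<union> \<rho>2)"
    using loops_split[of x u y v "[]" \<pi>] d \<pi>S by (simp add: \<pi>)
  moreover have "loops ([u] @ [v]) (\<rho>1 \<union> \<rho>2) = loops [u] \<rho>1 + loops [v] \<rho>2"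
    by (rule loops_union) (use 12 d in \<open>auto simp: planar_def\<close>)
  ultimately show "\<pi> \<in> {\<pi> \<in> planar (x # u @ y # v). {x, y} \<in> \<pi>}" using 12 \<pi>S by (auto simp: planar_def \<pi>)
qed

text \<open>The bounds for the disc \<open>u\<close> and for the annulus \<open>v\<close>,
  \<open>w\<close> add up to the prescribed value, so neither can be strict.\<close>

lemma loops_disc_annulus_extremal:
  assumes d: "distinct (u @ v @ w)" and \<rho>: "\<rho> \<in> pairings_on (set u \<union> set v \<union> set w)"
    and l: "linked \<rho> (set v) (set w)" "\<not> linked \<rho> (set u) (set v)" "\<not> linked \<rho> (set u) (set w)"
    and n: "2 * loops [u, v, w] \<rho> = length u + length v + length w + 2"
  obtains \<rho>1 \<rho>2 where "\<rho> = \<rho>1 \<union> \<rho>2" "\<rho>1 \<in> planar u" "\<rho>2 \<in> annular v w"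
proof -
  obtain \<rho>1 \<rho>2 where \<rho>12: "\<rho> = \<rho>1 \<union> \<rho>2" "\<rho>1 \<in> pairings_on (set u)"
      "\<rho>2 \<in> pairings_on (set v \<union> set w)"
    using unlinked_split[of \<rho> "set u" "set v \<union> set w"] \<rho> d l(2,3) by (auto simp: Un_assoc linked_Un_right)
  have v2: "linked \<rho>2 (set v) (set w)"
    using l(1) \<rho>12 pairings_onD(3)[OF \<rho>12(2)] d by (fastforce simp: linked_def)
  have "loops ([u] @ [v, w]) (\<rho>1 \<union> \<rho>2) = loops [u] \<rho>1 + loops [v, w] \<rho>2"
    by (rule loops_union) (use \<rho>12 d in auto)
  moreover have "2 * loops [u] \<rho>1 \<le> length u + 2" by (rule loops_disc_le) (use \<rho>12 d in auto)
  moreover have "2 * loops [v, w] \<rho>2 \<le> length v + length w"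
    by (rule loops_annulus_le) (use \<rho>12 d v2 in auto)
  ultimately have "\<rho>1 \<in> planar u" "\<rho>2 \<in> annular v w" using n \<rho>12 v2 by (auto simp: planar_def annular_def)
  then show ?thesis using that \<rho>12(1) by blast
qed

lemma planar_annular_union:
  assumes d: "distinct (u @ v @ w)" and "\<rho>1 \<in> planar u" "\<rho>2 \<in> annular v w"
  shows "\<rho>1 \<union> \<rho>2 \<in> pairings_on (set u \<union> set v \<union> set w)"
    and "2 * loops [u, v, w] (\<rho>1 \<union> \<rho>2) = length u + length v + length w + 2"
proof -
  have 12: "\<rho>1 \<in> pairings_on (set u)" "\<rho>2 \<in> pairings_on (set v \<union> set w)"
    "2 * loops [u] \<rho>1 = length u + 2" "2 * loops [v, w] \<rho>2 = length v + length w"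
    using assms(2,3) by (auto simp: planar_def annular_def)
  show "\<rho>1 \<union> \<rho>2 \<in> pairings_on (set u \<union> set v \<union> set w)"
    using pairings_on_union[OF 12(1,2)] d by (auto simp: Un_assoc)
  have "loops ([u] @ [v, w]) (\<rho>1 \<union> \<rho>2) = loops [u] \<rho>1 + loops [v, w] \<rho>2"
    by (rule loops_union) (use 12 d in auto)
  then show "2 * loops [u, v, w] (\<rho>1 \<union> \<rho>2) = length u + length v + length w + 2" using 12 by simp
qed

text \<open>Three circles remain, with twice the loop count equal to the total length plus 2,
  whereas a connected triple reaches at most the total length minus 2. Some through string survives,
  so exactly one of \<open>u\<close> and \<open>v\<close> stays linked to \<open>w'\<close>, and the
  other is a planar disc.\<close>

lemma annular_step_same:
  assumes d: "distinct ((x # u @ y # v) @ w')"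
  shows "{\<pi> \<in> annular (x # u @ y # v) w'. {x, y} \<in> \<pi>} =
    join_pair x y (planar u) (annular v w') \<union> join_pair x y (annular u w') (planar v)"
proof (intro equalityI subsetI)
  fix \<pi> assume "\<pi> \<in> {\<pi> \<in> annular (x # u @ y # v) w'. {x, y} \<in> \<pi>}"
  then have \<pi>: "\<pi> \<in> pairings_on (set (x # u @ y # v) \<union> set w')" and xy: "{x, y} \<in> \<pi>"
    and n: "2 * loops [x # u @ y # v, w'] \<pi> = length (x # u @ y # v) + length w'"
    and l: "linked \<pi> (set (x # u @ y # v)) (set w')"
    by (auto simp: annular_def)
  define \<rho> where "\<rho> = \<pi> - {{x, y}}"
  have "set (x # u @ y # v) \<union> set w' - {x, y} = set u \<union> set v \<union> set w'" using d by auto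
  from remove_pair_split[OF \<pi> xy this]
  have \<rho>: "\<rho> \<in> pairings_on (set u \<union> set v \<union> set w')" "\<pi> = insert {x, y} \<rho>" by (simp_all add: \<rho>_def)
  have eq: "loops [x # u @ y # v, w'] \<pi> = loops [u, v, w'] \<rho>"
    using loops_split[of x u y v "[w']" \<pi>] d \<pi> xy by (simp add: \<rho>_def Un_assoc)
  have n': "2 * loops [u, v, w'] \<rho> = length u + length v + length w' + 2" using n eq by simp
  have l': "linked \<rho> (set u) (set w') \<or> linked \<rho> (set v) (set w')"
  proof -
    obtain p q where pq: "p \<in> set (x # u @ y # v)" "q \<in> set w'" "{p, q} \<in> \<pi>"
      using l by (auto simp: linked_def)
    have "{p, q} \<noteq> {x, y}" using pq(2) d by (auto simp: doubleton_eq_iff)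
    moreover from this have "p \<noteq> x" "p \<noteq> y" using pairings_onD(4)[OF \<pi> pq(3) xy, of p] by auto
    ultimately show ?thesis using pq unfolding \<rho>_def linked_def by auto
  qed
  have eqs: "loops [u, v, w'] = loops [v, u, w']" "loops [u, v, w'] = loops [w', u, v]"
    using loops_swap[of u v "[w']"] loops_swap2[of v w' u "[]"] loops_swap[of u w' "[v]"] d by auto
  \<comment> \<open>One instance of the three-circle bound for each circle that could be linked to
    both others.\<close>
  have 3: "\<not> (linked \<rho> (set u) (set v) \<and> linked \<rho> (set u) (set w'))"
    "\<not> (linked \<rho> (set v) (set u) \<and> linked \<rho> (set v) (set w'))"
    "\<not> (linked \<rho> (set w') (set u) \<and> linked \<rho> (set w') (set v))"
    using loops_three_le[of u v w' \<rho>] loops_three_le[of v u w' \<rho>] loops_three_le[of w' u v \<rho>]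
      d \<rho>(1) n' eqs by (auto simp: ac_simps)
  from l' show "\<pi> \<in> join_pair x y (planar u) (annular v w') \<union> join_pair x y (annular u w') (planar v)"
  proof
    assume v: "linked \<rho> (set v) (set w')"
    have "\<not> linked \<rho> (set u) (set v)" "\<not> linked \<rho> (set u) (set w')" using 3 v by (auto simp: linked_commute)
    with v obtain \<rho>1 \<rho>2 where "\<rho> = \<rho>1 \<union> \<rho>2" "\<rho>1 \<in> planar u" "\<rho>2 \<in> annular v w'"
      using loops_disc_annulus_extremal[of u v w' \<rho>] d \<rho>(1) n' by auto
    then show ?thesis unfolding \<rho>(2) by (blast intro: join_pairI)
  next
    assume u: "linked \<rho> (set u) (set w')"
    have "\<not> linked \<rho> (set v) (set u)" "\<not> linked \<rho> (set v) (set w')" using 3 u by (auto simp: linked_commute)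
    moreover have "\<rho> \<in> pairings_on (set v \<union> set u \<union> set w')" using \<rho>(1) by (simp add: Un_commute)
    moreover have "distinct (v @ u @ w')" using d by auto
    moreover have "2 * loops [v, u, w'] \<rho> = length v + length u + length w' + 2" using n' eqs(1) by simp
    ultimately obtain \<rho>2 \<rho>1 where "\<rho> = \<rho>2 \<union> \<rho>1" "\<rho>2 \<in> planar v" "\<rho>1 \<in> annular u w'"
      using loops_disc_annulus_extremal[of v u w' \<rho>] u by metis
    then show ?thesis unfolding \<rho>(2) by (metis UnI2 Un_commute join_pairI)
  qed
next
  fix \<pi>
  assume "\<pi> \<in> join_pair x y (planar u) (annular v w') \<union> join_pair x y (annular u w') (planar v)"
  then obtain \<rho>1 \<rho>2 where \<pi>: "\<pi> = insert {x, y} (\<rho>1 \<union> \<rho>2)"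
    and 12: "(\<rho>1 \<in> planar u \<and> \<rho>2 \<in> annular v w') \<or> (\<rho>1 \<in> annular u w' \<and> \<rho>2 \<in> planar v)"
    by (auto simp: join_pair_def)
  have duv: "distinct (u @ v @ w')" "distinct (v @ u @ w')" using d by auto
  have swap: "loops [u, v, w'] = loops [v, u, w']" using loops_swap[of u v "[w']"] d by auto
  have "\<rho>1 \<union> \<rho>2 \<in> pairings_on (set u \<union> set v \<union> set w') \<and>
      2 * loops [u, v, w'] (\<rho>1 \<union> \<rho>2) = length u + length v + length w' + 2" using 12
  proof (elim disjE conjE)
    assume "\<rho>1 \<in> annular u w'" "\<rho>2 \<in> planar v"
    then show ?thesis unfolding swap Un_commute[of \<rho>1] Un_commute[of "set u"]
      using planar_annular_union[OF duv(2), of \<rho>2 \<rho>1] by simp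
  qed (simp add: planar_annular_union[OF duv(1)])
  then have \<rho>: "\<rho>1 \<union> \<rho>2 \<in> pairings_on (set u \<union> set v \<union> set w')"
    and 2: "2 * loops [u, v, w'] (\<rho>1 \<union> \<rho>2) = length u + length v + length w' + 2" by blast+
  have \<pi>S: "\<pi> \<in> pairings_on (set (x # u @ y # v) \<union> set w')"
    using pairings_on_insert[OF \<rho>, of x y] d by (auto simp: \<pi> insert_commute Un_assoc)
  have "{x, y} \<notin> \<rho>1 \<union> \<rho>2" using pairings_onD(3)[OF \<rho>, of "{x, y}"] d by auto
  then have 1: "loops [x # u @ y # v, w'] \<pi> = loops [u, v, w'] (\<rho>1 \<union> \<rho>2)"
    using loops_split[of x u y v "[w']" \<pi>] d \<pi>S by (simp add: \<pi> Un_assoc)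
  have "linked \<pi> (set (x # u @ y # v)) (set w')" using 12 by (auto simp: \<pi> annular_def linked_def)
  then show "\<pi> \<in> {\<pi> \<in> annular (x # u @ y # v) w'. {x, y} \<in> \<pi>}" using 1 2 \<pi>S by (auto simp: annular_def \<pi>)
qed

text \<open>The removed pair is itself a through string, so no linking condition is left over: the
  fused circle carries an arbitrary planar pairing. The factor \<open>{{}}\<close> only gives the
  right side the shape of \<open>join_pair\<close>.\<close>

lemma annular_step_cross:
  assumes d: "distinct ((x # w) @ u @ y # v)"
  shows "{\<pi> \<in> annular (x # w) (u @ y # v). {x, y} \<in> \<pi>} = join_pair x y (planar (w @ v @ u)) {{}}"
proof (intro equalityI subsetI)
  fix \<pi> assume "\<pi> \<in> {\<pi> \<in> annular (x # w) (u @ y # v). {x, y} \<in> \<pi>}"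
  then have \<pi>: "\<pi> \<in> pairings_on (set (x # w) \<union> set (u @ y # v))" and xy: "{x, y} \<in> \<pi>"
    and n: "2 * loops [x # w, u @ y # v] \<pi> = length (x # w) + length (u @ y # v)"
    by (auto simp: annular_def)
  define \<rho> where "\<rho> = \<pi> - {{x, y}}"
  have "set (x # w) \<union> set (u @ y # v) - {x, y} = set (w @ v @ u)" using d by auto
  then have \<rho>: "\<rho> \<in> pairings_on (set (w @ v @ u))" "\<pi> = insert {x, y} \<rho>"
    using pairings_on_remove[OF \<pi> xy] xy by (auto simp: \<rho>_def)
  have "loops [x # w, u @ y # v] \<pi> = loops [w @ v @ u] \<rho>"
    using loops_merge[of x w u y v "[]" \<pi>] d \<pi> xy by (simp add: \<rho>_def Int_Un_distrib insert_commute)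
  then have "\<rho> \<in> planar (w @ v @ u)" using \<rho>(1) n by (simp add: planar_def)
  then show "\<pi> \<in> join_pair x y (planar (w @ v @ u)) {{}}"
    using join_pairI[of \<rho> "planar (w @ v @ u)" "{}" "{{}}" x y] \<rho>(2) by simp
next
  fix \<pi> assume "\<pi> \<in> join_pair x y (planar (w @ v @ u)) {{}}"
  then obtain \<rho> where \<pi>: "\<pi> = insert {x, y} \<rho>" and "\<rho> \<in> planar (w @ v @ u)" by (auto simp: join_pair_def)
  then have \<rho>: "\<rho> \<in> pairings_on (set (w @ v @ u))" "2 * loops [w @ v @ u] \<rho> = length (w @ v @ u) + 2"
    by (auto simp: planar_def)
  have "insert x (insert y (set (w @ v @ u))) = set (x # w) \<union> set (u @ y # v)" by auto
  then have \<pi>S: "\<pi> \<in> pairings_on (set (x # w) \<union> set (u @ y # v))"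
    using pairings_on_insert[OF \<rho>(1), of x y] d by (auto simp: \<pi>)
  have "{x, y} \<notin> \<rho>" using pairings_onD(3)[OF \<rho>(1), of "{x, y}"] d by auto
  then have "loops [x # w, u @ y # v] \<pi> = loops [w @ v @ u] \<rho>"
    using loops_merge[of x w u y v "[]" \<pi>] d \<pi>S by (simp add: \<pi> insert_commute Int_Un_distrib)
  moreover have "linked \<pi> (set (x # w)) (set (u @ y # v))" by (auto simp: linked_def \<pi>)
  ultimately show "\<pi> \<in> {\<pi> \<in> annular (x # w) (u @ y # v). {x, y} \<in> \<pi>}"
    using \<pi>S \<rho>(2) by (auto simp: annular_def \<pi>)
qed

section \<open>Non-crossing pairings are the planar ones\<close>

definition noncrossing_on :: "nat set \<Rightarrow> nat set set set" where
  "noncrossing_on S = {\<pi> \<in> pairings_on S.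
     \<not> (\<exists>a b c d. a < b \<and> b < c \<and> c < d \<and> {a, c} \<in> \<pi> \<and> {b, d} \<in> \<pi>)}"

lemma NC2_eq: "NC2 n = noncrossing_on {1..n}"
  by (simp add: NC2_def noncrossing_on_def pairings_eq)

text \<open>As \<open>x\<close> is the least label, a pair crosses \<open>{x, y}\<close> exactly
  when it joins a label between \<open>x\<close> and \<open>y\<close> to one beyond
  \<open>y\<close>, that is, \<open>u\<close> to \<open>v\<close>.\<close>

lemma noncrossing_step:
  assumes s: "sorted_wrt (<) (x # u @ y # v)"
  shows "{\<pi> \<in> noncrossing_on (set (x # u @ y # v)). {x, y} \<in> \<pi>} =
    join_pair x y (noncrossing_on (set u)) (noncrossing_on (set v))"
proof (intro equalityI subsetI)
  have ord: "x < y" "\<And>p. p \<in> set u \<Longrightarrow> x < p \<and> p < y" "\<And>q. q \<in> set v \<Longrightarrow> y < q"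
    using s by (auto simp: sorted_wrt_append)
  have d: "distinct (x # u @ y # v)" using s strict_sorted_iff by blast
  fix \<pi>
  {
    assume "\<pi> \<in> {\<pi> \<in> noncrossing_on (set (x # u @ y # v)). {x, y} \<in> \<pi>}"
    then have \<pi>: "\<pi> \<in> pairings_on (set (x # u @ y # v))" and xy: "{x, y} \<in> \<pi>"
      and nc: "\<And>a b c d. a < b \<Longrightarrow> b < c \<Longrightarrow> c < d \<Longrightarrow> {a, c} \<in> \<pi> \<Longrightarrow> {b, d} \<notin> \<pi>"
      unfolding noncrossing_on_def by blast+
    define \<rho> where "\<rho> = \<pi> - {{x, y}}"
    have "set (x # u @ y # v) - {x, y} = set u \<union> set v" using d by auto
    from remove_pair_split[OF \<pi> xy this]
    have \<rho>: "\<rho> \<in> pairings_on (set u \<union> set v)" "\<pi> = insert {x, y} \<rho>" by (simp_all add: \<rho>_def)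
    have "\<not> linked \<rho> (set u) (set v)" using nc[OF _ _ _ xy] ord unfolding linked_def \<rho>_def by blast
    then obtain \<rho>1 \<rho>2 where \<rho>12: "\<rho> = \<rho>1 \<union> \<rho>2" "\<rho>1 \<in> pairings_on (set u)" "\<rho>2 \<in> pairings_on (set v)"
      using unlinked_split[OF \<rho>(1)] d by auto
    have "\<rho>1 \<in> noncrossing_on (set u)" "\<rho>2 \<in> noncrossing_on (set v)"
      using \<rho>12 nc unfolding \<rho>(2) noncrossing_on_def by blast+
    then show "\<pi> \<in> join_pair x y (noncrossing_on (set u)) (noncrossing_on (set v))"
      unfolding \<rho>(2) \<rho>12(1) by (rule join_pairI)
  next
    assume "\<pi> \<in> join_pair x y (noncrossing_on (set u)) (noncrossing_on (set v))"
    then obtain \<rho>1 \<rho>2 where \<pi>: "\<pi> = insert {x, y} (\<rho>1 \<union> \<rho>2)"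
      and 12: "\<rho>1 \<in> noncrossing_on (set u)" "\<rho>2 \<in> noncrossing_on (set v)"
      by (auto simp: join_pair_def)
    have 1: "\<rho>1 \<in> pairings_on (set u)" "\<rho>2 \<in> pairings_on (set v)"
      and nc: "\<And>a b c d. a < b \<Longrightarrow> b < c \<Longrightarrow> c < d \<Longrightarrow> {a, c} \<in> \<rho>1 \<Longrightarrow> {b, d} \<notin> \<rho>1"
        "\<And>a b c d. a < b \<Longrightarrow> b < c \<Longrightarrow> c < d \<Longrightarrow> {a, c} \<in> \<rho>2 \<Longrightarrow> {b, d} \<notin> \<rho>2"
      using 12 unfolding noncrossing_on_def by blast+
    have \<pi>S: "\<pi> \<in> pairings_on (set (x # u @ y # v))" unfolding \<pi> by (rule insert_pair_union[OF d 1])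
    have False if abcd: "a < b" "b < c" "c < d" "{a, c} \<in> \<pi>" "{b, d} \<in> \<pi>" for a b c d
    proof -
      have uv: "{p, q} \<in> \<rho>1 \<Longrightarrow> p \<in> set u \<and> q \<in> set u"
        "{p, q} \<in> \<rho>2 \<Longrightarrow> p \<in> set v \<and> q \<in> set v" for p q
        using pairings_onD(3)[OF 1(1), of "{p, q}"] pairings_onD(3)[OF 1(2), of "{p, q}"] by auto
      consider "{a, c} = {x, y}" | "{b, d} = {x, y}"
        | "{a, c} \<in> \<rho>1 \<union> \<rho>2" "{b, d} \<in> \<rho>1 \<union> \<rho>2" using abcd by (auto simp: \<pi>)
      then show False
      proof cases
        case 1
        then have ac: "a = x" "c = y" using ord(1) abcd by (auto simp: doubleton_eq_iff)
        have "{b, d} \<noteq> {x, y}" using ac abcd by (auto simp: doubleton_eq_iff)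
        then have "{b, d} \<in> \<rho>1 \<or> {b, d} \<in> \<rho>2" using abcd by (auto simp: \<pi>)
        then show False using uv[of b d] ord(2)[of d] ord(3)[of b] ac abcd by auto
      next
        case 2
        then have bd: "b = x" "d = y" using ord(1) abcd by (auto simp: doubleton_eq_iff)
        have "{a, c} \<noteq> {x, y}" using bd abcd by (auto simp: doubleton_eq_iff)
        then have "{a, c} \<in> \<rho>1 \<or> {a, c} \<in> \<rho>2" using abcd by (auto simp: \<pi>)
        then show False using uv[of a c] ord(1) ord(2)[of a] ord(3)[of a] bd abcd by auto
      next
        case 3
        have "\<not> ({a, c} \<in> \<rho>1 \<and> {b, d} \<in> \<rho>1)" using nc(1)[OF abcd(1-3)] by blast
        moreover have "\<not> ({a, c} \<in> \<rho>2 \<and> {b, d} \<in> \<rho>2)" using nc(2)[OF abcd(1-3)] by blast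
        moreover have "\<not> ({a, c} \<in> \<rho>1 \<and> {b, d} \<in> \<rho>2)"
          using uv(1)[of a c] uv(2)[of b d] ord(2)[of c] ord(3)[of b] abcd(2) by auto
        moreover have "\<not> ({a, c} \<in> \<rho>2 \<and> {b, d} \<in> \<rho>1)"
          using uv(2)[of a c] uv(1)[of b d] ord(2)[of d] ord(3)[of c] abcd(3) by auto
        ultimately show False using 3 by blast
      qed
    qed
    then have "\<pi> \<in> noncrossing_on (set (x # u @ y # v))" using \<pi>S unfolding noncrossing_on_def by blast
    then show "\<pi> \<in> {\<pi> \<in> noncrossing_on (set (x # u @ y # v)). {x, y} \<in> \<pi>}" by (simp add: \<pi>)
  }
qed

text \<open>Crossings are defined through the order of the labels, planarity through a cycle count.
  Both families obey the same recursion on the partner of the first label, hence they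
  coincide.\<close>

lemma noncrossing_eq_planar:
  assumes "sorted_wrt (<) w"
  shows "noncrossing_on (set w) = planar w"
  using assms
proof (induction "length w" arbitrary: w rule: less_induct)
  case less
  show ?case
  proof (cases w)
    case Nil
    then show ?thesis by (auto simp: noncrossing_on_def pairings_on_empty planar_Nil)
  next
    case (Cons x w0)
    have d: "distinct w" using less.prems strict_sorted_iff by blast
    have eq: "{\<pi> \<in> noncrossing_on (set w). {x, y} \<in> \<pi>} = {\<pi> \<in> planar w. {x, y} \<in> \<pi>}"
      if yw: "y \<in> set w0" for y
    proof -
      obtain u v where w0: "w0 = u @ y # v" using split_list[OF yw] by blast
      have w: "w = x # u @ y # v" using Cons w0 by simp
      have "sorted_wrt (<) u" "sorted_wrt (<) v" using less.prems by (auto simp: w sorted_wrt_append)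
      then have "noncrossing_on (set u) = planar u" "noncrossing_on (set v) = planar v"
        using less.hyps by (auto simp: w)
      then show ?thesis
        using noncrossing_step[of x u y v] planar_step[of x u y v] less.prems d by (simp only: w)
    qed
    have mem: "\<pi> \<in> A \<longleftrightarrow> (\<exists>y\<in>set w0. \<pi> \<in> {\<pi> \<in> A. {x, y} \<in> \<pi>})"
      if "A \<subseteq> pairings_on (set w)" for A \<pi>
      using that pairings_on_partner[of \<pi> "set w" x] Cons by auto
    have "noncrossing_on (set w) \<subseteq> pairings_on (set w)" "planar w \<subseteq> pairings_on (set w)"
      by (auto simp: noncrossing_on_def planar_def)
    then show ?thesis using mem eq by blast
  qed
qed

lemma NC2_eq_planar: "NC2 n = planar [1..<Suc n]"
proof -
  have "{1..n} = set [1..<Suc n]" by auto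
  moreover have "noncrossing_on (set [1..<Suc n]) = planar [1..<Suc n]"
    by (rule noncrossing_eq_planar) (rule sorted_wrt_upt)
  ultimately show ?thesis by (simp only: NC2_eq)
qed

section \<open>Annular non-crossing pairings as genus-zero pairings of two circles\<close>

lemma cycle_of_list_upt:
  "cyc [a..<Suc (a + d)] k =
    (if k = a + d then a else if a \<le> k \<and> k < a + d then Suc k else k)"
proof (induction d arbitrary: a)
  case (Suc d)
  have "[a..<Suc (a + Suc d)] = a # [Suc a..<Suc (Suc a + d)]" by (simp add: upt_conv_Cons)
  moreover have "[Suc a..<Suc (Suc a + d)] = Suc a # [Suc (Suc a)..<Suc (Suc a + d)]"
    by (simp add: upt_conv_Cons)
  ultimately have "cyc [a..<Suc (a + Suc d)] k =
      Transposition.transpose a (Suc a) (cyc [Suc a..<Suc (Suc a + d)] k)"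
    by (metis cycle_of_list.simps(1) comp_apply)
  then show ?case unfolding Suc.IH[of "Suc a"] by (auto simp: Transposition.transpose_def)
qed auto

lemma annular_cycle_eq:
  assumes "1 \<le> m" "1 \<le> n"
  shows "annular_cycle m n = circle_perm [[1..<Suc m], [Suc m..<Suc (m + n)]]"
proof
  fix k
  obtain m' n' where mn: "m = Suc m'" "n = Suc n'" using assms by (metis Suc_le_D One_nat_def)
  have "circle_perm [[1..<Suc m], [Suc m..<Suc (m + n)]] k =
      cyc [1..<Suc (1 + m')] (cyc [Suc m..<Suc (Suc m + n')] k)" by (simp add: mn)
  also have "\<dots> = annular_cycle m n k" unfolding cycle_of_list_upt annular_cycle_def by (auto simp: mn)
  finally show "annular_cycle m n k = circle_perm [[1..<Suc m], [Suc m..<Suc (m + n)]] k" by simp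
qed

text \<open>Both circles are nonempty, so the empty-circle term of \<open>loops\<close> vanishes and
  what remains is the cycle count of the definition.\<close>

lemma NC2_annular_eq:
  assumes mn: "1 \<le> m" "1 \<le> n"
  shows "NC2_annular m n = annular [1..<Suc m] [Suc m..<Suc (m + n)]"
proof -
  have S: "set [1..<Suc m] \<union> set [Suc m..<Suc (m + n)] = {1..m + n}" by auto
  have len: "length [1..<Suc m] + length [Suc m..<Suc (m + n)] = m + n" by simp
  have 1: "loops [[1..<Suc m], [Suc m..<Suc (m + n)]] \<pi> =
      num_cycles (m + n) (annular_cycle m n \<circ> pairing_perm \<pi>)" for \<pi>
  proof -
    have "set (concat [[1..<Suc m], [Suc m..<Suc (m + n)]]) = {1..m + n}" by auto
    moreover have "count_list [[1..<Suc m], [Suc m..<Suc (m + n)]] [] = 0" using mn by simp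
    ultimately show ?thesis
      unfolding loops_def num_cycles_def cycles_on_def annular_cycle_eq[OF mn] by (simp only: add_0_right)
  qed
  have 2: "linked \<pi> (set [1..<Suc m]) (set [Suc m..<Suc (m + n)]) \<longleftrightarrow>
      (\<exists>u v. {u, v} \<in> \<pi> \<and> u \<le> m \<and> m < v)" if "\<pi> \<in> pairings_on {1..m + n}" for \<pi>
  proof
    assume "\<exists>u v. {u, v} \<in> \<pi> \<and> u \<le> m \<and> m < v"
    then obtain u v where uv: "{u, v} \<in> \<pi>" "u \<le> m" "m < v" by blast
    then have "u \<in> {1..m + n}" "v \<in> {1..m + n}" using pairings_on_pair[OF that uv(1)] by auto
    then show "linked \<pi> (set [1..<Suc m]) (set [Suc m..<Suc (m + n)])"
      using uv unfolding linked_def by (intro bexI[of _ u] bexI[of _ v]) auto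
  next
    assume "linked \<pi> (set [1..<Suc m]) (set [Suc m..<Suc (m + n)])"
    then obtain u v where "u \<in> set [1..<Suc m]" "v \<in> set [Suc m..<Suc (m + n)]" "{u, v} \<in> \<pi>"
      unfolding linked_def by blast
    then show "\<exists>u v. {u, v} \<in> \<pi> \<and> u \<le> m \<and> m < v" by (intro exI[of _ u] exI[of _ v]) auto
  qed
  show ?thesis unfolding NC2_annular_def annular_def S pairings_eq 1 len by (rule Collect_cong) (metis 2)
qed

section \<open>Weighted sums over pairings and their recursions\<close>

definition pairing_sum :: "(nat set \<Rightarrow> real) \<Rightarrow> nat set set set \<Rightarrow> real" where
  "pairing_sum t P = (\<Sum>\<pi>\<in>P. \<Prod>B\<in>\<pi>. t B)"

text \<open>A joined pairing remembers its parts: the blocks inside \<open>S\<close>, the blocks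
  inside \<open>T\<close>, and \<open>{x, y}\<close> outside both. Hence joining is injective, and
  the weight of a joined pairing is a product.\<close>

lemma pairing_sum_join_pair:
  assumes P: "P \<subseteq> pairings_on S" and Q: "Q \<subseteq> pairings_on T" and fin: "finite S" "finite T"
    and dis: "S \<inter> T = {}" "x \<notin> S \<union> T" "y \<notin> S \<union> T"
  shows "pairing_sum t (join_pair x y P Q) = t {x, y} * pairing_sum t P * pairing_sum t Q"
proof -
  have nxy: "{x, y} \<notin> \<pi>" if "\<pi> \<in> pairings_on S \<or> \<pi> \<in> pairings_on T" for \<pi>
    using that pairings_onD(3)[of \<pi> S "{x, y}"] pairings_onD(3)[of \<pi> T "{x, y}"] dis by auto
  have nST: "\<not> B \<subseteq> T" if "\<pi> \<in> pairings_on S" "B \<in> \<pi>" for \<pi> B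
    using pairings_on_block[OF that] dis by (metis disjoint_iff insert_subset)
  have nTS: "\<not> B \<subseteq> S" if "\<pi> \<in> pairings_on T" "B \<in> \<pi>" for \<pi> B
    using pairings_on_block[OF that] dis by (metis disjoint_iff insert_subset)
  have PS: "\<pi> \<in> pairings_on S" if "\<pi> \<in> P" for \<pi> using that P by blast
  have QT: "\<rho> \<in> pairings_on T" if "\<rho> \<in> Q" for \<rho> using that Q by blast
  have xyST: "\<not> {x, y} \<subseteq> S" "\<not> {x, y} \<subseteq> T" using dis by auto
  have r1: "{B \<in> insert {x, y} (\<pi> \<union> \<rho>). B \<subseteq> S} = \<pi>" if "\<pi> \<in> P" "\<rho> \<in> Q" for \<pi> \<rho>
    using nTS[OF QT[OF that(2)]] pairings_onD(3)[OF PS[OF that(1)]] xyST by blast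
  have r2: "{B \<in> insert {x, y} (\<pi> \<union> \<rho>). B \<subseteq> T} = \<rho>" if "\<pi> \<in> P" "\<rho> \<in> Q" for \<pi> \<rho>
    using nST[OF PS[OF that(1)]] pairings_onD(3)[OF QT[OF that(2)]] xyST by blast
  have inj: "inj_on (\<lambda>(\<pi>, \<rho>). insert {x, y} (\<pi> \<union> \<rho>)) (P \<times> Q)"
  proof (rule inj_onI, clarify)
    fix \<pi> \<rho> \<pi>' \<rho>' assume a: "\<pi> \<in> P" "\<rho> \<in> Q" "\<pi>' \<in> P" "\<rho>' \<in> Q"
      "insert {x, y} (\<pi> \<union> \<rho>) = insert {x, y} (\<pi>' \<union> \<rho>')"
    show "\<pi> = \<pi>' \<and> \<rho> = \<rho>'" using trans[OF sym[OF r1[OF a(1,2), unfolded a(5)]] r1[OF a(3,4)]]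
        trans[OF sym[OF r2[OF a(1,2), unfolded a(5)]] r2[OF a(3,4)]] by (rule conjI)
  qed
  have pr: "(\<Prod>B\<in>insert {x, y} (\<pi> \<union> \<rho>). t B) = t {x, y} * ((\<Prod>B\<in>\<pi>. t B) * (\<Prod>B\<in>\<rho>. t B))"
    if "\<pi> \<in> P" "\<rho> \<in> Q" for \<pi> \<rho>
  proof -
    have "finite (\<Union>\<pi>)" "finite (\<Union>\<rho>)"
      using pairings_onD(1)[OF PS[OF that(1)]] pairings_onD(1)[OF QT[OF that(2)]] fin by simp_all
    then have f: "finite \<pi>" "finite \<rho>" by (auto dest: finite_UnionD)
    have "\<pi> \<inter> \<rho> = {}" using nTS[OF QT[OF that(2)]] pairings_onD(3)[OF PS[OF that(1)]] by blast
    moreover have "{x, y} \<notin> \<pi> \<union> \<rho>" using nxy[of \<pi>] nxy[of \<rho>] PS[OF that(1)] QT[OF that(2)] by blast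
    ultimately show ?thesis using f by (subst prod.insert) (simp_all add: prod.union_disjoint)
  qed
  have "pairing_sum t (join_pair x y P Q) =
      (\<Sum>z\<in>P \<times> Q. \<Prod>B\<in>(case z of (\<pi>, \<rho>) \<Rightarrow> insert {x, y} (\<pi> \<union> \<rho>)). t B)"
    unfolding pairing_sum_def join_pair_def by (subst sum.reindex[OF inj]) simp
  also have "\<dots> = (\<Sum>(\<pi>, \<rho>)\<in>P \<times> Q. t {x, y} * ((\<Prod>B\<in>\<pi>. t B) * (\<Prod>B\<in>\<rho>. t B)))" by (rule sum.cong) (auto simp: pr)
  also have "\<dots> = t {x, y} * pairing_sum t P * pairing_sum t Q"
    unfolding pairing_sum_def mult.assoc sum_product sum.cartesian_product
    by (simp only: sum_distrib_left case_prod_unfold)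
  finally show ?thesis .
qed

lemma pairing_sum_partner:
  assumes A: "A \<subseteq> pairings_on S" and fin: "finite S" and x: "x \<in> S"
  shows "pairing_sum t A = (\<Sum>y\<in>S - {x}. pairing_sum t {\<pi> \<in> A. {x, y} \<in> \<pi>})"
proof -
  have "A = (\<Union>y\<in>S - {x}. {\<pi> \<in> A. {x, y} \<in> \<pi>})" using pairings_on_partner[OF subsetD[OF A] x] by blast
  then have "pairing_sum t A = (\<Sum>\<pi>\<in>(\<Union>y\<in>S - {x}. {\<pi> \<in> A. {x, y} \<in> \<pi>}). \<Prod>B\<in>\<pi>. t B)"
    unfolding pairing_sum_def by simp
  also have "\<dots> = (\<Sum>y\<in>S - {x}. \<Sum>\<pi>\<in>{\<pi> \<in> A. {x, y} \<in> \<pi>}. \<Prod>B\<in>\<pi>. t B)"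
  proof (rule sum.UNION_disjoint)
    show "\<forall>y\<in>S - {x}. finite {\<pi> \<in> A. {x, y} \<in> \<pi>}"
      using finite_subset[OF A finite_pairings_on[OF fin]] by simp
    show "\<forall>y\<in>S - {x}. \<forall>z\<in>S - {x}. y \<noteq> z \<longrightarrow>
        {\<pi> \<in> A. {x, y} \<in> \<pi>} \<inter> {\<pi> \<in> A. {x, z} \<in> \<pi>} = {}"
    proof (intro ballI impI)
      fix y z assume "y \<in> S - {x}" "z \<in> S - {x}" "y \<noteq> z"
      then have "{x, y} \<noteq> {x, z}" by (auto simp: doubleton_eq_iff)
      then show "{\<pi> \<in> A. {x, y} \<in> \<pi>} \<inter> {\<pi> \<in> A. {x, z} \<in> \<pi>} = {}"
        using pairings_onD(4)[OF subsetD[OF A], of _ "{x, y}" "{x, z}" x] by blast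
    qed
  qed (use fin in auto)
  finally show ?thesis by (simp add: pairing_sum_def)
qed

lemma sum_set_nth: "distinct w \<Longrightarrow> (\<Sum>y\<in>set w. f y) = (\<Sum>k<length w. f (w ! k))"
  using sum.reindex_bij_betw[OF bij_betw_nth[of w "{..<length w}" "set w"], of f] by simp

text \<open>The Catalan recursion with weights, sorted by the partner of the first label.\<close>

lemma pairing_sum_planar_Cons:
  assumes d: "distinct (x # w)"
  shows "pairing_sum t (planar (x # w)) =
    (\<Sum>k<length w. t {x, w ! k} * pairing_sum t (planar (take k w)) * pairing_sum t (planar (drop (Suc k) w)))"
  (is "_ = ?R")
proof -
  have "planar (x # w) \<subseteq> pairings_on (set (x # w))" by (auto simp: planar_def)
  from pairing_sum_partner[OF this, of x t]
  have "pairing_sum t (planar (x # w)) =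
      (\<Sum>y\<in>set w. pairing_sum t {\<pi> \<in> planar (x # w). {x, y} \<in> \<pi>})" using d by simp
  also have "\<dots> = (\<Sum>k<length w. pairing_sum t {\<pi> \<in> planar (x # w). {x, w ! k} \<in> \<pi>})"
    using d by (subst sum_set_nth) auto
  also have "\<dots> = ?R"
  proof (rule sum.cong[OF refl], goal_cases)
    case (1 k)
    define u y v where "u = take k w" and "y = w ! k" and "v = drop (Suc k) w"
    have w: "w = u @ y # v" using 1 id_take_nth_drop[of k w] by (simp add: u_def v_def y_def)
    then have d': "distinct (x # u @ y # v)" using d by simp
    have "pairing_sum t {\<pi> \<in> planar (x # w). {x, y} \<in> \<pi>} =
        pairing_sum t (join_pair x y (planar u) (planar v))" unfolding w planar_step[OF d'] ..
    also have "\<dots> = t {x, y} * pairing_sum t (planar u) * pairing_sum t (planar v)"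
      by (rule pairing_sum_join_pair[of _ "set u" _ "set v"]) (use d' in \<open>auto simp: planar_def\<close>)
    finally show ?case by (simp add: u_def v_def y_def)
  qed
  finally show ?thesis .
qed

text \<open>A partner inside the first circle leaves all through strings on one of its two sides,
  which accounts for the two products in the first sum. In the second sum the pair of
  \<open>x\<close> is itself a through string.\<close>

lemma pairing_sum_annular_Cons:
  assumes d: "distinct ((x # w) @ w')"
  shows "pairing_sum t (annular (x # w) w') =
    (\<Sum>k<length w. t {x, w ! k} *
      (pairing_sum t (planar (take k w)) * pairing_sum t (annular (drop (Suc k) w) w') +
       pairing_sum t (annular (take k w) w') * pairing_sum t (planar (drop (Suc k) w)))) +
    (\<Sum>k<length w'. t {x, w' ! k} * pairing_sum t (planar (w @ drop (Suc k) w' @ take k w')))"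
  (is "_ = ?R1 + ?R2")
proof -
  let ?A = "annular (x # w) w'"
  have A: "?A \<subseteq> pairings_on (set (x # w) \<union> set w')" by (auto simp: annular_def)
  have "set (x # w) \<union> set w' - {x} = set w \<union> set w'" using d by auto
  with pairing_sum_partner[OF A, of x t]
  have "pairing_sum t ?A = (\<Sum>y\<in>set w \<union> set w'. pairing_sum t {\<pi> \<in> ?A. {x, y} \<in> \<pi>})" by simp
  also have "\<dots> = (\<Sum>y\<in>set w. pairing_sum t {\<pi> \<in> ?A. {x, y} \<in> \<pi>}) +
      (\<Sum>y\<in>set w'. pairing_sum t {\<pi> \<in> ?A. {x, y} \<in> \<pi>})" by (rule sum.union_disjoint) (use d in auto)
  also have "(\<Sum>y\<in>set w. pairing_sum t {\<pi> \<in> ?A. {x, y} \<in> \<pi>}) =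
      (\<Sum>k<length w. pairing_sum t {\<pi> \<in> ?A. {x, w ! k} \<in> \<pi>})" using d by (subst sum_set_nth) auto
  also have "(\<Sum>y\<in>set w'. pairing_sum t {\<pi> \<in> ?A. {x, y} \<in> \<pi>}) =
      (\<Sum>k<length w'. pairing_sum t {\<pi> \<in> ?A. {x, w' ! k} \<in> \<pi>})" using d by (subst sum_set_nth) auto
  also have "(\<Sum>k<length w. pairing_sum t {\<pi> \<in> ?A. {x, w ! k} \<in> \<pi>}) = ?R1"
  proof (rule sum.cong[OF refl], goal_cases)
    case (1 k)
    define u y v where "u = take k w" and "y = w ! k" and "v = drop (Suc k) w"
    have w: "w = u @ y # v" using 1 id_take_nth_drop[of k w] by (simp add: u_def v_def y_def)
    then have d': "distinct ((x # u @ y # v) @ w')" using d by simp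
    let ?J1 = "join_pair x y (planar u) (annular v w')" and ?J2 = "join_pair x y (annular u w') (planar v)"
    have J1: "pairing_sum t ?J1 = t {x, y} * pairing_sum t (planar u) * pairing_sum t (annular v w')"
      by (rule pairing_sum_join_pair[of _ "set u" _ "set v \<union> set w'"])
        (use d' in \<open>auto simp: planar_def annular_def\<close>)
    have J2: "pairing_sum t ?J2 = t {x, y} * pairing_sum t (annular u w') * pairing_sum t (planar v)"
      by (rule pairing_sum_join_pair[of _ "set u \<union> set w'" _ "set v"])
        (use d' in \<open>auto simp: planar_def annular_def\<close>)
    have un: "{\<pi> \<in> ?A. {x, y} \<in> \<pi>} = ?J1 \<union> ?J2" unfolding w by (rule annular_step_same[OF d'])
    \<comment> \<open>A through string that starts in \<open>u\<close> excludes a pairing of the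
      first kind, where \<open>u\<close> is paired within itself.\<close>
    have "?J1 \<inter> ?J2 = {}"
    proof -
      have False if "\<pi> \<in> ?J1" "\<pi> \<in> ?J2" for \<pi>
      proof -
        obtain \<rho>1 \<rho>2 where 1: "\<pi> = insert {x, y} (\<rho>1 \<union> \<rho>2)" "\<rho>1 \<in> planar u" "\<rho>2 \<in> annular v w'"
          using \<open>\<pi> \<in> ?J1\<close> by (auto simp: join_pair_def)
        obtain \<tau>1 \<tau>2 where 2: "\<pi> = insert {x, y} (\<tau>1 \<union> \<tau>2)" "\<tau>1 \<in> annular u w'" "\<tau>2 \<in> planar v"
          using \<open>\<pi> \<in> ?J2\<close> by (auto simp: join_pair_def)
        obtain p q where pq: "p \<in> set u" "q \<in> set w'" "{p, q} \<in> \<tau>1"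
          using 2(2) by (auto simp: annular_def linked_def)
        have "{p, q} \<noteq> {x, y}" using pq(1,2) d' by (auto simp: doubleton_eq_iff)
        moreover have "{p, q} \<in> \<pi>" unfolding 2(1) using pq(3) by blast
        ultimately have "{p, q} \<in> \<rho>1 \<or> {p, q} \<in> \<rho>2" unfolding 1(1) by blast
        moreover have "\<rho>1 \<in> pairings_on (set u)" "\<rho>2 \<in> pairings_on (set v \<union> set w')"
          using 1(2,3) by (simp_all add: planar_def annular_def)
        ultimately have "{p, q} \<subseteq> set u \<or> {p, q} \<subseteq> set v \<union> set w'" using pairings_onD(3) by metis
        then show False using pq d' by auto
      qed
      then show ?thesis by blast
    qed
    moreover have "finite {\<pi> \<in> ?A. {x, y} \<in> \<pi>}" using finite_subset[OF A finite_pairings_on] by simp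
    ultimately have "pairing_sum t {\<pi> \<in> ?A. {x, y} \<in> \<pi>} = pairing_sum t ?J1 + pairing_sum t ?J2"
      unfolding un pairing_sum_def by (intro sum.union_disjoint) auto
    then show ?case unfolding J1 J2 by (simp add: u_def v_def y_def algebra_simps)
  qed
  also have "(\<Sum>k<length w'. pairing_sum t {\<pi> \<in> ?A. {x, w' ! k} \<in> \<pi>}) = ?R2"
  proof (rule sum.cong[OF refl], goal_cases)
    case (1 k)
    define u y v where "u = take k w'" and "y = w' ! k" and "v = drop (Suc k) w'"
    have w': "w' = u @ y # v" using 1 id_take_nth_drop[of k w'] by (simp add: u_def v_def y_def)
    then have d': "distinct ((x # w) @ u @ y # v)" using d by simp
    have "pairing_sum t {\<pi> \<in> ?A. {x, y} \<in> \<pi>} = pairing_sum t (join_pair x y (planar (w @ v @ u)) {{}})"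
      unfolding w' annular_step_cross[OF d'] ..
    also have "\<dots> = t {x, y} * pairing_sum t (planar (w @ v @ u)) * pairing_sum t {{}}"
      by (rule pairing_sum_join_pair[of _ "set (w @ v @ u)" _ "{}"])
        (use d' in \<open>auto simp: planar_def pairings_on_empty\<close>)
    finally show ?case by (simp add: u_def v_def y_def pairing_sum_def)
  qed
  finally show ?thesis .
qed

section \<open>Sums over factorizations of words\<close>

text \<open>\<open>letter_sum F w\<close> sums \<open>F u y v\<close> over all factorizations \<open>w = u @ y # v\<close>, and
  \<open>cut_sum F w\<close> sums \<open>F u v\<close> over all factorizations \<open>w = u @ v\<close>.\<close>

primrec letter_sum :: "('l list \<Rightarrow> 'l \<Rightarrow> 'l list \<Rightarrow> real) \<Rightarrow> 'l list \<Rightarrow> real" where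
  "letter_sum F [] = 0"
| "letter_sum F (x # w) = F [] x w + letter_sum (\<lambda>u. F (x # u)) w"

primrec cut_sum :: "('l list \<Rightarrow> 'l list \<Rightarrow> real) \<Rightarrow> 'l list \<Rightarrow> real" where
  "cut_sum F [] = F [] []"
| "cut_sum F (x # w) = F [] (x # w) + cut_sum (\<lambda>u. F (x # u)) w"

lemma letter_sum_eq: "letter_sum F w = (\<Sum>k<length w. F (take k w) (w ! k) (drop (Suc k) w))"
  by (induction w arbitrary: F) (simp_all add: sum.lessThan_Suc_shift del: sum.lessThan_Suc)

lemma cut_sum_eq: "cut_sum F w = (\<Sum>k\<le>length w. F (take k w) (drop k w))"
  by (induction w arbitrary: F) (simp_all add: sum.atMost_Suc_shift del: sum.atMost_Suc)

lemma letter_sum_add: "letter_sum (\<lambda>u y v. F u y v + G u y v) w = letter_sum F w + letter_sum G w"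
  by (simp add: letter_sum_eq sum.distrib)

lemma cut_sum_add: "cut_sum (\<lambda>u v. F u v + G u v) w = cut_sum F w + cut_sum G w"
  by (simp add: cut_sum_eq sum.distrib)

lemma letter_sum_mult_left: "c * letter_sum F w = letter_sum (\<lambda>u y v. c * F u y v) w"
  by (simp add: letter_sum_eq sum_distrib_left)

lemma cut_sum_mult_left: "c * cut_sum F w = cut_sum (\<lambda>u v. c * F u v) w"
  by (simp add: cut_sum_eq sum_distrib_left)

lemma letter_sum_mult_right: "letter_sum F w * c = letter_sum (\<lambda>u y v. F u y v * c) w"
  by (simp add: letter_sum_eq sum_distrib_right)

lemma cut_sum_mult_right: "cut_sum F w * c = cut_sum (\<lambda>u v. F u v * c) w"
  by (simp add: cut_sum_eq sum_distrib_right)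

lemma letter_sum_0: "letter_sum (\<lambda>u y v. 0) w = 0"
  by (simp add: letter_sum_eq)

lemma cut_sum_0: "cut_sum (\<lambda>u v. 0) w = 0"
  by (simp add: cut_sum_eq)

lemma letter_sum_cong:
  assumes "\<And>u y v. w = u @ y # v \<Longrightarrow> F u y v = G u y v"
  shows "letter_sum F w = letter_sum G w"
  unfolding letter_sum_eq by (rule sum.cong[OF refl], rule assms, rule id_take_nth_drop) simp

lemma letter_sum_swap:
  "letter_sum (\<lambda>u y v. letter_sum (\<lambda>a z b. F u y v a z b) w') w =
    letter_sum (\<lambda>a z b. letter_sum (\<lambda>u y v. F u y v a z b) w) w'" unfolding letter_sum_eq by (rule sum.swap)

lemma cut_sum_swap:
  "cut_sum (\<lambda>u v. cut_sum (\<lambda>a b. F u v a b) w') w = cut_sum (\<lambda>a b. cut_sum (\<lambda>u v. F u v a b) w) w'"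
  unfolding cut_sum_eq by (rule sum.swap)

lemma letter_cut_swap:
  "letter_sum (\<lambda>u y v. cut_sum (\<lambda>a b. F u y v a b) w') w =
    cut_sum (\<lambda>a b. letter_sum (\<lambda>u y v. F u y v a b) w) w'"
  unfolding cut_sum_eq letter_sum_eq by (rule sum.swap)

text \<open>A cut is named by the letter after it, and only the last cut has none;
  \<open>cut_sum_eq_left\<close> names a cut by the letter before it. These two translate between
  cuts and letters.\<close>

lemma cut_sum_eq_right: "cut_sum F w = F w [] + letter_sum (\<lambda>u y v. F u (y # v)) w"
  by (induction w arbitrary: F) auto

lemma cut_sum_eq_left: "cut_sum F w = F [] w + letter_sum (\<lambda>u y v. F (u @ [y]) v) w"
proof (induction w arbitrary: F)
  case (Cons x w)
  show ?case using Cons[of "\<lambda>u. F (x # u)"] by simp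
qed simp

lemma letter_sum_append:
  "letter_sum F (u @ v) = letter_sum (\<lambda>a y b. F a y (b @ v)) u + letter_sum (\<lambda>a y b. F (u @ a) y b) v"
  by (induction u arbitrary: F) auto

text \<open>The cut exactly between \<open>u\<close> and \<open>v\<close> belongs to the second
  term: the first one lists only the cuts followed by a letter of \<open>u\<close>.\<close>

lemma cut_sum_append:
  "cut_sum F (u @ v) = letter_sum (\<lambda>a y b. F a (y # b @ v)) u + cut_sum (\<lambda>a b. F (u @ a) b) v"
  by (induction u arbitrary: F) auto

lemma letter_sum_rev: "letter_sum F (rev w) = letter_sum (\<lambda>u y v. F (rev v) y (rev u)) w"
  by (induction w arbitrary: F) (simp_all add: letter_sum_append)

text \<open>Of two letters chosen in order, either can be chosen first. This lemma and its three
  variants with cuts perform all the regroupings of nested decompositions.\<close>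

lemma letter_letter_assoc:
  "letter_sum (\<lambda>u y v. letter_sum (\<lambda>a z b. F a z b y v) u) w =
    letter_sum (\<lambda>a z t. letter_sum (\<lambda>b y v. F a z b y v) t) w"
  by (induction w arbitrary: F) (simp_all add: letter_sum_add)

lemma cut_cut_assoc:
  "cut_sum (\<lambda>u v. cut_sum (\<lambda>a b. F a b v) u) w = cut_sum (\<lambda>a t. cut_sum (\<lambda>b v. F a b v) t) w"
  by (induction w arbitrary: F) (simp_all add: cut_sum_add)

lemma letter_cut_assoc:
  "letter_sum (\<lambda>u y v. cut_sum (\<lambda>a b. F a b y v) u) w = cut_sum (\<lambda>a t. letter_sum (\<lambda>b y v. F a b y v) t) w"
  by (induction w arbitrary: F) (simp_all add: letter_sum_add)

lemma cut_letter_assoc: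
  "cut_sum (\<lambda>u v. letter_sum (\<lambda>a z b. F a z b v) u) w = letter_sum (\<lambda>a z t. cut_sum (\<lambda>b v. F a z b v) t) w"
  by (induction w arbitrary: F) (simp_all add: cut_sum_add)

text \<open>Since an empty middle part contributes nothing, the middle part can be named by its
  first letter, and in the next lemma by its last.\<close>

lemma cut_cut_nonempty_letter:
  assumes "\<And>t v. G t [] v = 0"
  shows "cut_sum (\<lambda>t r. cut_sum (\<lambda>m v. G t m v) r) w =
    letter_sum (\<lambda>t y b. cut_sum (\<lambda>m v. G t (y # m) v) b) w" by (simp add: cut_sum_eq_right[of _ w] assms)

lemma cut_cut_nonempty_last:
  assumes "\<And>t v. G t [] v = 0"
  shows "cut_sum (\<lambda>t r. cut_sum (\<lambda>m v. G t m v) r) w =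
    letter_sum (\<lambda>u y v. cut_sum (\<lambda>t m. G t (m @ [y]) v) u) w"
proof -
  have snoc: "cut_sum (\<lambda>t m. G t m v) (u @ [y]) = cut_sum (\<lambda>t m. G t (m @ [y]) v) u" for u v y
    by (simp add: cut_sum_append cut_sum_eq_right[of _ u] assms)
  show ?thesis unfolding cut_cut_assoc[symmetric] by (subst cut_sum_eq_left) (simp add: assms snoc)
qed

section \<open>Disc and annular moments of words\<close>

context
  fixes s :: "'l \<Rightarrow> 'l \<Rightarrow> real"
begin

text \<open>The recursions of \<open>pairing_sum_planar_Cons\<close> and
  \<open>pairing_sum_annular_Cons\<close>, now taken as definitions on words. Letters may repeat, so
  words can be cut and concatenated with no distinctness to carry along.\<close>

fun disc_moment :: "'l list \<Rightarrow> real" where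
  "disc_moment [] = 1"
| "disc_moment (x # w) =
    (\<Sum>k<length w. s x (w ! k) * disc_moment (take k w) * disc_moment (drop (Suc k) w))"

fun annular_moment :: "'l list \<Rightarrow> 'l list \<Rightarrow> real" where
  "annular_moment [] w' = 0"
| "annular_moment (x # w) w' =
    (\<Sum>k<length w. s x (w ! k) *
      (disc_moment (take k w) * annular_moment (drop (Suc k) w) w' +
       annular_moment (take k w) w' * disc_moment (drop (Suc k) w))) +
    (\<Sum>k<length w'. s x (w' ! k) * disc_moment (w @ drop (Suc k) w' @ take k w'))"

lemma disc_moment_Cons: "disc_moment (x # w) = letter_sum (\<lambda>u y v. s x y * disc_moment u * disc_moment v) w"
  by (simp add: letter_sum_eq)

lemma annular_moment_Cons:
  "annular_moment (x # w) w' =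
    letter_sum (\<lambda>u y v. s x y * (disc_moment u * annular_moment v w' + annular_moment u w' * disc_moment v)) w +
    letter_sum (\<lambda>u y v. s x y * disc_moment (w @ v @ u)) w'" by (simp add: letter_sum_eq)

declare disc_moment.simps(2) [simp del] annular_moment.simps(2) [simp del]

private abbreviation (input) "E \<equiv> disc_moment"

text \<open>\<open>z\<close> is the last letter of \<open>w\<close> joined to \<open>w'\<close>, and
  \<open>y\<close> is its partner. By the choice of \<open>z\<close> the word \<open>u\<close> is
  not joined to \<open>w'\<close>, and a pair starting in \<open>t\<close> cannot cross the string
  from \<open>z\<close> to \<open>y\<close>; so \<open>u\<close> and \<open>t\<close> are paired
  within themselves, and \<open>c @ c'\<close> is left outside. The recursion, however, removes
  first letters, so the induction must carry the pair of the first letter through this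
  decomposition.\<close>

lemma disc_moment_append:
  "E (w @ w') = E w * E w' +
    letter_sum (\<lambda>c z u. letter_sum (\<lambda>t y c'. s z y * E (c @ c') * E u * E t) w') w"
proof (induction w arbitrary: w' rule: length_induct)
  case (1 w)
  show ?case
  proof (cases w)
    case (Cons x w0)
    have IH: "E (b @ r) = E b * E r + letter_sum (\<lambda>c z u. letter_sum (\<lambda>t y c'. s z y * E (c @ c') * E u * E t) r) b"
      if "length b \<le> length w0" for b r
      using 1 that Cons by auto
    let ?G = "\<lambda>c z u. letter_sum (\<lambda>t y c'. s z y * E (c @ c') * E u * E t)"
    \<comment> \<open>The partner of \<open>x\<close> is in \<open>w0\<close> in the first sum and
      in \<open>w'\<close> in the second.\<close>
    have "E (w @ w') = letter_sum (\<lambda>a y b. s x y * E a * E (b @ w')) w0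
        + letter_sum (\<lambda>t y b. s x y * E (w0 @ t) * E b) w'"
      by (simp add: Cons disc_moment_Cons letter_sum_append)
    also have "letter_sum (\<lambda>a y b. s x y * E a * E (b @ w')) w0 =
        letter_sum (\<lambda>a y b. s x y * E a * (E b * E w' + letter_sum (\<lambda>c z u. ?G c z u w') b)) w0"
      by (rule letter_sum_cong) (subst IH, auto)
    also have "\<dots> = E w * E w' + letter_sum (\<lambda>a y b. letter_sum (\<lambda>c z u. s x y * E a * ?G c z u w') b) w0"
      by (simp add: Cons disc_moment_Cons letter_sum_mult_right letter_sum_mult_left
          letter_sum_add[symmetric] algebra_simps)
    also have "letter_sum (\<lambda>a y b. letter_sum (\<lambda>c z u. s x y * E a * ?G c z u w') b) w0 =
        letter_sum (\<lambda>d z u. letter_sum (\<lambda>a y c. s x y * E a * ?G c z u w') d) w0"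
      by (rule letter_letter_assoc[symmetric])
    also have "letter_sum (\<lambda>t y b. s x y * E (w0 @ t) * E b) w' =
        letter_sum (\<lambda>t y b. s x y * (E w0 * E t + letter_sum (\<lambda>c z u. ?G c z u t) w0) * E b) w'"
      by (subst IH) auto
    also have "\<dots> = letter_sum (\<lambda>t y b. s x y * E b * E w0 * E t) w' +
        letter_sum (\<lambda>t y b. letter_sum (\<lambda>c z u. s x y * E b * ?G c z u t) w0) w'"
      by (simp add: letter_sum_mult_right letter_sum_mult_left letter_sum_add[symmetric] algebra_simps)
    also have "letter_sum (\<lambda>t y b. letter_sum (\<lambda>c z u. s x y * E b * ?G c z u t) w0) w' =
        letter_sum (\<lambda>c z u. letter_sum (\<lambda>t y b. s x y * E b * ?G c z u t) w') w0" by (rule letter_sum_swap)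
    finally have L: "E (w @ w') = E w * E w' +
        letter_sum (\<lambda>d z u. letter_sum (\<lambda>a y c. s x y * E a * ?G c z u w') d) w0 +
        (letter_sum (\<lambda>t y b. s x y * E b * E w0 * E t) w' +
         letter_sum (\<lambda>c z u. letter_sum (\<lambda>t y b. s x y * E b * ?G c z u t) w') w0)" .
    have "letter_sum (\<lambda>c z u. ?G c z u w') w = letter_sum (\<lambda>t y b. s x y * E b * E w0 * E t) w' +
        letter_sum (\<lambda>c z u. letter_sum (\<lambda>t y c'. s z y * E (x # c @ c') * E u * E t) w') w0"
      by (simp add: Cons)
    moreover have "letter_sum (\<lambda>t y c'. s z y * E (x # c @ c') * E u * E t) w' =
        letter_sum (\<lambda>a y c. s x y * E a * ?G c z u w') c +
        letter_sum (\<lambda>t y b. s x y * E b * ?G c z u t) w'" for c z u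
    proof -
      \<comment> \<open>The factor \<open>E (x # c @ c')\<close> is expanded at its first letter,
        whose partner lies in \<open>c\<close> or in \<open>c'\<close>. These are the two nested
        terms of fact \<open>L\<close>.\<close>
      have "letter_sum (\<lambda>t y c'. s z y * E (x # c @ c') * E u * E t) w' =
          letter_sum (\<lambda>t y c'. letter_sum (\<lambda>a y' b. s x y' * E a * (s z y * E (b @ c') * E u * E t)) c) w' +
          letter_sum (\<lambda>t y c'. letter_sum (\<lambda>t' y' b. s x y' * E b * (s z y * E (c @ t') * E u * E t)) c') w'"
        by (simp add: disc_moment_Cons letter_sum_append letter_sum_mult_left letter_sum_mult_right
            letter_sum_add[symmetric] algebra_simps)
      also have "letter_sum (\<lambda>t y c'. letter_sum (\<lambda>a y' b. s x y' * E a * (s z y * E (b @ c') * E u * E t)) c) w'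
          = letter_sum (\<lambda>a y c. s x y * E a * ?G c z u w') c"
        unfolding letter_sum_mult_left by (rule letter_sum_swap)
      also have "letter_sum (\<lambda>t y c'. letter_sum (\<lambda>t' y' b. s x y' * E b * (s z y * E (c @ t') * E u * E t)) c') w'
          = letter_sum (\<lambda>t y b. s x y * E b * ?G c z u t) w'"
        unfolding letter_sum_mult_left by (rule letter_letter_assoc[symmetric])
      finally show ?thesis .
    qed
    ultimately show ?thesis unfolding L by (simp add: letter_sum_add)
  qed simp
qed

text \<open>\<open>inner_link c c'\<close> sums over the pairings of \<open>c @ c'\<close> that pair the last letter of \<open>c\<close> with the
  first of \<open>c'\<close>; \<open>outer_link\<close> pairs the first letter of \<open>c\<close> with the last of \<open>c'\<close>; \<open>double_link\<close>
  requires both. Two empty words count as linked, except in \<open>double_link\<close>.\<close>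

definition inner_link :: "'l list \<Rightarrow> 'l list \<Rightarrow> real" where
  "inner_link c c' = (if c = [] \<and> c' = [] then 1 else if c = [] \<or> c' = [] then 0
    else s (last c) (hd c') * E (butlast c @ tl c'))"

definition outer_link :: "'l list \<Rightarrow> 'l list \<Rightarrow> real" where
  "outer_link c c' = (if c = [] \<and> c' = [] then 1 else if c = [] \<or> c' = [] then 0
    else s (hd c) (last c') * E (tl c @ butlast c'))"

definition double_link :: "'l list \<Rightarrow> 'l list \<Rightarrow> real" where
  "double_link m m' = (if m = [] \<or> m' = [] then 0 else s (hd m) (last m') * inner_link (tl m) (butlast m'))"

private abbreviation (input) "K \<equiv> inner_link"
private abbreviation (input) "D \<equiv> double_link"

lemma inner_link_simps [simp]:
  "K [] [] = 1" "K [] (x # c) = 0" "K (x # c) [] = 0" "K (c @ [z]) [] = 0"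
  "K (c @ [z]) (t # c') = s z t * E (c @ c')" by (simp_all add: inner_link_def)

lemma outer_link_simps [simp]:
  "outer_link [] [] = 1" "outer_link [] (x # c) = 0" "outer_link (x # c) [] = 0" "outer_link [] (c @ [z]) = 0"
  "outer_link (x # c) (c' @ [y]) = s x y * E (c @ c')" by (simp_all add: outer_link_def)

lemma double_link_simps [simp]:
  "D [] m' = 0" "D m [] = 0" "D (x # c) (c' @ [y]) = s x y * K c c'" by (simp_all add: double_link_def)

text \<open>\<open>double_link\<close> is defined by removing the outer pair first; here the inner
  pair goes first. If both words have a single letter the two pairs coincide, and the value 1 of the
  links on two empty words takes care of this case.\<close>

lemma double_link_outer: "D (m @ [z]) (t # m') = s z t * outer_link m m'"
proof (cases m; cases m' rule: rev_cases)
  fix x c c' y assume m: "m = x # c" "m' = c' @ [y]"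
  then have "m @ [z] = x # (c @ [z])" "t # m' = (t # c') @ [y]" by simp_all
  then have "D (m @ [z]) (t # m') = s x y * K (c @ [z]) (t # c')" by (simp only: double_link_simps)
  then show ?thesis using m by simp
next
  fix x c assume m: "m = x # c" "m' = []"
  have "D (x # c @ [z]) ([] @ [t]) = s x t * K (c @ [z]) []" by (simp only: double_link_simps)
  then show ?thesis using m by simp
next
  fix c' y assume m: "m = []" "m' = c' @ [y]"
  have "D (z # []) ((t # c') @ [y]) = s z y * K [] (t # c')" by (simp only: double_link_simps)
  then show ?thesis using m by simp
next
  assume m: "m = []" "m' = []"
  have "D (z # []) ([] @ [t]) = s z t * K [] []" by (simp only: double_link_simps)
  then show ?thesis using m by simp
qed

text \<open>Because \<open>inner_link [] [] = 1\<close>, the unlinked term of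
  \<open>disc_moment_append\<close> becomes the summand with \<open>c\<close> and \<open>c'\<close>
  empty, and a single sum covers both cases.\<close>

lemma disc_moment_append_cut:
  "E (w @ w') = cut_sum (\<lambda>c u. cut_sum (\<lambda>t c'. K c c' * E u * E t) w') w"
proof -
  have "cut_sum (\<lambda>t c'. K [] c' * E w * E t) w' = E w * E w'" by (simp add: cut_sum_eq_right letter_sum_0)
  moreover have "cut_sum (\<lambda>t c'. K (c @ [z]) c' * E u * E t) w' =
      letter_sum (\<lambda>t y c'. s z y * E (c @ c') * E u * E t) w'" for c z u by (simp add: cut_sum_eq_right)
  ultimately show ?thesis unfolding disc_moment_append[of w w'] cut_sum_eq_left[of _ w] by simp
qed

text \<open>The pairings of \<open>p @ v @ u\<close> without a pair between \<open>p\<close> and \<open>v\<close>, cut at the last letter of \<open>p\<close>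
  that is paired into \<open>u\<close>.\<close>

definition unlinked_moment :: "'l list \<Rightarrow> 'l list \<Rightarrow> 'l list \<Rightarrow> real" where
  "unlinked_moment p v u = cut_sum (\<lambda>c r. cut_sum (\<lambda>t c'. K c c' * E r * E (v @ t)) u) p"

private abbreviation (input) "N \<equiv> unlinked_moment"

text \<open>\<open>{x, y}\<close> is the outermost pair between \<open>a\<close> and
  \<open>b\<close>: it encloses \<open>c @ c'\<close>, and beyond it nothing joins \<open>p\<close>
  to \<open>v\<close>. The induction instead peels off the innermost pair, found at the end of
  \<open>a\<close>; the pairs enclosed by \<open>{x, y}\<close> are then reassembled into
  \<open>E (c @ c')\<close> by \<open>disc_moment_append\<close>.\<close>

lemma disc_moment_append3:
  "E (a @ b @ u) = N a b u +
    letter_sum (\<lambda>p x c. letter_sum (\<lambda>c' y v. s x y * E (c @ c') * N p v u) b) a"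
proof (induction a arbitrary: b rule: length_induct)
  case (1 a)
  have IH: "E (a1 @ b1 @ u) = N a1 b1 u +
      letter_sum (\<lambda>p x c. letter_sum (\<lambda>c' y v. s x y * E (c @ c') * N p v u) b1) a1"
    if "length a1 < length a" for a1 b1
    using 1 that by blast
  have "E (a @ (b @ u)) =
      cut_sum (\<lambda>c r. letter_sum (\<lambda>t y b1. K c (y # b1 @ u) * E r * E t) b +
        cut_sum (\<lambda>t c'. K c c' * E r * E (b @ t)) u) a"
    by (subst disc_moment_append_cut) (simp add: cut_sum_append)
  \<comment> \<open>If the last string leaving \<open>a\<close> ends in \<open>u\<close>, no earlier
    one can end in \<open>b\<close> without crossing it; together with the case of no string these
    terms make up \<open>N a b u\<close>.\<close>
  also have "\<dots> = cut_sum (\<lambda>c r. letter_sum (\<lambda>t y b1. K c (y # b1 @ u) * E r * E t) b) a + N a b u"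
    by (simp add: cut_sum_add unlinked_moment_def)
  also have "cut_sum (\<lambda>c r. letter_sum (\<lambda>t y b1. K c (y # b1 @ u) * E r * E t) b) a =
      letter_sum (\<lambda>a1 z r. letter_sum (\<lambda>t y b1. s z y * E (a1 @ b1 @ u) * E r * E t) b) a"
    by (subst cut_sum_eq_left) (simp add: letter_sum_0)
  also have "\<dots> = letter_sum (\<lambda>a1 z r. letter_sum (\<lambda>t y b1. s z y * (N a1 b1 u +
      letter_sum (\<lambda>p x c. letter_sum (\<lambda>c' y v. s x y * E (c @ c') * N p v u) b1) a1) * E r * E t) b) a"
    by (rule letter_sum_cong) (subst IH, auto)
  also have "\<dots> = letter_sum (\<lambda>a1 z r. letter_sum (\<lambda>t y b1. s z y * E r * E t * N a1 b1 u) b) a +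
      letter_sum (\<lambda>a1 z r. letter_sum (\<lambda>t y b1. letter_sum (\<lambda>p x c. letter_sum (\<lambda>c' y' v.
        s x y' * N p v u * (s z y * E (c @ c') * E r * E t)) b1) a1) b) a"
    by (simp add: letter_sum_mult_left letter_sum_mult_right letter_sum_add[symmetric] algebra_simps)
  also have "letter_sum (\<lambda>a1 z r. letter_sum (\<lambda>t y b1. letter_sum (\<lambda>p x c. letter_sum (\<lambda>c' y' v.
        s x y' * N p v u * (s z y * E (c @ c') * E r * E t)) b1) a1) b) a =
      letter_sum (\<lambda>a1 z r. letter_sum (\<lambda>p x c. letter_sum (\<lambda>t y b1. letter_sum (\<lambda>c' y' v.
        s x y' * N p v u * (s z y * E (c @ c') * E r * E t)) b1) b) a1) a" by (subst letter_sum_swap) simp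
  also have "\<dots> = letter_sum (\<lambda>p x q. letter_sum (\<lambda>c z r. letter_sum (\<lambda>t y b1. letter_sum (\<lambda>c' y' v.
        s x y' * N p v u * (s z y * E (c @ c') * E r * E t)) b1) b) q) a" by (rule letter_letter_assoc)
  also have "\<dots> = letter_sum (\<lambda>p x q. letter_sum (\<lambda>c z r. letter_sum (\<lambda>q' y' v. letter_sum (\<lambda>t y c'.
        s x y' * N p v u * (s z y * E (c @ c') * E r * E t)) q') b) q) a"
    by (subst letter_letter_assoc[symmetric]) simp
  also have "\<dots> = letter_sum (\<lambda>p x q. letter_sum (\<lambda>q' y' v. letter_sum (\<lambda>c z r. letter_sum (\<lambda>t y c'.
        s x y' * N p v u * (s z y * E (c @ c') * E r * E t)) q') q) b) a" by (subst letter_sum_swap) simp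
  finally have "E (a @ b @ u) = letter_sum (\<lambda>p x q. letter_sum (\<lambda>q' y v. s x y * E q * E q' * N p v u) b) a +
      letter_sum (\<lambda>p x q. letter_sum (\<lambda>q' y' v. letter_sum (\<lambda>c z r. letter_sum (\<lambda>t y c'.
        s x y' * N p v u * (s z y * E (c @ c') * E r * E t)) q') q) b) a + N a b u" .
  moreover have "s x y * E (q @ q') * N p v u = s x y * E q * E q' * N p v u +
      letter_sum (\<lambda>c z r. letter_sum (\<lambda>t y' c'. s x y * N p v u * (s z y' * E (c @ c') * E r * E t)) q') q"
    for x y q q' p v
    unfolding disc_moment_append[of q q'] by (simp add: letter_sum_mult_left letter_sum_mult_right algebra_simps)
  ultimately show ?case by (simp add: letter_sum_add)
qed

end

section \<open>Sums over threefold cuts\<close>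

definition cut3_sum :: "('l list \<Rightarrow> 'l list \<Rightarrow> 'l list \<Rightarrow> real) \<Rightarrow> 'l list \<Rightarrow> real" where
  "cut3_sum F w = cut_sum (\<lambda>a r. cut_sum (\<lambda>b c. F a b c) r) w"

lemma cut3_sum_mult_left: "c * cut3_sum F w = cut3_sum (\<lambda>u v z. c * F u v z) w"
  by (simp add: cut3_sum_def cut_sum_mult_left)

lemma cut3_sum_add: "cut3_sum (\<lambda>u v z. F u v z + G u v z) w = cut3_sum F w + cut3_sum G w"
  by (simp add: cut3_sum_def cut_sum_add)

lemma cut3_sum_0: "cut3_sum (\<lambda>u v z. 0) w = 0"
  by (simp add: cut3_sum_def cut_sum_0)

lemma cut3_cut_swap:
  "cut3_sum (\<lambda>a b c. cut_sum (\<lambda>p q. F a b c p q) w') w = cut_sum (\<lambda>p q. cut3_sum (\<lambda>a b c. F a b c p q) w) w'"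
  unfolding cut3_sum_def
  by (subst cut_sum_swap, rule arg_cong2[where f = cut_sum, OF _ refl], intro ext, subst cut_sum_swap) simp

lemma cut3_letter_swap:
  "cut3_sum (\<lambda>a b c. letter_sum (\<lambda>p y q. F a b c p y q) w') w =
    letter_sum (\<lambda>p y q. cut3_sum (\<lambda>a b c. F a b c p y q) w) w'" unfolding cut3_sum_def letter_cut_swap ..

lemma cut3_cut3_swap:
  "cut3_sum (\<lambda>a b c. cut3_sum (\<lambda>p q r. F a b c p q r) w') w =
    cut3_sum (\<lambda>p q r. cut3_sum (\<lambda>a b c. F a b c p q r) w) w'"
proof -
  have "cut3_sum (\<lambda>a b c. cut3_sum (\<lambda>p q r. F a b c p q r) w') w =
      cut_sum (\<lambda>p r. cut3_sum (\<lambda>a b c. cut_sum (\<lambda>q z. F a b c p q z) r) w) w'"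
    unfolding cut3_sum_def[of _ w'] by (rule cut3_cut_swap)
  also have "\<dots> = cut3_sum (\<lambda>p q r. cut3_sum (\<lambda>a b c. F a b c p q r) w) w'"
    unfolding cut3_sum_def[of _ w'] by (subst cut3_cut_swap) simp
  finally show ?thesis .
qed

lemma cut3_sum_assoc: "cut3_sum F w = cut_sum (\<lambda>p c. cut_sum (\<lambda>a b. F a b c) p) w"
  unfolding cut3_sum_def by (rule cut_cut_assoc[symmetric])

section \<open>The annular moment cut at its extreme through strings\<close>

context
  fixes s :: "'l \<Rightarrow> 'l \<Rightarrow> real"
begin

private abbreviation (input) "Es \<equiv> disc_moment s"
private abbreviation (input) "Ks \<equiv> inner_link s"
private abbreviation (input) "Ds \<equiv> double_link s"
private abbreviation (input) "Ns \<equiv> unlinked_moment s"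

text \<open>The block \<open>m\<close>, \<open>t # m'\<close> extends from the outermost string
  between \<open>c\<close> and \<open>t # b\<close> to the innermost one, which ends at
  \<open>t\<close>; outside it nothing joins \<open>p\<close> to \<open>v\<close>. Removing the
  innermost pair turns this into \<open>disc_moment_append3\<close>.\<close>

lemma inner_link_append:
  "Ks c (t # b @ u) = cut_sum (\<lambda>p m. cut_sum (\<lambda>m' v. Ns p v u * Ds m (t # m')) b) c"
proof (cases c rule: rev_cases)
  case (snoc a z)
  let ?G = "\<lambda>p m. cut_sum (\<lambda>m' v. Ns p v u * Ds m (t # m')) b"
  have "cut_sum ?G c = cut_sum (\<lambda>p m. ?G p (m @ [z])) a"
    by (simp add: snoc cut_sum_append cut_sum_eq_right[of _ a] cut_sum_0)
  also have "\<dots> = cut_sum (\<lambda>p m. cut_sum (\<lambda>m' v. Ns p v u * (s z t * outer_link s m m')) b) a"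
    by (simp only: double_link_outer)
  also have "\<dots> = s z t * Ns a b u + letter_sum (\<lambda>p x c. letter_sum (\<lambda>c' y v.
      Ns p v u * (s z t * (s x y * Es (c @ c')))) b) a"
  proof -
    have "cut_sum (\<lambda>m' v. Ns a v u * (s z t * outer_link s [] m')) b = s z t * Ns a b u"
      by (simp add: cut_sum_eq_left letter_sum_0)
    moreover have "cut_sum (\<lambda>m' v. Ns p v u * (s z t * outer_link s (x # c) m')) b =
        letter_sum (\<lambda>c' y v. Ns p v u * (s z t * (s x y * Es (c @ c')))) b" for p x c
      by (simp add: cut_sum_eq_left)
    ultimately show ?thesis unfolding cut_sum_eq_right[of _ a] by simp
  qed
  also have "\<dots> = s z t * Es (a @ b @ u)"
    unfolding disc_moment_append3 by (simp add: letter_sum_mult_left algebra_simps)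
  finally show ?thesis by (simp add: snoc)
qed (simp add: cut_sum_0)

text \<open>\<open>annular_core m m'\<close> sums over the arrangements in which the first and the last letters of \<open>m\<close> and of
  \<open>m'\<close> lie on through strings. The first summand has the strings of \<open>m\<close> meeting those of \<open>m'\<close> in
  opposite order; in the second this order is rotated by the base point of the circle of \<open>m'\<close>.\<close>

definition annular_core :: "'l list \<Rightarrow> 'l list \<Rightarrow> real" where
  "annular_core m m' = Ds m m' +
    cut3_sum (\<lambda>m1 a m2. cut3_sum (\<lambda>m1' b m2'. Ds m1 m1' * Es a * Es b * Ds m2 m2') m') m"

text \<open>The words \<open>v1\<close> and \<open>v2\<close> outside the extreme through strings
  meet at the base point and may be paired with each other, so they are weighed together as
  \<open>v1 @ v2\<close>. \<open>annular_cuts\<close> does the same on the first circle.\<close>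

definition annular_half :: "'l list \<Rightarrow> 'l list \<Rightarrow> real" where
  "annular_half m w' = cut3_sum (\<lambda>v1 m' v2. Es (v1 @ v2) * annular_core m m') w'"

definition annular_cuts :: "'l list \<Rightarrow> 'l list \<Rightarrow> real" where
  "annular_cuts w w' = cut3_sum (\<lambda>u1 m u2. Es (u1 @ u2) * annular_half m w') w"

text \<open>The pairings of \<open>c @ v @ u\<close> that pair the last letter of \<open>c\<close> with a letter of \<open>v\<close>: such a string
  passes beyond the base point that separates \<open>v\<close> from \<open>u\<close> on the second circle.\<close>

definition wrapped_links :: "'l list \<Rightarrow> 'l list \<Rightarrow> 'l list \<Rightarrow> real" where
  "wrapped_links c u v = cut3_sum (\<lambda>t m' v3. Es t * cut_sum (\<lambda>p m. Ns p v3 u * Ds m m') c) v"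

text \<open>The defining sum has the shape that \<open>annular_core\<close> produces; the right side
  has the shape that arises when a disc moment is cut at the partner \<open>y\<close> of the last
  letter of \<open>c\<close>.\<close>

lemma wrapped_links_eq: "wrapped_links c u v = letter_sum (\<lambda>t y b. Ks c (y # b @ u) * Es t) v"
proof -
  have "wrapped_links c u v = letter_sum (\<lambda>t y b. cut_sum (\<lambda>m' v3. Es t * cut_sum (\<lambda>p m. Ns p v3 u * Ds m (y # m')) c) b) v"
    unfolding wrapped_links_def cut3_sum_def by (rule cut_cut_nonempty_letter) (simp add: cut_sum_0)
  also have "\<dots> = letter_sum (\<lambda>t y b. Es t * cut_sum (\<lambda>m' v3. cut_sum (\<lambda>p m. Ns p v3 u * Ds m (y # m')) c) b) v"
    by (simp add: cut_sum_mult_left)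
  also have "\<dots> = letter_sum (\<lambda>t y b. Ks c (y # b @ u) * Es t) v"
    unfolding inner_link_append by (subst cut_sum_swap) (simp add: mult.commute)
  finally show ?thesis .
qed

text \<open>The string from \<open>x\<close> to \<open>y\<close> has been removed. The word
  \<open>c\<close> ends at the last letter of \<open>w\<close> joined to \<open>v @ u\<close>, if
  there is one, so \<open>r\<close> is paired within itself. The partner of that letter lies in
  \<open>u\<close> for the first term and in \<open>v\<close>, beyond the base point, for the
  second.\<close>

lemma disc_moment_through:
  "letter_sum (\<lambda>u y v. s x y * Es (w @ v @ u)) w' = cut_sum (\<lambda>c r. Es r *
    letter_sum (\<lambda>u y v. s x y * (cut_sum (\<lambda>t c'. Es (v @ t) * Ks c c') u + wrapped_links c u v)) w') w"
proof -
  have "Es (w @ v @ u) = cut_sum (\<lambda>c r. Es r *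
      (cut_sum (\<lambda>t c'. Es (v @ t) * Ks c c') u + wrapped_links c u v)) w" for u v unfolding wrapped_links_eq
    by (subst disc_moment_append_cut)
      (simp add: cut_sum_append letter_sum_mult_left cut_sum_mult_left algebra_simps)
  then have "letter_sum (\<lambda>u y v. s x y * Es (w @ v @ u)) w' = letter_sum (\<lambda>u y v. cut_sum (\<lambda>c r.
      Es r * (s x y * (cut_sum (\<lambda>t c'. Es (v @ t) * Ks c c') u + wrapped_links c u v))) w) w'"
    by (simp add: cut_sum_mult_left algebra_simps)
  also have "\<dots> = cut_sum (\<lambda>c r. letter_sum (\<lambda>u y v.
      Es r * (s x y * (cut_sum (\<lambda>t c'. Es (v @ t) * Ks c c') u + wrapped_links c u v))) w') w"
    by (rule letter_cut_swap)
  finally show ?thesis by (simp add: letter_sum_mult_left)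
qed

text \<open>\<open>x\<close> is the first through string and \<open>y\<close> its other end. The
  unrotated summand of \<open>annular_core\<close> yields the sum over cuts of \<open>u\<close>, the
  rotated one yields \<open>wrapped_links\<close>. Rotation invariance enters because the outer
  words of the second circle are read from its base point on one side and from \<open>y\<close> on
  the other.\<close>

lemma annular_half_Cons:
  assumes rot: "\<And>u v. Es (u @ v) = Es (v @ u)"
  shows "annular_half (x # c) w' =
    letter_sum (\<lambda>u y v. s x y * (cut_sum (\<lambda>t c'. Es (v @ t) * Ks c c') u + wrapped_links c u v)) w'"
proof -
  have 1: "cut3_sum (\<lambda>v1 m' v2. Es (v1 @ v2) * Ds (x # c) m') w' =
      letter_sum (\<lambda>u y v. s x y * cut_sum (\<lambda>t c'. Es (v @ t) * Ks c c') u) w'" unfolding cut3_sum_def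
    by (subst cut_cut_nonempty_last) (simp_all add: cut_sum_mult_left rot algebra_simps)
  have 2: "cut3_sum (\<lambda>v1 m' v2. Es (v1 @ v2) *
        cut3_sum (\<lambda>m1' b m2'. Ds (x # c1) m1' * Es a * Es b * Ds m2 m2') m') w' =
      letter_sum (\<lambda>u y v. cut_sum (\<lambda>v1 c1'. cut3_sum (\<lambda>b m2' v3.
        Es (v1 @ v3) * (s x y * Ks c1 c1' * Es a * Es b * Ds m2 m2')) v) u) w'" (is "?L = ?R") for c1 a m2
  proof -
    let ?g = "\<lambda>v1 m1' b m2' v3. Es (v1 @ v3) * (Ds (x # c1) m1' * Es a * Es b * Ds m2 m2')"
    have "?L = cut_sum (\<lambda>v1 r. cut_sum (\<lambda>m' v3. cut_sum (\<lambda>m1' r'. cut_sum (\<lambda>b m2'. ?g v1 m1' b m2' v3) r') m') r) w'"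
      by (simp add: cut3_sum_def cut_sum_mult_left)
    also have "\<dots> = cut_sum (\<lambda>v1 r. cut_sum (\<lambda>m1' v. cut3_sum (\<lambda>b m2' v3. ?g v1 m1' b m2' v3) v) r) w'"
      unfolding cut_cut_assoc cut3_sum_def ..
    also have "\<dots> = letter_sum (\<lambda>u y v. cut_sum (\<lambda>v1 c1'. cut3_sum (\<lambda>b m2' v3. ?g v1 (c1' @ [y]) b m2' v3) v) u) w'"
      by (rule cut_cut_nonempty_last) (simp add: cut3_sum_0)
    finally show ?thesis by simp
  qed
  \<comment> \<open>An empty first block has weight 0, so \<open>m1\<close> begins with
    \<open>x\<close> and the remaining cuts are those of \<open>c\<close>.\<close>
  have "cut3_sum (\<lambda>v1 m' v2. Es (v1 @ v2) *
      cut3_sum (\<lambda>m1 a m2. cut3_sum (\<lambda>m1' b m2'. Ds m1 m1' * Es a * Es b * Ds m2 m2') m') (x # c)) w' =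
    cut3_sum (\<lambda>v1 m' v2. cut3_sum (\<lambda>c1 a m2. Es (v1 @ v2) * cut3_sum (\<lambda>m1' b m2'.
      Ds (x # c1) m1' * Es a * Es b * Ds m2 m2') m') c) w'"
    unfolding cut3_sum_mult_left[symmetric] unfolding cut3_sum_def[of _ "x # c"] cut3_sum_def[of _ c]
    by (simp add: cut3_sum_0 cut_sum_0)
  also have "\<dots> = cut3_sum (\<lambda>c1 a m2. letter_sum (\<lambda>u y v. cut_sum (\<lambda>v1 c1'. cut3_sum (\<lambda>b m2' v3.
        Es (v1 @ v3) * (s x y * Ks c1 c1' * Es a * Es b * Ds m2 m2')) v) u) w') c"
    by (subst cut3_cut3_swap) (simp add: 2)
  also have "\<dots> = letter_sum (\<lambda>u y v. s x y * wrapped_links c u v) w'"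
  proof -
    have "s x y * wrapped_links c u v = cut3_sum (\<lambda>c1 a m2. cut_sum (\<lambda>v1 c1'. cut3_sum (\<lambda>b m2' v3.
        Es (v1 @ v3) * (s x y * Ks c1 c1' * Es a * Es b * Ds m2 m2')) v) u) c" for u y v
    proof -
      have "s x y * wrapped_links c u v = cut3_sum (\<lambda>b m2' v3. cut3_sum (\<lambda>c1 a m2. cut_sum (\<lambda>v1 c1'.
          Es (v1 @ v3) * (s x y * Ks c1 c1' * Es a * Es b * Ds m2 m2')) u) c) v"
        unfolding wrapped_links_def unlinked_moment_def cut3_sum_assoc[of _ c]
        by (simp add: cut_sum_mult_left cut_sum_mult_right cut3_sum_mult_left rot algebra_simps)
      also have "\<dots> = cut3_sum (\<lambda>c1 a m2. cut3_sum (\<lambda>b m2' v3. cut_sum (\<lambda>v1 c1'.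
          Es (v1 @ v3) * (s x y * Ks c1 c1' * Es a * Es b * Ds m2 m2')) u) v) c" by (rule cut3_cut3_swap)
      finally show ?thesis by (simp only: cut3_cut_swap)
    qed
    then show ?thesis by (simp only: cut3_letter_swap)
  qed
  finally show ?thesis unfolding annular_half_def annular_core_def
    by (simp add: distrib_left cut3_sum_add 1 letter_sum_add)
qed

lemma annular_half_Nil: "annular_half [] w' = 0"
proof -
  have "annular_core [] m' = 0" for m' by (simp add: annular_core_def cut3_sum_def cut_sum_eq)
  then show ?thesis by (simp add: annular_half_def cut3_sum_0)
qed

text \<open>If the outer prefix is nonempty it begins with \<open>x\<close>, whose partner is
  outside the through block as well, before or behind it; this gives the first sum. Otherwise
  \<open>x\<close> is the first through string. The result has the shape of
  \<open>annular_moment_Cons\<close>.\<close>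

lemma annular_cuts_Cons:
  "annular_cuts (x # w) w' =
    letter_sum (\<lambda>u y v. s x y * (Es u * annular_cuts v w' + annular_cuts u w' * Es v)) w +
    cut_sum (\<lambda>c r. Es r * annular_half (x # c) w') w"
proof -
  let ?B = "\<lambda>m. annular_half m w'"
  have "annular_cuts (x # w) w' = cut_sum (\<lambda>m u2. Es u2 * ?B m) (x # w) +
      cut3_sum (\<lambda>u1 m u2. Es (x # u1 @ u2) * ?B m) w" by (simp add: annular_cuts_def cut3_sum_def)
  also have "cut_sum (\<lambda>m u2. Es u2 * ?B m) (x # w) = cut_sum (\<lambda>c r. Es r * annular_half (x # c) w') w"
    by (simp add: annular_half_Nil)
  also have "cut3_sum (\<lambda>u1 m u2. Es (x # u1 @ u2) * ?B m) w =
      cut3_sum (\<lambda>u1 m u2. letter_sum (\<lambda>u y v. s x y * Es u * Es (v @ u2) * ?B m) u1) w +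
      cut3_sum (\<lambda>u1 m u2. letter_sum (\<lambda>u y v. s x y * Es (u1 @ u) * Es v * ?B m) u2) w"
    by (simp add: disc_moment_Cons letter_sum_append cut3_sum_add[symmetric] distrib_right letter_sum_mult_right)
  also have "cut3_sum (\<lambda>u1 m u2. letter_sum (\<lambda>u y v. s x y * Es u * Es (v @ u2) * ?B m) u1) w =
      letter_sum (\<lambda>u y v. s x y * (Es u * annular_cuts v w')) w"
  proof -
    have "cut3_sum (\<lambda>u1 m u2. letter_sum (\<lambda>u y v. s x y * Es u * Es (v @ u2) * ?B m) u1) w =
        cut_sum (\<lambda>u1 r. letter_sum (\<lambda>u y v. cut_sum (\<lambda>m u2. s x y * Es u * Es (v @ u2) * ?B m) r) u1) w"
      unfolding cut3_sum_def letter_cut_swap ..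
    also have "\<dots> = letter_sum (\<lambda>u y t. cut_sum (\<lambda>v r. cut_sum (\<lambda>m u2. s x y * Es u * Es (v @ u2) * ?B m) r) t) w"
      by (rule cut_letter_assoc)
    finally show ?thesis by (simp add: annular_cuts_def cut3_sum_def cut_sum_mult_left mult.assoc)
  qed
  also have "cut3_sum (\<lambda>u1 m u2. letter_sum (\<lambda>u y v. s x y * Es (u1 @ u) * Es v * ?B m) u2) w =
      letter_sum (\<lambda>u y v. s x y * (annular_cuts u w' * Es v)) w"
  proof -
    have "cut3_sum (\<lambda>u1 m u2. letter_sum (\<lambda>u y v. s x y * Es (u1 @ u) * Es v * ?B m) u2) w =
        cut_sum (\<lambda>u1 r. letter_sum (\<lambda>p y v. cut_sum (\<lambda>m u. s x y * Es (u1 @ u) * Es v * ?B m) p) r) w"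
      unfolding cut3_sum_def letter_cut_assoc ..
    also have "\<dots> = letter_sum (\<lambda>p y v. cut_sum (\<lambda>u1 r. cut_sum (\<lambda>m u. s x y * Es (u1 @ u) * Es v * ?B m) r) p) w"
      by (rule letter_cut_assoc[symmetric])
    finally show ?thesis
      by (simp add: annular_cuts_def cut3_sum_def cut_sum_mult_left cut_sum_mult_right algebra_simps)
  qed
  finally show ?thesis by (simp add: distrib_left letter_sum_add)
qed

text \<open>Both sides obey the same recursion on the first letter of \<open>w\<close>: the through
  term of one is rewritten by \<open>disc_moment_through\<close>, that of the other by
  \<open>annular_half_Cons\<close>.\<close>

lemma annular_moment_eq_cuts:
  assumes rot: "\<And>u v. Es (u @ v) = Es (v @ u)"
  shows "annular_moment s w w' = annular_cuts w w'"
proof (induction w rule: length_induct)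
  case (1 w)
  show ?case
  proof (cases w)
    case Nil
    then show ?thesis by (simp add: annular_cuts_def cut3_sum_def annular_half_Nil)
  next
    case (Cons x w0)
    have "annular_moment s v w' = annular_cuts v w'" if "length v \<le> length w0" for v
      using 1 that Cons by auto
    then have "letter_sum (\<lambda>u y v. s x y * (Es u * annular_moment s v w' + annular_moment s u w' * Es v)) w0 =
        letter_sum (\<lambda>u y v. s x y * (Es u * annular_cuts v w' + annular_cuts u w' * Es v)) w0"
      by (intro letter_sum_cong) auto
    then show ?thesis
      unfolding Cons annular_moment_Cons annular_cuts_Cons disc_moment_through annular_half_Cons[OF rot]
      by simp
  qed
qed

section \<open>From labelled pairings to words, and symmetries of the disc moment\<close>

lemma pairing_sum_planar:
  assumes "distinct w" and t: "\<And>x y. x \<noteq> y \<Longrightarrow> t {x, y} = s (c x) (c y)"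
  shows "pairing_sum t (planar w) = Es (map c w)"
  using assms(1)
proof (induction w rule: length_induct)
  case (1 w)
  show ?case
  proof (cases w)
    case Nil
    then show ?thesis by (simp add: planar_Nil pairing_sum_def)
  next
    case (Cons x w0)
    have IH: "pairing_sum t (planar v) = Es (map c v)" if "length v \<le> length w0" "distinct v" for v
      using 1 that Cons by auto
    have d: "distinct (x # w0)" using 1 Cons by simp
    show ?thesis unfolding Cons pairing_sum_planar_Cons[OF d] list.map disc_moment.simps length_map
    proof (rule sum.cong[OF refl], goal_cases)
      case (1 k)
      then have "x \<noteq> w0 ! k" using d by auto
      then show ?case using 1 d by (simp add: t IH take_map drop_map)
    qed
  qed
qed

lemma pairing_sum_annular:
  assumes "distinct (w @ w')" and t: "\<And>x y. x \<noteq> y \<Longrightarrow> t {x, y} = s (c x) (c y)"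
  shows "pairing_sum t (annular w w') = annular_moment s (map c w) (map c w')"
  using assms(1)
proof (induction w rule: length_induct)
  case (1 w)
  show ?case
  proof (cases w)
    case Nil
    then show ?thesis by (simp add: annular_Nil pairing_sum_def)
  next
    case (Cons x w0)
    have d: "distinct ((x # w0) @ w')" using 1 Cons by simp
    have planar_eq: "pairing_sum t (planar v) = Es (map c v)" if "distinct v" for v
      by (rule pairing_sum_planar[OF that]) (rule t)
    have IH: "pairing_sum t (annular v w') = annular_moment s (map c v) (map c w')"
      if "length v \<le> length w0" "distinct (v @ w')" for v
      using 1 that Cons by auto
    have dist: "distinct (take k w0 @ w')" "distinct (drop (Suc k) w0 @ w')" for k
      using d set_take_subset[of k w0] set_drop_subset[of "Suc k" w0] by auto
    have dist': "distinct (w0 @ drop (Suc k) w' @ take k w')" for k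
      using d set_take_subset[of k w'] set_drop_subset[of "Suc k" w'] set_take_disj_set_drop_if_distinct[of w' k "Suc k"]
      by auto
    show ?thesis unfolding Cons pairing_sum_annular_Cons[OF d] list.map annular_moment.simps length_map
    proof ((rule arg_cong2[where f = "(+)"]; rule sum.cong[OF refl]), goal_cases)
      case (1 k)
      then have "x \<noteq> w0 ! k" using d by auto
      then show ?case using 1 dist[of k] by (simp add: t IH planar_eq take_map drop_map)
    next
      case (2 k)
      then have "w' ! k \<in> set w'" by simp
      then have "x \<noteq> w' ! k" using d by (metis distinct_append disjoint_iff list.set_intros(1))
      then show ?case using 2 dist'[of k] by (simp add: t planar_eq take_map drop_map)
    qed
  qed
qed

context
  assumes sym: "\<And>x y. s x y = s y x"
begin

lemma pair_weight:
  fixes x y :: nat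
  assumes "x \<noteq> y"
  shows "s (c (Min {x, y})) (c (Max {x, y})) = s (c x) (c y)"
  using assms sym by (cases "x < y") (auto simp: min_def max_def)

text \<open>The recursion singles out the first letter and hides this invariance. It is visible for
  \<open>planar\<close>, which depends only on a cycle, so the letters are given distinct labels and
  the invariance is transferred back.\<close>

lemma disc_moment_rotate: "Es (u @ v) = Es (v @ u)"
proof -
  define p q where "p = [0..<length u]" and "q = [length u..<length u + length v]"
  let ?c = "\<lambda>k. (u @ v) ! k"
  have pq: "distinct (p @ q)" "distinct (q @ p)" by (auto simp: p_def q_def)
  have m: "map ?c p = u" "map ?c q = v" by (auto simp: p_def q_def nth_append intro: nth_equalityI)
  have "pairing_sum (\<lambda>B. s (?c (Min B)) (?c (Max B))) (planar l) = Es (map ?c l)" if "distinct l" for l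
    by (rule pairing_sum_planar[OF that]) (rule pair_weight)
  from this[OF pq(1)] this[OF pq(2)] planar_rotate[OF pq(1)] have "Es (map ?c (p @ q)) = Es (map ?c (q @ p))" by simp
  then show ?thesis by (simp only: map_append m)
qed

lemma disc_moment_rev: "Es (rev w) = Es w"
proof (induction w rule: length_induct)
  case (1 w)
  show ?case
  proof (cases w)
    case (Cons x w0)
    have "Es (rev w) = Es (x # rev w0)" using disc_moment_rotate[of "rev w0" "[x]"] by (simp add: Cons)
    also have "\<dots> = letter_sum (\<lambda>u y v. s x y * Es (rev v) * Es (rev u)) w0"
      by (simp add: disc_moment_Cons letter_sum_rev)
    also have "\<dots> = letter_sum (\<lambda>u y v. s x y * Es u * Es v) w0" using 1 Cons by (intro letter_sum_cong) auto
    finally show ?thesis by (simp add: Cons disc_moment_Cons)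
  qed simp
qed

lemma disc_moment_map:
  assumes "\<And>x y. s (f x) (f y) = s x y"
  shows "Es (map f w) = Es w"
proof (induction w rule: length_induct)
  case (1 w)
  show ?case
  proof (cases w)
    case (Cons x w0)
    have "Es (map f w) = (\<Sum>k<length w0. s (f x) (f (w0 ! k)) * Es (map f (take k w0)) * Es (map f (drop (Suc k) w0)))"
      by (simp add: Cons disc_moment_Cons letter_sum_eq take_map drop_map)
    also have "\<dots> = Es w"
      unfolding Cons disc_moment_Cons letter_sum_eq using 1 Cons assms by (intro sum.cong) auto
    finally show ?thesis .
  qed simp
qed

end

end

section \<open>Sums of power series\<close>

abbreviation (input) "lfin \<equiv> mps_locally_finite"
abbreviation (input) "homog \<equiv> mps_homogeneous"

lemma mps_coeff_sum: "mps_coeff (sum f S) M = (\<Sum>s\<in>S. mps_coeff (f s) M)"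
  by (induction S rule: infinite_finite_induct) (auto simp: zero_mps.rep_eq plus_mps.rep_eq)

text \<open>Any finite index set containing the support computes the coefficient, so families with
  different supports can be summed over a common set.\<close>

lemma mps_coeff_mps_sum:
  assumes "finite F" "F \<subseteq> S" "\<And>s. s \<in> S \<Longrightarrow> mps_coeff (f s) M \<noteq> 0 \<Longrightarrow> s \<in> F"
  shows "mps_coeff (mps_sum f S) M = (\<Sum>s\<in>F. mps_coeff (f s) M)"
  unfolding mps_sum.rep_eq by (rule sum.mono_neutral_left) (use assms in auto)

lemma mps_locally_finiteD: "lfin f S \<Longrightarrow> finite {s \<in> S. mps_coeff (f s) M \<noteq> 0}"
  by (simp add: mps_locally_finite_def)

lemma mps_locally_finite_subset_support:
  assumes "lfin f S" "\<And>s M. s \<in> S \<Longrightarrow> mps_coeff (g s) M \<noteq> 0 \<Longrightarrow> mps_coeff (f s) M \<noteq> 0"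
  shows "lfin g S"
  unfolding mps_locally_finite_def
proof
  fix M
  show "finite {s \<in> S. mps_coeff (g s) M \<noteq> 0}"
    by (rule finite_subset[OF _ mps_locally_finiteD[OF assms(1), of M]]) (use assms(2) in auto)
qed

lemma mps_coeff_mult_of_real: "mps_coeff (f * of_real c) M = mps_coeff f M * of_real c"
proof -
  have "f * of_real c = c *\<^sub>R f" by (simp add: scaleR_conv_of_real mult.commute)
  then have "mps_coeff (f * of_real c) M = c *\<^sub>R mps_coeff f M" by (simp only: scaleR_mps.rep_eq)
  then show ?thesis by (simp add: scaleR_conv_of_real mult.commute)
qed

lemma mps_locally_finite_scale:
  assumes "lfin f S"
  shows "lfin (\<lambda>s. f s * of_real (c s)) S"
  by (rule mps_locally_finite_subset_support[OF assms]) (simp add: mps_coeff_mult_of_real)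

lemma mps_locally_finite_sum:
  assumes "finite I" "\<And>i. i \<in> I \<Longrightarrow> lfin (f i) S"
  shows "lfin (\<lambda>s. \<Sum>i\<in>I. f i s) S"
  unfolding mps_locally_finite_def
proof
  fix M
  have "{s \<in> S. mps_coeff (\<Sum>i\<in>I. f i s) M \<noteq> 0} \<subseteq> (\<Union>i\<in>I. {s \<in> S. mps_coeff (f i s) M \<noteq> 0})"
    unfolding mps_coeff_sum by (auto dest: sum.not_neutral_contains_not_neutral)
  then show "finite {s \<in> S. mps_coeff (\<Sum>i\<in>I. f i s) M \<noteq> 0}"
    by (rule finite_subset) (use assms mps_locally_finiteD in auto)
qed

lemma mps_sum_sum:
  assumes "finite I" "\<And>i. i \<in> I \<Longrightarrow> lfin (f i) S"
  shows "(\<Sum>i\<in>I. mps_sum (f i) S) = mps_sum (\<lambda>s. \<Sum>i\<in>I. f i s) S"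
proof (rule mps_eqI)
  fix M
  define F where "F = (\<Union>i\<in>I. {s \<in> S. mps_coeff (f i s) M \<noteq> 0})"
  have F: "finite F" "F \<subseteq> S" using assms mps_locally_finiteD by (auto simp: F_def)
  have "mps_coeff (\<Sum>i\<in>I. mps_sum (f i) S) M = (\<Sum>i\<in>I. \<Sum>s\<in>F. mps_coeff (f i s) M)"
    unfolding mps_coeff_sum by (intro sum.cong refl mps_coeff_mps_sum) (use F in \<open>auto simp: F_def\<close>)
  also have "\<dots> = (\<Sum>s\<in>F. mps_coeff (\<Sum>i\<in>I. f i s) M)" unfolding mps_coeff_sum by (rule sum.swap)
  also have "\<dots> = mps_coeff (mps_sum (\<lambda>s. \<Sum>i\<in>I. f i s) S) M" by (intro mps_coeff_mps_sum[symmetric])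
      (use F in \<open>auto simp: F_def mps_coeff_sum dest: sum.not_neutral_contains_not_neutral\<close>)
  finally show "mps_coeff (\<Sum>i\<in>I. mps_sum (f i) S) M = mps_coeff (mps_sum (\<lambda>s. \<Sum>i\<in>I. f i s) S) M" .
qed

lemma mps_sum_add:
  assumes "lfin f S" "lfin g S"
  shows "mps_sum f S + mps_sum g S = mps_sum (\<lambda>s. f s + g s) S"
  using mps_sum_sum[of "UNIV :: bool set" "\<lambda>b. if b then f else g" S] assms
  by (simp add: UNIV_bool add.commute)

lemma
  assumes f: "lfin f S" and g: "lfin g T"
  shows mps_locally_finite_times: "lfin (\<lambda>(s, t). f s * g t) (S \<times> T)"
    and mps_sum_times: "mps_sum f S * mps_sum g T = mps_sum (\<lambda>(s, t). f s * g t) (S \<times> T)"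
proof -
  \<comment> \<open>\<open>F M\<close> and \<open>G M\<close> collect the indices that can
    contribute to the coefficient of \<open>M\<close>; they are finite because \<open>M\<close>
    splits in finitely many ways.\<close>
  define F where "F M = (\<Union>(A, B)\<in>splits M. {s \<in> S. mps_coeff (f s) A \<noteq> 0})" for M
  define G where "G M = (\<Union>(A, B)\<in>splits M. {t \<in> T. mps_coeff (g t) B \<noteq> 0})" for M
  have FG: "finite (F M)" "F M \<subseteq> S" "finite (G M)" "G M \<subseteq> T" for M
    using f g mps_locally_finiteD by (auto simp: F_def G_def finite_splits)
  have supp: "s \<in> F M \<and> t \<in> G M" if st: "s \<in> S" "t \<in> T" "mps_coeff (f s * g t) M \<noteq> 0" for s t M
  proof -
    obtain A B where "(A, B) \<in> splits M" "mps_coeff (f s) A * mps_coeff (g t) B \<noteq> 0"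
      using st(3) unfolding times_mps.rep_eq
      by (metis (no_types, lifting) sum.neutral split_beta prod.collapse)
    then show ?thesis using st(1,2) unfolding F_def G_def by force
  qed
  show "lfin (\<lambda>(s, t). f s * g t) (S \<times> T)" unfolding mps_locally_finite_def
  proof
    fix M
    show "finite {z \<in> S \<times> T. mps_coeff (case z of (s, t) \<Rightarrow> f s * g t) M \<noteq> 0}"
      by (rule finite_subset[of _ "F M \<times> G M"]) (use supp FG in auto)
  qed
  show "mps_sum f S * mps_sum g T = mps_sum (\<lambda>(s, t). f s * g t) (S \<times> T)"
  proof (rule mps_eqI)
    fix M
    have "mps_coeff (mps_sum f S * mps_sum g T) M =
        (\<Sum>(A, B)\<in>splits M. (\<Sum>s\<in>F M. mps_coeff (f s) A) * (\<Sum>t\<in>G M. mps_coeff (g t) B))"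
      unfolding times_mps.rep_eq
    proof (rule sum.cong[OF refl], clarify)
      fix A B assume AB: "(A, B) \<in> splits M"
      have "mps_coeff (mps_sum f S) A = (\<Sum>s\<in>F M. mps_coeff (f s) A)"
        by (rule mps_coeff_mps_sum) (use FG AB in \<open>auto simp: F_def\<close>)
      moreover have "mps_coeff (mps_sum g T) B = (\<Sum>t\<in>G M. mps_coeff (g t) B)"
        by (rule mps_coeff_mps_sum) (use FG AB in \<open>auto simp: G_def\<close>)
      ultimately show "mps_coeff (mps_sum f S) A * mps_coeff (mps_sum g T) B =
          (\<Sum>s\<in>F M. mps_coeff (f s) A) * (\<Sum>t\<in>G M. mps_coeff (g t) B)" by simp
    qed
    also have "\<dots> = (\<Sum>(A, B)\<in>splits M. \<Sum>z\<in>F M \<times> G M. mps_coeff (f (fst z)) A * mps_coeff (g (snd z)) B)"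
      by (simp add: sum_product sum.cartesian_product case_prod_unfold)
    also have "\<dots> = (\<Sum>z\<in>F M \<times> G M. \<Sum>(A, B)\<in>splits M. mps_coeff (f (fst z)) A * mps_coeff (g (snd z)) B)"
      unfolding case_prod_unfold by (rule sum.swap)
    also have "\<dots> = (\<Sum>z\<in>F M \<times> G M. mps_coeff (case z of (s, t) \<Rightarrow> f s * g t) M)"
      by (simp add: times_mps.rep_eq case_prod_unfold)
    also have "\<dots> = mps_coeff (mps_sum (\<lambda>(s, t). f s * g t) (S \<times> T)) M"
    proof (rule mps_coeff_mps_sum[symmetric])
      show "F M \<times> G M \<subseteq> S \<times> T" using FG by (intro Sigma_mono)
    qed (use FG(1,3) supp in auto)
    finally show "mps_coeff (mps_sum f S * mps_sum g T) M =
        mps_coeff (mps_sum (\<lambda>(s, t). f s * g t) (S \<times> T)) M" .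
  qed
qed

lemma mps_sum_reindex:
  assumes "bij_betw h S T"
  shows "mps_sum f T = mps_sum (\<lambda>s. f (h s)) S"
proof (rule mps_eqI)
  fix M
  have "bij_betw h {s \<in> S. mps_coeff (f (h s)) M \<noteq> 0} {t \<in> T. mps_coeff (f t) M \<noteq> 0}"
    using assms by (auto simp: bij_betw_def inj_on_def)
  then show "mps_coeff (mps_sum f T) M = mps_coeff (mps_sum (\<lambda>s. f (h s)) S) M"
    unfolding mps_sum.rep_eq by (rule sum.reindex_bij_betw[symmetric])
qed

lemma mps_locally_finite_reindex:
  assumes "lfin f T" "inj_on h S" "h ` S \<subseteq> T"
  shows "lfin (\<lambda>s. f (h s)) S"
  unfolding mps_locally_finite_def
proof
  fix M
  have "h ` {s \<in> S. mps_coeff (f (h s)) M \<noteq> 0} \<subseteq> {t \<in> T. mps_coeff (f t) M \<noteq> 0}" using assms(3) by auto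
  then have "finite (h ` {s \<in> S. mps_coeff (f (h s)) M \<noteq> 0})"
    using mps_locally_finiteD[OF assms(1)] finite_subset by blast
  then show "finite {s \<in> S. mps_coeff (f (h s)) M \<noteq> 0}"
    by (rule finite_imageD) (use assms(2) in \<open>auto simp: inj_on_def\<close>)
qed

lemma mps_coeff_mps_sum_graded:
  assumes Q: "finite Q" and fin: "\<And>k. finite {s \<in> U. c s = k}"
    and supp: "\<And>s. s \<in> U \<Longrightarrow> mps_coeff (h s) M \<noteq> 0 \<Longrightarrow> c s \<in> Q"
  shows "mps_coeff (mps_sum h U) M = (\<Sum>k\<in>Q. mps_coeff (\<Sum>s | s \<in> U \<and> c s = k. h s) M)"
proof -
  have "{s \<in> U. c s \<in> Q} = (\<Union>k\<in>Q. {s \<in> U. c s = k})" by auto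
  then have fU: "finite {s \<in> U. c s \<in> Q}" using Q fin by simp
  have "mps_coeff (mps_sum h U) M = (\<Sum>s | s \<in> U \<and> c s \<in> Q. mps_coeff (h s) M)"
    by (rule mps_coeff_mps_sum) (use fU supp in auto)
  also have "\<dots> = (\<Sum>k\<in>Q. \<Sum>s | s \<in> {s \<in> U. c s \<in> Q} \<and> c s = k. mps_coeff (h s) M)"
    by (rule sum.group[symmetric]) (use fU Q in auto)
  also have "\<dots> = (\<Sum>k\<in>Q. mps_coeff (\<Sum>s | s \<in> U \<and> c s = k. h s) M)"
    unfolding mps_coeff_sum by (intro sum.cong refl) auto
  finally show ?thesis .
qed

text \<open>Two infinite sums agree as soon as their finite parts of each grade agree. The grades
  used are lengths, pairs of lengths and pairs of words.\<close>

lemma mps_sum_regroup: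
  assumes f: "lfin f S" and g: "lfin g T"
    and fin: "\<And>k. finite {s \<in> S. d s = k}" "\<And>k. finite {t \<in> T. e t = k}"
    and eq: "\<And>k. (\<Sum>s | s \<in> S \<and> d s = k. f s) = (\<Sum>t | t \<in> T \<and> e t = k. g t)"
  shows "mps_sum f S = mps_sum g T"
proof (rule mps_eqI)
  fix M
  define Q where "Q = d ` {s \<in> S. mps_coeff (f s) M \<noteq> 0} \<union> e ` {t \<in> T. mps_coeff (g t) M \<noteq> 0}"
  have Q: "finite Q" using mps_locally_finiteD[OF f] mps_locally_finiteD[OF g] by (simp add: Q_def)
  have "mps_coeff (mps_sum f S) M = (\<Sum>k\<in>Q. mps_coeff (\<Sum>s | s \<in> S \<and> d s = k. f s) M)"
    by (rule mps_coeff_mps_sum_graded[OF Q fin(1)]) (auto simp: Q_def)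
  moreover have "mps_coeff (mps_sum g T) M = (\<Sum>k\<in>Q. mps_coeff (\<Sum>t | t \<in> T \<and> e t = k. g t) M)"
    by (rule mps_coeff_mps_sum_graded[OF Q fin(2)]) (auto simp: Q_def)
  ultimately show "mps_coeff (mps_sum f S) M = mps_coeff (mps_sum g T) M" by (simp add: eq)
qed

section \<open>Transforms as sums over words\<close>

lemma join_pair_unit: "join_pair x y P {{}} = insert {x, y} ` P"
  by (auto simp: join_pair_def)

lemma insert_image_filter: "b \<noteq> a \<Longrightarrow> {\<pi> \<in> insert a ` P. b \<in> \<pi>} = insert a ` {\<rho> \<in> P. b \<in> \<rho>}"
  by auto

text \<open>The outer pair is removed by \<open>planar_step\<close>. The ends \<open>z\<close> and
  \<open>r\<close> of the inner pair are then adjacent on the remaining circle, so after rotating to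
  \<open>z\<close> the word enclosed by them is empty.\<close>

lemma pairing_sum_double_link:
  assumes d: "distinct (w @ w')" and ne: "w \<noteq> []" "w' \<noteq> []"
    and t: "\<And>x y. x \<noteq> y \<Longrightarrow> t {x, y} = s (c x) (c y)" and sym: "\<And>x y. s x y = s y x"
  shows "pairing_sum t {\<pi> \<in> planar (w @ w'). {hd w, last w'} \<in> \<pi> \<and> {last w, hd w'} \<in> \<pi>} =
    double_link s (map c w) (map c w')"
proof -
  obtain x u where w: "w = x # u" using ne(1) by (cases w) auto
  obtain v y where w': "w' = v @ [y]" using ne(2) by (cases w' rule: rev_cases) auto
  have d': "distinct (x # (u @ v) @ y # [])" using d by (auto simp: w w')
  have step: "{\<pi> \<in> planar (w @ w'). {x, y} \<in> \<pi>} = join_pair x y (planar (u @ v)) {{}}"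
    using planar_step[OF d'] by (simp add: w w' planar_Nil)
  have one: "pairing_sum t {{}} = 1" by (simp add: pairing_sum_def)
  have jp: "pairing_sum t (join_pair x y P {{}}) = s (c x) (c y) * pairing_sum t P"
    if "P \<subseteq> pairings_on (set (u @ v))" for P
    using d' one by (subst pairing_sum_join_pair[OF that, of _ "{}"]) (auto simp: pairings_on_empty t)
  \<comment> \<open>A letter has only one partner: if just one of the two words is a single letter,
    no pairing contains both required pairs.\<close>
  have uniq: "{\<pi> \<in> planar (w @ w'). {x, y} \<in> \<pi> \<and> {a, b} \<in> \<pi>} = {}"
    if "{a, b} \<noteq> {x, y}" "a = x \<or> b = y" for a b
    using pairings_onD(4)[of _ _ "{x, y}" "{a, b}"] that unfolding planar_def by blast
  show ?thesis
  proof (cases u rule: rev_cases)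
    case u: Nil
    show ?thesis
    proof (cases v)
      case Nil
      have "pairing_sum t {\<pi> \<in> planar (w @ w'). {x, y} \<in> \<pi>} = s (c x) (c y)"
        unfolding step using u Nil one by (subst jp) (auto simp: planar_Nil pairings_on_empty)
      then show ?thesis using u Nil double_link_simps(3)[of s "c x" "[]" "[]" "c y"] by (simp add: w w')
    next
      case (Cons z v')
      have "{\<pi> \<in> planar (w @ w'). {x, y} \<in> \<pi> \<and> {x, z} \<in> \<pi>} = {}"
        by (rule uniq) (use d' Cons in \<open>auto simp: doubleton_eq_iff\<close>)
      moreover have "hd w = x" "last w' = y" "last w = x" "hd w' = z" using u Cons by (simp_all add: w w')
      ultimately have emp: "{\<pi> \<in> planar (w @ w'). {hd w, last w'} \<in> \<pi> \<and> {last w, hd w'} \<in> \<pi>} = {}"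
        by (simp only:)
      show ?thesis unfolding emp using u Cons double_link_simps(3)[of s "c x" "[]" "c z # map c v'" "c y"]
        by (simp add: w w' pairing_sum_def)
    qed
  next
    case u: (snoc u' z)
    show ?thesis
    proof (cases v)
      case Nil
      have "{\<pi> \<in> planar (w @ w'). {x, y} \<in> \<pi> \<and> {z, y} \<in> \<pi>} = {}"
        by (rule uniq) (use d' u in \<open>auto simp: doubleton_eq_iff\<close>)
      moreover have "hd w = x" "last w' = y" "last w = z" "hd w' = y" using u Nil by (simp_all add: w w')
      ultimately have emp: "{\<pi> \<in> planar (w @ w'). {hd w, last w'} \<in> \<pi> \<and> {last w, hd w'} \<in> \<pi>} = {}"
        by (simp only:)
      show ?thesis unfolding emp using u Nil double_link_simps(3)[of s "c x" "map c u' @ [c z]" "[]" "c y"]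
        by (simp add: w w' pairing_sum_def)
    next
      case (Cons r v')
      have dz: "distinct (z # [] @ r # (v' @ u'))" using d' u Cons by auto
      have ne: "{z, r} \<noteq> {x, y}" using d' u by (auto simp: doubleton_eq_iff)
      have "{\<pi> \<in> planar (w @ w'). {x, y} \<in> \<pi> \<and> {z, r} \<in> \<pi>} =
          {\<pi> \<in> {\<pi> \<in> planar (w @ w'). {x, y} \<in> \<pi>}. {z, r} \<in> \<pi>}" by blast
      also have "\<dots> = join_pair x y {\<rho> \<in> planar (u @ v). {z, r} \<in> \<rho>} {{}}"
        unfolding step join_pair_unit by (rule insert_image_filter[OF ne])
      finally have "{\<pi> \<in> planar (w @ w'). {x, y} \<in> \<pi> \<and> {z, r} \<in> \<pi>} =
          join_pair x y {\<rho> \<in> planar (u @ v). {z, r} \<in> \<rho>} {{}}" .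
      moreover have "planar (u @ v) = planar (z # [] @ r # (v' @ u'))"
        using planar_rotate[of u' "z # r # v'"] d' u Cons by auto
      ultimately have eq: "{\<pi> \<in> planar (w @ w'). {x, y} \<in> \<pi> \<and> {z, r} \<in> \<pi>} =
          join_pair x y (join_pair z r (planar []) (planar (v' @ u'))) {{}}"
        using planar_step[OF dz] by (simp only:)
      have sub: "join_pair z r (planar []) (planar (v' @ u')) \<subseteq> pairings_on (set (u @ v))"
        unfolding planar_step[OF dz, symmetric] using u Cons by (auto simp: planar_def insert_commute Un_commute)
      have "pairing_sum t (join_pair z r (planar []) (planar (v' @ u'))) =
          t {z, r} * pairing_sum t (planar []) * pairing_sum t (planar (v' @ u'))"
        by (rule pairing_sum_join_pair[of _ "{}" _ "set (v' @ u')"])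
          (use dz in \<open>auto simp: planar_def pairings_on_empty\<close>)
      also have "\<dots> = s (c z) (c r) * disc_moment s (map c (v' @ u'))"
      proof -
        have "pairing_sum t (planar (v' @ u')) = disc_moment s (map c (v' @ u'))"
          by (rule pairing_sum_planar) (use dz t in auto)
        then show ?thesis using dz by (simp add: planar_Nil one t)
      qed
      also have "\<dots> = inner_link s (map c u' @ [c z]) (c r # map c v')"
        using disc_moment_rotate[of s "map c v'" "map c u'"] sym by simp
      finally have "pairing_sum t {\<pi> \<in> planar (w @ w'). {x, y} \<in> \<pi> \<and> {z, r} \<in> \<pi>} =
          s (c x) (c y) * inner_link s (map c u' @ [c z]) (c r # map c v')" unfolding eq jp[OF sub] by simp
      moreover have "hd w = x" "last w' = y" "last w = z" "hd w' = r" using u Cons by (simp_all add: w w')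
      moreover have "map c w = c x # map c u' @ [c z]" "map c w' = (c r # map c v') @ [c y]"
        using u Cons by (simp_all add: w w')
      ultimately show ?thesis by (simp only: double_link_simps)
    qed
  qed
qed

section \<open>Matrix products along words of index pairs\<close>

primrec word_weight :: "(nat \<Rightarrow> 'r::comm_ring_1^'d^'d::finite) \<Rightarrow> ('d \<times> 'd) list \<Rightarrow> 'd \<Rightarrow> 'd \<Rightarrow> 'r" where
  "word_weight a [] p q = a 0 $ p $ q"
| "word_weight a (l # w) p q = a 0 $ p $ fst l * word_weight (\<lambda>k. a (Suc k)) w (snd l) q"

definition index_word :: "nat \<Rightarrow> (nat \<Rightarrow> 'd) \<Rightarrow> (nat \<Rightarrow> 'd) \<Rightarrow> ('d \<times> 'd) list" where
  "index_word n i j = map (\<lambda>t. (i t, j t)) [1..<Suc n]"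

lemma length_index_word [simp]: "length (index_word n i j) = n"
  by (simp add: index_word_def)

lemma word_weight_cong:
  "(\<And>k. k \<le> length w \<Longrightarrow> a k = b k) \<Longrightarrow> word_weight a w p q = word_weight b w p q"
proof (induction w arbitrary: a b p)
  case (Cons l w)
  have "a 0 = b 0" by (rule Cons.prems) simp
  moreover have "word_weight (\<lambda>k. a (Suc k)) w (snd l) q = word_weight (\<lambda>k. b (Suc k)) w (snd l) q"
    by (rule Cons.IH, rule Cons.prems) simp
  ultimately show ?case by (simp only: word_weight.simps)
qed simp

lemma line_product_eq_word_weight:
  "line_product n a i j p q = word_weight a (index_word n i j) p q"
proof (induction n arbitrary: a i j p)
  case 0
  then show ?case by (simp add: line_product_def index_word_def)
next
  case (Suc n)
  have "[1..<Suc (Suc n)] = 1 # map Suc [1..<Suc n]" by (simp add: map_Suc_upt upt_conv_Cons del: upt_Suc)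
  then have iw: "index_word (Suc n) i j = (i 1, j 1) # index_word n (\<lambda>t. i (Suc t)) (\<lambda>t. j (Suc t))"
    by (simp add: index_word_def comp_def del: upt_Suc)
  have "line_product (Suc n) a i j p q = a 0 $ p $ i 1 *
      line_product n (\<lambda>k. a (Suc k)) (\<lambda>t. i (Suc t)) (\<lambda>t. j (Suc t)) (j 1) q"
    unfolding line_product_def prod.atLeast0_atMost_Suc_shift
    by (rule arg_cong2[where f = "(*)"], simp, rule prod.cong) (auto simp: fun_upd_def)
  then show ?case unfolding iw Suc.IH by simp
qed

lemma finite_words: "finite {w :: ('d::finite \<times> 'd) list. length w = n}"
  using finite_lists_length_eq[of "UNIV :: ('d \<times> 'd) set" n] by simp

lemma sum_index_maps:
  fixes F :: "('d::finite \<times> 'd) list \<Rightarrow> 'b::comm_monoid_add"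
  shows "(\<Sum>i\<in>index_maps n. \<Sum>j\<in>index_maps n. F (index_word n i j)) = (\<Sum>w | length w = n. F w)"
proof -
  have nth: "index_word n i j ! (t - 1) = (i t, j t)" if "t \<in> {1..n}" for t i and j :: "nat \<Rightarrow> 'd"
    using that by (auto simp: index_word_def nth_append simp del: upt_Suc)
  have "(\<Sum>i\<in>index_maps n. \<Sum>j\<in>index_maps n. F (index_word n i j)) =
      (\<Sum>(i, j)\<in>index_maps n \<times> index_maps n. F (index_word n i j))" by (rule sum.cartesian_product)
  also have "\<dots> = (\<Sum>w | length w = n. F w)"
  proof (rule sum.reindex_bij_witness[of _
        "\<lambda>w. (\<lambda>t\<in>{1..n}. fst (w ! (t - 1)), \<lambda>t\<in>{1..n}. snd (w ! (t - 1)))" "\<lambda>(i, j). index_word n i j"])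
    fix z :: "(nat \<Rightarrow> 'd) \<times> (nat \<Rightarrow> 'd)"
    assume "z \<in> index_maps n \<times> index_maps n"
    then obtain i j where z: "z = (i, j)" "i \<in> {1..n} \<rightarrow>\<^sub>E UNIV" "j \<in> {1..n} \<rightarrow>\<^sub>E UNIV"
      by (auto simp: index_maps_def)
    have "(\<lambda>t\<in>{1..n}. fst (index_word n i j ! (t - 1))) = (\<lambda>t\<in>{1..n}. i t)"
      "(\<lambda>t\<in>{1..n}. snd (index_word n i j ! (t - 1))) = (\<lambda>t\<in>{1..n}. j t)"
      using nth[of _ i j] by (auto intro!: restrict_ext)
    then show "(\<lambda>t\<in>{1..n}. fst ((case z of (i, j) \<Rightarrow> index_word n i j) ! (t - 1)),
        \<lambda>t\<in>{1..n}. snd ((case z of (i, j) \<Rightarrow> index_word n i j) ! (t - 1))) = z"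
      using z PiE_restrict[OF z(2)] PiE_restrict[OF z(3)] by simp
  next
    fix w :: "('d \<times> 'd) list" assume w: "w \<in> {w. length w = n}"
    show "(case (\<lambda>t\<in>{1..n}. fst (w ! (t - 1)), \<lambda>t\<in>{1..n}. snd (w ! (t - 1))) of (i, j) \<Rightarrow> index_word n i j) = w"
      using w by (auto simp: index_word_def intro!: nth_equalityI simp del: upt_Suc)
    show "(\<lambda>t\<in>{1..n}. fst (w ! (t - 1)), \<lambda>t\<in>{1..n}. snd (w ! (t - 1))) \<in> index_maps n \<times> index_maps n"
      by (simp add: index_maps_def)
  qed auto
  finally show ?thesis .
qed

text \<open>The sum over pairings is carried out first; it depends on the indices only through the
  word they spell, which leaves a sum over words of fixed length.\<close>

lemma sum_kappa_single:
  fixes a :: "nat \<Rightarrow> 'r::{comm_ring_1,real_algebra_1}^'d::finite^'d"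
  assumes P: "\<And>c. (\<Sum>\<pi>\<in>P. pairing_weight \<sigma> \<pi> c) = g (map c [1..<Suc n])"
  shows "(\<Sum>\<pi>\<in>P. kappa_single \<sigma> n \<pi> a $ p $ q) =
    (\<Sum>w | length w = n. word_weight a w p q * of_real (g w))"
proof -
  have "(\<Sum>\<pi>\<in>P. kappa_single \<sigma> n \<pi> a $ p $ q) =
      (\<Sum>i\<in>index_maps n. \<Sum>j\<in>index_maps n. \<Sum>\<pi>\<in>P. word_weight a (index_word n i j) p q *
        of_real (pairing_weight \<sigma> \<pi> (\<lambda>t. (i t, j t))))"
    unfolding kappa_single_def line_product_eq_word_weight by (simp add: sum.swap[of _ _ P])
  also have "\<dots> = (\<Sum>i\<in>index_maps n. \<Sum>j\<in>index_maps n. word_weight a (index_word n i j) p q *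
      of_real (g (index_word n i j)))"
    by (simp only: sum_distrib_left[symmetric] of_real_sum[symmetric] P index_word_def)
  also have "\<dots> = (\<Sum>w | length w = n. word_weight a w p q * of_real (g w))" by (rule sum_index_maps)
  finally show ?thesis .
qed

lemma sum_kappa_double:
  fixes a b :: "nat \<Rightarrow> 'r::{comm_ring_1,real_algebra_1}^'d::finite^'d"
  assumes P: "\<And>c. (\<Sum>\<pi>\<in>P. pairing_weight \<sigma> \<pi> c) = g (map c [1..<Suc m]) (map c [Suc m..<Suc (m + n)])"
  shows "(\<Sum>\<pi>\<in>P. kappa_double \<sigma> m n \<pi> a b $ (p, r) $ (q, s)) =
    (\<Sum>w | length w = m. \<Sum>w' | length w' = n. word_weight a w p q *
      word_weight (\<lambda>k. transpose (b (n - k))) w' s r * of_real (g w w'))"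
proof -
  let ?b = "\<lambda>k. transpose (b (n - k))"
  define c where "c i' j' i'' j'' t = (if t \<le> m then (i' t, j' t) else (i'' (t - m), j'' (t - m)))"
    for i' j' i'' j'' :: "nat \<Rightarrow> 'd" and t
  have c1: "map (c i' j' i'' j'') [1..<Suc m] = index_word m i' j'" for i' j' i'' j''
    by (auto simp: index_word_def c_def simp del: upt_Suc)
  have c2: "map (c i' j' i'' j'') [Suc m..<Suc (m + n)] = index_word n i'' j''" for i' j' i'' j''
    by (rule nth_equalityI) (auto simp: index_word_def c_def simp del: upt_Suc)
  have "(\<Sum>\<pi>\<in>P. kappa_double \<sigma> m n \<pi> a b $ (p, r) $ (q, s)) =
      (\<Sum>i'\<in>index_maps m. \<Sum>j'\<in>index_maps m. \<Sum>i''\<in>index_maps n. \<Sum>j''\<in>index_maps n. \<Sum>\<pi>\<in>P.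
        word_weight a (index_word m i' j') p q * word_weight ?b (index_word n i'' j'') s r *
        of_real (pairing_weight \<sigma> \<pi> (c i' j' i'' j'')))"
    unfolding kappa_double_def dmatrix_def line_product_eq_word_weight c_def
    by (simp add: sum.swap[of _ _ P])
  also have "\<dots> = (\<Sum>i'\<in>index_maps m. \<Sum>j'\<in>index_maps m. \<Sum>i''\<in>index_maps n. \<Sum>j''\<in>index_maps n.
        word_weight a (index_word m i' j') p q * word_weight ?b (index_word n i'' j'') s r *
        of_real (g (index_word m i' j') (index_word n i'' j'')))"
    by (simp only: sum_distrib_left[symmetric] of_real_sum[symmetric] P c1 c2)
  also have "\<dots> = (\<Sum>w | length w = m. \<Sum>w' | length w' = n. word_weight a w p q *
      word_weight ?b w' s r * of_real (g w w'))"
    by (simp only: sum_index_maps[where F = "\<lambda>w'. word_weight a w p q * word_weight ?b w' s r * of_real (g w w')" for w]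
        sum_index_maps[where F = "\<lambda>w. \<Sum>w' | length w' = n. word_weight a w p q * word_weight ?b w' s r * of_real (g w w')"])
  finally show ?thesis .
qed

definition line_weight :: "'r::comm_ring_1^'d^'d::finite \<Rightarrow> ('d \<times> 'd) list \<Rightarrow> 'd \<Rightarrow> 'd \<Rightarrow> 'r" where
  "line_weight x = word_weight (\<lambda>_. x)"

text \<open>The line weight with identity matrices at both ends, as in \<open>H\<close>: n letters
  carry n - 1 matrices instead of n + 1. The value 0 on the empty word matches the condition that
  both lines of a member of \<open>DP_par\<close> are nonempty.\<close>

definition core_weight :: "'r::comm_ring_1^'d^'d::finite \<Rightarrow> ('d \<times> 'd) list \<Rightarrow> 'd \<Rightarrow> 'd \<Rightarrow> 'r" where
  "core_weight x w p q = (if w = [] then 0 else word_weight (flank (length w) x) w p q)"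

lemma line_weight_simps [simp]:
  "line_weight x [] p q = x $ p $ q"
  "line_weight x (l # w) p q = x $ p $ fst l * line_weight x w (snd l) q" by (simp_all add: line_weight_def)

lemma core_weight_Nil [simp]: "core_weight x [] p q = 0"
  by (simp add: core_weight_def)

lemma core_weight_single: "core_weight x [l] p q = (if p = fst l \<and> snd l = q then 1 else 0)"
  by (simp add: core_weight_def flank_def mat_def)

lemma core_weight_Cons_Cons:
  "core_weight x (l # l' # w) p q =
    (if p = fst l then 1 else 0) * x $ snd l $ fst l' * core_weight x (l' # w) (fst l') q"
proof -
  have flank: "word_weight (\<lambda>k. flank (Suc (Suc (length w))) x (Suc (Suc k))) w a q =
      word_weight (\<lambda>k. flank (Suc (length w)) x (Suc k)) w a q" for a
    by (rule word_weight_cong) (auto simp: flank_def)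
  show ?thesis by (simp add: core_weight_def flank) (simp add: flank_def mat_def)
qed

lemma line_weight_append:
  "line_weight x (u @ l # v) p q = line_weight x u p (fst l) * line_weight x v (snd l) q"
  by (induction u arbitrary: p) (auto simp: mult.assoc)

lemma core_weight_head: "g \<noteq> fst l \<Longrightarrow> core_weight x (l # w) g q = 0"
  by (cases w) (auto simp: core_weight_single core_weight_Cons_Cons)

lemma sum_core_weight_head:
  "(\<Sum>g\<in>UNIV. f g * core_weight x (l # w) g q) = f (fst l) * core_weight x (l # w) (fst l) q"
proof -
  have "(\<Sum>g\<in>UNIV. f g * core_weight x (l # w) g q) = (\<Sum>g\<in>{fst l}. f g * core_weight x (l # w) g q)"
    by (rule sum.mono_neutral_right) (auto simp: core_weight_head)
  then show ?thesis by simp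
qed

lemma core_weight_append_left:
  "m \<noteq> [] \<Longrightarrow> core_weight x (l # k @ m) p q =
    (if p = fst l then (\<Sum>g\<in>UNIV. line_weight x k (snd l) g * core_weight x m g q) else 0)"
proof (induction k arbitrary: l p)
  case Nil
  then obtain l' w where m: "m = l' # w" by (cases m) auto
  show ?case unfolding m by (simp add: core_weight_Cons_Cons sum_core_weight_head)
next
  case (Cons l' k)
  then show ?case by (simp add: core_weight_Cons_Cons sum_distrib_left mult.assoc)
qed

text \<open>The matrices at the two joints are supplied by the line through \<open>k\<close>, which
  has one matrix more than letters, while each core has one less; the total is again one less.
  \<open>line_weight_core_append\<close> is the same count with the core in the middle.\<close>

lemma core_weight_append:
  assumes "m1 \<noteq> []" "m2 \<noteq> []"
  shows "core_weight x (m1 @ k @ m2) p q =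
    (\<Sum>e\<in>UNIV. \<Sum>g\<in>UNIV. core_weight x m1 p e * line_weight x k e g * core_weight x m2 g q)" using assms(1)
proof (induction m1 arbitrary: p)
  case (Cons l w)
  show ?case
  proof (cases w)
    case Nil
    have "(\<Sum>e\<in>UNIV. \<Sum>g\<in>UNIV. core_weight x [l] p e * line_weight x k e g * core_weight x m2 g q) =
        (\<Sum>e\<in>UNIV. if snd l = e then (if p = fst l then (\<Sum>g\<in>UNIV. line_weight x k e g * core_weight x m2 g q) else 0) else 0)"
      by (rule sum.cong) (auto simp: core_weight_single)
    then show ?thesis using Nil by (simp add: core_weight_append_left[OF assms(2)])
  next
    case (Cons l' w')
    then show ?thesis using Cons.IH[of "fst l'"]
      by (simp add: core_weight_Cons_Cons sum_distrib_left mult.assoc)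
  qed
qed simp

lemma line_weight_core_append:
  assumes "m \<noteq> []"
  shows "line_weight x (u @ m @ v) p q =
    (\<Sum>g\<in>UNIV. \<Sum>h\<in>UNIV. line_weight x u p g * core_weight x m g h * line_weight x v h q)"
proof (induction u arbitrary: p)
  case Nil
  show ?case using assms
  proof (induction m arbitrary: p)
    case (Cons l w)
    have pull: "(\<Sum>g\<in>UNIV. \<Sum>h\<in>UNIV. x $ p $ g * core_weight x (l # w) g h * line_weight x v h q) =
        x $ p $ fst l * (\<Sum>h\<in>UNIV. core_weight x (l # w) (fst l) h * line_weight x v h q)" for l w p
    proof -
      have "(\<Sum>h\<in>UNIV. x $ p $ g * core_weight x (l # w) g h * line_weight x v h q) =
          (if g = fst l then x $ p $ fst l * (\<Sum>h\<in>UNIV. core_weight x (l # w) (fst l) h * line_weight x v h q) else 0)" for g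
        by (cases "g = fst l") (simp_all add: core_weight_head sum_distrib_left mult.assoc)
      then show ?thesis by simp
    qed
    show ?case
    proof (cases w)
      case Nil
      have "(\<Sum>h\<in>UNIV. core_weight x [l] (fst l) h * line_weight x v h q) = line_weight x v (snd l) q"
        by (simp add: core_weight_single if_distrib[of "\<lambda>c. c * _"] cong: if_cong)
      then show ?thesis using Nil pull[of p l w] by simp
    next
      case (Cons l' w')
      have "line_weight x ((l' # w') @ v) (snd l) q = x $ snd l $ fst l' *
          (\<Sum>h\<in>UNIV. core_weight x (l' # w') (fst l') h * line_weight x v h q)"
        using Cons.IH[of "snd l"] Cons pull[of "snd l" l' w'] by simp
      then show ?thesis
        using pull[of p l w] Cons by (simp add: core_weight_Cons_Cons sum_distrib_left mult.assoc)
    qed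
  qed simp
next
  case (Cons l u)
  then show ?case by (simp add: sum_distrib_left mult.assoc)
qed

text \<open>Traversing a line backwards transposes its matrices, reverses its word and swaps every
  index pair. This reconciles the direction of the second line in \<open>kappa_double\<close> with
  those in \<open>G_S\<close> and \<open>G_D\<close>.\<close>

lemma line_weight_transpose:
  "line_weight (transpose x) (rev (map prod.swap w)) q p = line_weight x w p q"
  by (induction w arbitrary: p) (simp_all add: line_weight_append transpose_def mult.commute)

lemma mps_homogeneous_transpose:
  "(\<And>p q. homog n (x $ p $ q)) \<Longrightarrow> homog n (transpose x $ p $ q)"
  by (simp add: transpose_def)

lemma mps_homogeneous_line_weight:
  assumes "\<And>p q. homog (Suc 0) (x $ p $ q)"
  shows "homog (length w + 1) (line_weight x w p q)"
proof (induction w arbitrary: p)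
  case (Cons l w)
  show ?case using mps_homogeneous_mult[OF assms Cons] by simp
qed (simp add: assms)

lemma mps_homogeneous_core_weight:
  assumes "\<And>p q. homog (Suc 0) (x $ p $ q)"
  shows "homog (length w - 1) (core_weight x w p q)"
proof (cases w)
  case (Cons l v)
  have "homog (length v) (core_weight x (l # v) p q)"
  proof (induction v arbitrary: l p)
    case Nil
    then show ?case by (simp add: core_weight_single mps_homogeneous_0 mps_homogeneous_1)
  next
    case (Cons l' v)
    show ?case using mps_homogeneous_mult[OF assms Cons[of l']]
      by (auto simp: core_weight_Cons_Cons mps_homogeneous_0)
  qed
  then show ?thesis using Cons by simp
qed (simp add: mps_homogeneous_0)

lemma locally_finite_line_weight:
  fixes x :: "'v mps^'d^'d::finite"
  assumes "\<And>p q. homog (Suc 0) (x $ p $ q)"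
  shows "lfin (\<lambda>w. line_weight x w p q) UNIV"
proof (rule mps_locally_finiteI[where deg = "\<lambda>w. length w + 1"])
  fix k
  show "finite {w \<in> UNIV. length (w :: ('d \<times> 'd) list) + 1 = k}"
    by (rule finite_subset[OF _ finite_words[of "k - 1"]]) auto
qed (rule mps_homogeneous_line_weight[OF assms])

lemma locally_finite_words:
  fixes f :: "('d::finite \<times> 'd) list \<Rightarrow> 'v mps"
  assumes "\<And>w. homog (length w - 1) (f w)"
  shows "lfin f UNIV"
proof (rule mps_locally_finiteI[where deg = "\<lambda>w. length w - 1"])
  fix k
  \<comment> \<open>Truncated subtraction puts the empty word into degree 0, together with the
    one-letter words.\<close>
  have "finite ({w :: ('d \<times> 'd) list. length w = 0} \<union> {w. length w = Suc k})"
    using finite_words[of 0] finite_words[of "Suc k"] by blast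
  then show "finite {w \<in> UNIV. length (w :: ('d \<times> 'd) list) - 1 = k}" by (rule rev_finite_subset) auto
qed (rule assms)

lemma locally_finite_core_weight:
  assumes "\<And>p q. homog (Suc 0) (x $ p $ q)"
  shows "lfin (\<lambda>w. core_weight x w p q) UNIV"
  by (rule locally_finite_words[OF mps_homogeneous_core_weight[OF assms]])

lemma locally_finite_flank:
  assumes "\<And>p q. homog (Suc 0) (x $ p $ q)"
  shows "lfin (\<lambda>w. word_weight (flank (length w) x) w p q) UNIV"
proof (rule locally_finite_words)
  fix w
  show "homog (length w - 1) (word_weight (flank (length w) x) w p q)"
    using mps_homogeneous_core_weight[of x w p q, OF assms]
    by (cases w) (auto simp: core_weight_def flank_def mat_def mps_homogeneous_0 mps_homogeneous_1)
qed

lemma locally_finite_pair: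
  assumes "lfin f UNIV" "lfin g UNIV"
  shows "lfin (\<lambda>z. f (fst z) * g (snd z)) UNIV"
  using mps_locally_finite_times[OF assms] by (simp add: case_prod_unfold)

lemma mps_sum_pair:
  assumes "lfin f UNIV" "lfin g UNIV"
  shows "mps_sum f UNIV * mps_sum g UNIV = mps_sum (\<lambda>z. f (fst z) * g (snd z)) UNIV"
  using mps_sum_times[OF assms] by (simp add: case_prod_unfold)

section \<open>The four transforms as series over words\<close>

lemma sum_NC2_pairing_weight:
  assumes sym: "\<And>x y. \<sigma> x y = \<sigma> y x"
  shows "(\<Sum>\<pi>\<in>NC2 n. pairing_weight \<sigma> \<pi> c) = disc_moment \<sigma> (map c [1..<Suc n])"
proof -
  have "pairing_sum (\<lambda>B. \<sigma> (c (Min B)) (c (Max B))) (planar [1..<Suc n]) = disc_moment \<sigma> (map c [1..<Suc n])"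
    by (rule pairing_sum_planar[OF distinct_upt]) (rule pair_weight[OF sym])
  then show ?thesis by (simp add: NC2_eq_planar pairing_sum_def pairing_weight_def del: upt_Suc)
qed

lemma annular_moment_Nil_right: "annular_moment s w [] = 0"
proof (induction w rule: length_induct)
  case (1 w)
  show ?case
  proof (cases w)
    case (Cons x w0)
    have "letter_sum (\<lambda>u y v. s x y * (disc_moment s u * annular_moment s v [] + annular_moment s u [] * disc_moment s v)) w0 = 0"
      using 1 Cons by (subst letter_sum_cong[where G = "\<lambda>u y v. 0"]) (auto simp: letter_sum_0)
    then show ?thesis by (simp add: Cons annular_moment_Cons)
  qed simp
qed

lemma upt_append: "[1..<Suc m] @ [Suc m..<Suc (m + n)] = [1..<Suc (m + n)]"
  using upt_add_eq_append[of 1 "Suc m" n] by simp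

lemma sum_NC2_annular_pairing_weight:
  assumes sym: "\<And>x y. \<sigma> x y = \<sigma> y x" and mn: "1 \<le> m" "1 \<le> n"
  shows "(\<Sum>\<pi>\<in>NC2_annular m n. pairing_weight \<sigma> \<pi> c) =
    annular_moment \<sigma> (map c [1..<Suc m]) (map c [Suc m..<Suc (m + n)])"
proof -
  have "pairing_sum (\<lambda>B. \<sigma> (c (Min B)) (c (Max B))) (annular [1..<Suc m] [Suc m..<Suc (m + n)]) =
      annular_moment \<sigma> (map c [1..<Suc m]) (map c [Suc m..<Suc (m + n)])"
  proof (rule pairing_sum_annular)
    show "distinct ([1..<Suc m] @ [Suc m..<Suc (m + n)])" by (auto simp del: upt_Suc)
  qed (rule pair_weight[OF sym])
  then show ?thesis by (simp add: NC2_annular_eq[OF mn] pairing_sum_def pairing_weight_def del: upt_Suc)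
qed

lemma sum_parallel_pairing_weight:
  assumes sym: "\<And>x y. \<sigma> x y = \<sigma> y x" and mn: "1 \<le> m" "1 \<le> n"
  shows "(\<Sum>\<pi> | \<pi> \<in> NC2 (m + n) \<and> {1, m + n} \<in> \<pi> \<and> {m, m + 1} \<in> \<pi>. pairing_weight \<sigma> \<pi> c) =
    double_link \<sigma> (map c [1..<Suc m]) (map c [Suc m..<Suc (m + n)])"
proof -
  let ?w = "[1..<Suc m]" and ?w' = "[Suc m..<Suc (m + n)]"
  have hl: "hd ?w = 1" "last ?w = m" "hd ?w' = m + 1" "last ?w' = m + n" "?w \<noteq> []" "?w' \<noteq> []"
    using mn by (auto simp: hd_append)
  have d: "distinct (?w @ ?w')" by (auto simp del: upt_Suc)
  have "pairing_sum (\<lambda>B. \<sigma> (c (Min B)) (c (Max B)))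
      {\<pi> \<in> planar (?w @ ?w'). {hd ?w, last ?w'} \<in> \<pi> \<and> {last ?w, hd ?w'} \<in> \<pi>} =
    double_link \<sigma> (map c ?w) (map c ?w')"
    by (rule pairing_sum_double_link[OF d hl(5,6) _ sym]) (rule pair_weight[OF sym])
  then show ?thesis
    unfolding hl(1-4) upt_append by (simp add: NC2_eq_planar pairing_sum_def pairing_weight_def del: upt_Suc)
qed

lemma G_S_words:
  fixes x :: "'v mps^'d::finite^'d"
  assumes x: "\<And>p q. homog (Suc 0) (x $ p $ q)" and sym: "\<And>x y. \<sigma> x y = \<sigma> y x"
  shows "G_S \<sigma> x $ p $ q = mps_sum (\<lambda>w. line_weight x w p q * of_real (disc_moment \<sigma> w)) UNIV"
proof -
  have "mps_sum (\<lambda>s. (case s of (n, \<pi>) \<Rightarrow> kappa_single \<sigma> n \<pi> (\<lambda>_. x)) $ p $ q) SP =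
      mps_sum (\<lambda>w. line_weight x w p q * of_real (disc_moment \<sigma> w)) UNIV"
  proof (rule mps_sum_regroup[where d = fst and e = length])
    show "lfin (\<lambda>s. (case s of (n, \<pi>) \<Rightarrow> kappa_single \<sigma> n \<pi> (\<lambda>_. x)) $ p $ q) SP"
      by (rule G_S_locally_finite[OF x x])
    show "lfin (\<lambda>w. line_weight x w p q * of_real (disc_moment \<sigma> w)) UNIV"
      by (intro mps_locally_finite_scale locally_finite_line_weight x)
    fix n :: nat
    have SPn: "{s \<in> SP. fst s = n} = Pair n ` NC2 n" by (auto simp: SP_def)
    have "finite (NC2 n)" by (rule finite_subset[OF _ finite_pairings]) (auto simp: NC2_def)
    then show "finite {s \<in> SP. fst s = n}" by (simp add: SPn)
    show "finite {t \<in> UNIV. length (t :: ('d \<times> 'd) list) = n}" using finite_words[of n] by simp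
    have "(\<Sum>s | s \<in> SP \<and> fst s = n. (case s of (n, \<pi>) \<Rightarrow> kappa_single \<sigma> n \<pi> (\<lambda>_. x)) $ p $ q) =
        (\<Sum>\<pi>\<in>NC2 n. kappa_single \<sigma> n \<pi> (\<lambda>_. x) $ p $ q)"
      unfolding SPn by (subst sum.reindex) (auto simp: inj_on_def)
    also have "\<dots> = (\<Sum>w | length w = n. line_weight x w p q * of_real (disc_moment \<sigma> w))"
      unfolding line_weight_def by (rule sum_kappa_single) (rule sum_NC2_pairing_weight[OF sym])
    finally show "(\<Sum>s | s \<in> SP \<and> fst s = n. (case s of (n, \<pi>) \<Rightarrow> kappa_single \<sigma> n \<pi> (\<lambda>_. x)) $ p $ q) =
        (\<Sum>t | t \<in> UNIV \<and> length t = n. line_weight x t p q * of_real (disc_moment \<sigma> t))" by simp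
  qed
  then show ?thesis by (simp add: G_S_def matrix_mps_sum_def)
qed

text \<open>One regrouping serves the three two-line transforms: for fixed \<open>(m, n)\<close>
  both sides are finite sums. The matrices may depend on the lengths because \<open>flank\<close>
  does.\<close>

lemma kappa_double_words:
  fixes a b :: "nat \<Rightarrow> nat \<Rightarrow> 'v mps^'d::finite^'d"
  assumes S: "S = {(m, n, \<pi>). \<pi> \<in> P m n}" and fin: "\<And>m n. finite (P m n)"
    and P: "\<And>m n c. (\<Sum>\<pi>\<in>P m n. pairing_weight \<sigma> \<pi> c) = g (map c [1..<Suc m]) (map c [Suc m..<Suc (m + n)])"
    and lf: "lfin (\<lambda>s'. (case s' of (m, n, \<pi>) \<Rightarrow> kappa_double \<sigma> m n \<pi> (a m) (b n)) $ (p, r) $ (q, s)) S"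
    and F: "\<And>w. word_weight (a (length w)) w p q = F w"
    and F': "\<And>w. word_weight (\<lambda>k. transpose (b (length w) (length w - k))) w s r = F' w"
    and lfF: "lfin F UNIV" "lfin F' UNIV"
  shows "matrix_mps_sum (\<lambda>(m, n, \<pi>). kappa_double \<sigma> m n \<pi> (a m) (b n)) S $ (p, r) $ (q, s) =
    mps_sum (\<lambda>z. F (fst z) * F' (snd z) * of_real (g (fst z) (snd z))) UNIV"
proof -
  have "mps_sum (\<lambda>s'. (case s' of (m, n, \<pi>) \<Rightarrow> kappa_double \<sigma> m n \<pi> (a m) (b n)) $ (p, r) $ (q, s)) S =
      mps_sum (\<lambda>z. F (fst z) * F' (snd z) * of_real (g (fst z) (snd z))) UNIV"
  proof (rule mps_sum_regroup[where d = "\<lambda>(m, n, \<pi>). (m, n)" and e = "\<lambda>z. (length (fst z), length (snd z))", OF lf])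
    show "lfin (\<lambda>z. F (fst z) * F' (snd z) * of_real (g (fst z) (snd z))) UNIV"
      by (intro mps_locally_finite_scale locally_finite_pair lfF)
    fix k :: "nat \<times> nat"
    obtain m n where k: "k = (m, n)" by (cases k)
    have Sk: "{s \<in> S. (case s of (m, n, \<pi>) \<Rightarrow> (m, n)) = k} = (\<lambda>\<pi>. (m, n, \<pi>)) ` P m n" by (auto simp: S k)
    then show "finite {s \<in> S. (case s of (m, n, \<pi>) \<Rightarrow> (m, n)) = k}" by (simp add: fin)
    have Tk: "{t \<in> UNIV. (length (fst t :: ('d \<times> 'd) list), length (snd t :: ('d \<times> 'd) list)) = k} =
        {w. length w = m} \<times> {w'. length w' = n}" by (auto simp: k)
    then show "finite {t \<in> UNIV. (length (fst t :: ('d \<times> 'd) list), length (snd t :: ('d \<times> 'd) list)) = k}"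
      by (simp add: finite_words)
    have "(\<Sum>s' | s' \<in> S \<and> (case s' of (m, n, \<pi>) \<Rightarrow> (m, n)) = k.
          (case s' of (m, n, \<pi>) \<Rightarrow> kappa_double \<sigma> m n \<pi> (a m) (b n)) $ (p, r) $ (q, s)) =
        (\<Sum>\<pi>\<in>P m n. kappa_double \<sigma> m n \<pi> (a m) (b n) $ (p, r) $ (q, s))"
      unfolding Sk by (subst sum.reindex) (auto simp: inj_on_def)
    also have "\<dots> = (\<Sum>w | length w = m. \<Sum>w' | length w' = n. word_weight (a m) w p q *
        word_weight (\<lambda>k. transpose (b n (n - k))) w' s r * of_real (g w w'))"
      by (rule sum_kappa_double) (rule P)
    also have "\<dots> = (\<Sum>w | length w = m. \<Sum>w' | length w' = n. F w * F' w' * of_real (g w w'))"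
      by (intro sum.cong refl) (auto simp: F[symmetric] F'[symmetric])
    also have "\<dots> = (\<Sum>t | t \<in> UNIV \<and> (length (fst t), length (snd t)) = k.
        F (fst t) * F' (snd t) * of_real (g (fst t) (snd t)))"
      unfolding Tk by (simp add: sum.cartesian_product case_prod_unfold)
    finally show "(\<Sum>s' | s' \<in> S \<and> (case s' of (m, n, \<pi>) \<Rightarrow> (m, n)) = k.
          (case s' of (m, n, \<pi>) \<Rightarrow> kappa_double \<sigma> m n \<pi> (a m) (b n)) $ (p, r) $ (q, s)) =
        (\<Sum>t | t \<in> UNIV \<and> (length (fst t), length (snd t)) = k.
          F (fst t) * F' (snd t) * of_real (g (fst t) (snd t)))" .
  qed
  then show ?thesis by (simp add: matrix_mps_sum_def)
qed

context
  fixes x y :: "'v mps^'d::finite^'d" and \<sigma> :: "'d \<times> 'd \<Rightarrow> 'd \<times> 'd \<Rightarrow> real"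
  assumes x: "\<And>p q. homog (Suc 0) (x $ p $ q)"
    and y: "\<And>p q. homog (Suc 0) (y $ p $ q)"
    and sym: "\<And>c c'. \<sigma> c c' = \<sigma> c' c"
begin

lemma G_D_words:
  "G_D \<sigma> x y $ (p, r) $ (q, s) = mps_sum (\<lambda>z. line_weight x (fst z) p q *
    line_weight (transpose y) (snd z) s r * of_real (disc_moment \<sigma> (fst z @ snd z))) UNIV" unfolding G_D_def
proof (rule kappa_double_words[where P = "\<lambda>m n. NC2 (m + n)" and a = "\<lambda>_ _. x" and b = "\<lambda>_ _. y"
      and g = "\<lambda>w w'. disc_moment \<sigma> (w @ w')"])
  show "DP = {(m, n, \<pi>). \<pi> \<in> NC2 (m + n)}" by (simp add: DP_def)
  show "finite (NC2 (m + n))" for m n by (rule finite_subset[OF _ finite_pairings]) (auto simp: NC2_def)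
  show "(\<Sum>\<pi>\<in>NC2 (m + n). pairing_weight \<sigma> \<pi> c) =
      disc_moment \<sigma> (map c [1..<Suc m] @ map c [Suc m..<Suc (m + n)])" for m n c
    unfolding sum_NC2_pairing_weight[of \<sigma>, OF sym] map_append[symmetric] upt_append ..
  show "lfin (\<lambda>s'. (case s' of (m, n, \<pi>) \<Rightarrow> kappa_double \<sigma> m n \<pi> (\<lambda>_. x) (\<lambda>_. y)) $ (p, r) $ (q, s)) DP"
    using x y by (rule G_D_locally_finite)
  show "lfin (\<lambda>w. line_weight x w p q) UNIV" by (rule locally_finite_line_weight[OF x])
  show "lfin (\<lambda>w. line_weight (transpose y) w s r) UNIV"
    by (rule locally_finite_line_weight[OF mps_homogeneous_transpose[OF y]])
qed (simp_all add: line_weight_def)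

text \<open>\<open>annular_moment\<close> vanishes when either word is empty, so the sum may run
  over all pairs of words although \<open>AP\<close> has both circles nonempty.\<close>

lemma G_A_words:
  "G_A \<sigma> x y $ (p, r) $ (q, s) = mps_sum (\<lambda>z. line_weight x (fst z) p q *
    line_weight (transpose y) (snd z) s r * of_real (annular_moment \<sigma> (fst z) (snd z))) UNIV"
  unfolding G_A_def
proof (rule kappa_double_words[where P = "\<lambda>m n. if 1 \<le> m \<and> 1 \<le> n then NC2_annular m n else {}"
      and a = "\<lambda>_ _. x" and b = "\<lambda>_ _. y" and g = "annular_moment \<sigma>"])
  show "AP = {(m, n, \<pi>). \<pi> \<in> (if 1 \<le> m \<and> 1 \<le> n then NC2_annular m n else {})}"
    by (auto simp: AP_def split: if_splits)
  show "finite (if 1 \<le> m \<and> 1 \<le> n then NC2_annular m n else {})" for m n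
    using finite_subset[OF _ finite_pairings[of "m + n"]] by (auto simp: NC2_annular_def)
  show "(\<Sum>\<pi>\<in>(if 1 \<le> m \<and> 1 \<le> n then NC2_annular m n else {}). pairing_weight \<sigma> \<pi> c) =
      annular_moment \<sigma> (map c [1..<Suc m]) (map c [Suc m..<Suc (m + n)])" for m n c
  proof (cases "1 \<le> m \<and> 1 \<le> n")
    case True
    then show ?thesis using sum_NC2_annular_pairing_weight[of \<sigma> m n, OF sym] by simp
  next
    case False
    then have "m = 0 \<or> n = 0" by auto
    then show ?thesis using annular_moment_Nil_right[of \<sigma>] by auto
  qed
  show "lfin (\<lambda>s'. (case s' of (m, n, \<pi>) \<Rightarrow> kappa_double \<sigma> m n \<pi> (\<lambda>_. x) (\<lambda>_. y)) $ (p, r) $ (q, s)) AP"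
    using x y by (rule G_A_locally_finite)
  show "lfin (\<lambda>w. line_weight x w p q) UNIV" by (rule locally_finite_line_weight[OF x])
  show "lfin (\<lambda>w. line_weight (transpose y) w s r) UNIV"
    by (rule locally_finite_line_weight[OF mps_homogeneous_transpose[OF y]])
qed (simp_all add: line_weight_def)

lemma H_words:
  "H \<sigma> x y $ (p, r) $ (q, s) = mps_sum (\<lambda>z. core_weight x (fst z) p q *
    core_weight (transpose y) (snd z) s r * of_real (double_link \<sigma> (fst z) (snd z))) UNIV"
proof -
  let ?P = "\<lambda>m n. {\<pi>. 1 \<le> m \<and> 1 \<le> n \<and> \<pi> \<in> NC2 (m + n) \<and> {1, m + n} \<in> \<pi> \<and> {m, m + 1} \<in> \<pi>}"
  let ?F = "\<lambda>w. word_weight (flank (length w) x) w p q"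
  let ?F' = "\<lambda>w. word_weight (\<lambda>k. transpose (flank (length w) y (length w - k))) w s r"
  \<comment> \<open>\<open>flank\<close> is invariant under reversing the positions, and its
    identity matrices are their own transposes.\<close>
  have tr: "?F' w = word_weight (flank (length w) (transpose y)) w s r" for w
    by (rule word_weight_cong) (auto simp: flank_def transpose_mat)
  have nil: "double_link \<sigma> [] w = 0" "double_link \<sigma> w [] = 0" for w by simp_all
  have "H \<sigma> x y $ (p, r) $ (q, s) =
      mps_sum (\<lambda>z. ?F (fst z) * ?F' (snd z) * of_real (double_link \<sigma> (fst z) (snd z))) UNIV" unfolding H_def
  proof (rule kappa_double_words[where P = ?P and g = "double_link \<sigma>"])
    show "DP_par = {(m, n, \<pi>). \<pi> \<in> ?P m n}" by (auto simp: DP_par_def)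
    show "finite (?P m n)" for m n
      by (rule finite_subset[OF _ finite_pairings[of "m + n"]]) (auto simp: NC2_def)
    show "(\<Sum>\<pi>\<in>?P m n. pairing_weight \<sigma> \<pi> c) =
        double_link \<sigma> (map c [1..<Suc m]) (map c [Suc m..<Suc (m + n)])" for m n c
    proof (cases "1 \<le> m \<and> 1 \<le> n")
      case True
      then show ?thesis using sum_parallel_pairing_weight[of \<sigma> m n, OF sym] by simp
    next
      case False
      then have "?P m n = {}" by auto
      moreover have "m = 0 \<or> n = 0" using False by auto
      ultimately show ?thesis using nil by auto
    qed
    show "lfin (\<lambda>s'. (case s' of (m, n, \<pi>) \<Rightarrow> kappa_double \<sigma> m n \<pi> (flank m x) (flank n y)) $ (p, r) $ (q, s)) DP_par"
      using x y by (rule H_locally_finite)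
    show "lfin ?F UNIV" "lfin ?F' UNIV"
      unfolding tr by (intro locally_finite_flank x mps_homogeneous_transpose y)+
  qed simp_all
  also have "(\<lambda>z. ?F (fst z) * ?F' (snd z) * of_real (double_link \<sigma> (fst z) (snd z))) =
      (\<lambda>z. core_weight x (fst z) p q * core_weight (transpose y) (snd z) s r * of_real (double_link \<sigma> (fst z) (snd z)))"
    by (rule ext) (auto simp: core_weight_def tr)
  finally show ?thesis .
qed

end

section \<open>The product formula\<close>

lemma locally_finite_triple:
  assumes "lfin f UNIV" "lfin g UNIV" "lfin h UNIV"
  shows "lfin (\<lambda>t. f (fst (fst t)) * g (snd (fst t)) * h (snd t)) UNIV"
  using locally_finite_pair[OF locally_finite_pair[OF assms(1,2)] assms(3)] .

lemma mps_sum_triple: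
  assumes "lfin f UNIV" "lfin g UNIV" "lfin h UNIV"
  shows "mps_sum f UNIV * mps_sum g UNIV * mps_sum h UNIV =
    mps_sum (\<lambda>t. f (fst (fst t)) * g (snd (fst t)) * h (snd t)) UNIV"
  unfolding mps_sum_pair[OF assms(1,2)] by (rule mps_sum_pair[OF locally_finite_pair[OF assms(1,2)] assms(3)])

lemma mps_sum_sum2:
  fixes F :: "'x::finite \<Rightarrow> 'y::finite \<Rightarrow> 'i \<Rightarrow> 'v mps"
  assumes "\<And>k j. lfin (F k j) UNIV"
  shows "(\<Sum>k\<in>UNIV. \<Sum>j\<in>UNIV. mps_sum (F k j) UNIV) = mps_sum (\<lambda>t. \<Sum>k\<in>UNIV. \<Sum>j\<in>UNIV. F k j t) UNIV"
    and "lfin (\<lambda>t. \<Sum>k\<in>UNIV. \<Sum>j\<in>UNIV. F k j t) UNIV"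
proof -
  have lf: "lfin (\<lambda>t. \<Sum>j\<in>UNIV. F k j t) UNIV" for k
    by (rule mps_locally_finite_sum) (use assms in auto)
  show "(\<Sum>k\<in>UNIV. \<Sum>j\<in>UNIV. mps_sum (F k j) UNIV) = mps_sum (\<lambda>t. \<Sum>k\<in>UNIV. \<Sum>j\<in>UNIV. F k j t) UNIV"
    using assms lf by (simp add: mps_sum_sum)
  show "lfin (\<lambda>t. \<Sum>k\<in>UNIV. \<Sum>j\<in>UNIV. F k j t) UNIV"
    by (rule mps_locally_finite_sum) (use lf in auto)
qed

section \<open>Products of three series as sums over cuts\<close>

definition cuts3 :: "'l list \<Rightarrow> ('l list \<times> 'l list \<times> 'l list) set" where
  "cuts3 w = {(a, b, c). a @ b @ c = w}"

lemma finite_cuts: "finite {(u, v). u @ v = w}"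
proof (rule finite_subset)
  show "{(u, v). u @ v = w} \<subseteq> (\<lambda>k. (take k w, drop k w)) ` {..length w}"
  proof clarify
    fix u v :: "'a list"
    show "(u, v) \<in> (\<lambda>k. (take k (u @ v), drop k (u @ v))) ` {..length (u @ v)}"
      by (rule image_eqI[of _ _ "length u"]) auto
  qed
qed simp

lemma cut_sum_set: "cut_sum F w = (\<Sum>(u, v)\<in>{(u, v). u @ v = w}. F u v)"
  unfolding cut_sum_eq
  by (rule sum.reindex_bij_witness[of _ "\<lambda>(u, v). length u" "\<lambda>k. (take k w, drop k w)"]) auto

lemma cuts3_eq: "cuts3 w = (\<lambda>((a, r), (b, c)). (a, b, c)) ` (SIGMA z:{(u, v). u @ v = w}. {(b, c). b @ c = snd z})"
  by (force simp: cuts3_def image_iff)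

lemma finite_cuts3: "finite (cuts3 w)"
  unfolding cuts3_eq by (intro finite_imageI finite_SigmaI finite_cuts)

lemma cut3_sum_set: "cut3_sum F w = (\<Sum>(a, b, c)\<in>cuts3 w. F a b c)"
proof -
  have "cut3_sum F w = (\<Sum>z\<in>{(u, v). u @ v = w}. \<Sum>y\<in>{(b, c). b @ c = snd z}. F (fst z) (fst y) (snd y))"
    by (simp add: cut3_sum_def cut_sum_set case_prod_unfold)
  also have "\<dots> = (\<Sum>(z, y)\<in>(SIGMA z:{(u, v). u @ v = w}. {(b, c). b @ c = snd z}). F (fst z) (fst y) (snd y))"
    by (rule sum.Sigma) (auto simp: finite_cuts)
  also have "\<dots> = (\<Sum>(a, b, c)\<in>cuts3 w. F a b c)"
    by (rule sum.reindex_bij_witness[of _ "\<lambda>(a, b, c). ((a, b @ c), (b, c))" "\<lambda>((a, r), (b, c)). (a, b, c)"])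
      (auto simp: cuts3_def)
  finally show ?thesis .
qed

text \<open>Triples of pairs of words are graded by their two concatenations. The members of one
  grade are the independent threefold cuts of two given words, hence finite in number.\<close>

lemma mps_sum_cuts3:
  fixes h :: "'l list \<times> 'l list \<Rightarrow> 'l list \<times> 'l list \<Rightarrow> 'l list \<times> 'l list \<Rightarrow> 'v mps"
  assumes lf: "lfin (\<lambda>t. h (fst (fst t)) (snd (fst t)) (snd t)) UNIV" "lfin g UNIV"
    and eq: "\<And>w w'. g (w, w') = (\<Sum>(a, b, c)\<in>cuts3 w. \<Sum>(a', b', c')\<in>cuts3 w'. h (a, a') (b, b') (c, c'))"
  shows "mps_sum (\<lambda>t. h (fst (fst t)) (snd (fst t)) (snd t)) UNIV = mps_sum g UNIV"
proof (rule mps_sum_regroup[OF lf, where d = "\<lambda>t. (fst (fst (fst t)) @ fst (snd (fst t)) @ fst (snd t),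
      snd (fst (fst t)) @ snd (snd (fst t)) @ snd (snd t))" and e = id])
  fix k :: "'l list \<times> 'l list"
  obtain w w' where k: "k = (w, w')" by (cases k)
  let ?d = "\<lambda>t :: (('l list \<times> 'l list) \<times> ('l list \<times> 'l list)) \<times> ('l list \<times> 'l list).
    (fst (fst (fst t)) @ fst (snd (fst t)) @ fst (snd t), snd (fst (fst t)) @ snd (snd (fst t)) @ snd (snd t))"
  have T: "{t \<in> UNIV. ?d t = k} = (\<lambda>((a, b, c), (a', b', c')). (((a, a'), (b, b')), (c, c'))) ` (cuts3 w \<times> cuts3 w')"
    by (force simp: k cuts3_def image_iff)
  show "finite {t \<in> UNIV. ?d t = k}" unfolding T by (intro finite_imageI finite_SigmaI finite_cuts3)
  show "finite {t \<in> UNIV. id t = k}" by simp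
  have inj: "inj_on (\<lambda>((a, b, c), (a', b', c')). (((a, a'), (b, b')), (c, c'))) (cuts3 w \<times> cuts3 w')"
    by (auto simp: inj_on_def)
  have "(\<Sum>t | t \<in> UNIV \<and> ?d t = k. h (fst (fst t)) (snd (fst t)) (snd t)) =
      (\<Sum>((a, b, c), (a', b', c'))\<in>cuts3 w \<times> cuts3 w'. h (a, a') (b, b') (c, c'))"
    unfolding T by (subst sum.reindex[OF inj]) (simp add: case_prod_unfold)
  also have "\<dots> = g (w, w')" unfolding eq by (simp add: sum.cartesian_product case_prod_unfold)
  finally show "(\<Sum>t | t \<in> UNIV \<and> ?d t = k. h (fst (fst t)) (snd (fst t)) (snd t)) =
      (\<Sum>t | t \<in> UNIV \<and> id t = k. g t)" by (simp add: k)
qed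

lemma sum_UNIV_prod: "(\<Sum>z\<in>UNIV. F (fst z) (snd z)) = (\<Sum>a\<in>UNIV. \<Sum>b\<in>UNIV. F a b)"
  for F :: "'x::finite \<Rightarrow> 'y::finite \<Rightarrow> 'b::comm_monoid_add"
  by (simp add: UNIV_Times_UNIV[symmetric] sum.cartesian_product case_prod_unfold del: UNIV_Times_UNIV)

lemma sum_product_pairs:
  fixes X :: "'x::finite \<Rightarrow> 'y::finite \<Rightarrow> 'r::comm_semiring_0"
    and Y :: "'z::finite \<Rightarrow> 'w::finite \<Rightarrow> 'r"
  shows "(\<Sum>e\<in>UNIV. \<Sum>g\<in>UNIV. X e g) * (\<Sum>f\<in>UNIV. \<Sum>h\<in>UNIV. Y f h) =
    (\<Sum>z\<in>UNIV. \<Sum>y\<in>UNIV. X (fst y) (fst z) * Y (snd y) (snd z))"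
proof -
  have "(\<Sum>z\<in>UNIV. \<Sum>y\<in>UNIV. X (fst y) (fst z) * Y (snd y) (snd z)) =
      (\<Sum>g\<in>UNIV. \<Sum>h\<in>UNIV. \<Sum>e\<in>UNIV. \<Sum>f\<in>UNIV. X e g * Y f h)"
    unfolding sum_UNIV_prod[where F = "\<lambda>e f. X e (fst z) * Y f (snd z)" for z] by (rule sum_UNIV_prod)
  also have "\<dots> = (\<Sum>g\<in>UNIV. \<Sum>e\<in>UNIV. X e g) * (\<Sum>h\<in>UNIV. \<Sum>f\<in>UNIV. Y f h)" by (simp add: sum_product)
  also have "\<dots> = (\<Sum>e\<in>UNIV. \<Sum>g\<in>UNIV. X e g) * (\<Sum>f\<in>UNIV. \<Sum>h\<in>UNIV. Y f h)"
    by (simp only: sum.swap[of X UNIV UNIV] sum.swap[of Y UNIV UNIV])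
  finally show ?thesis by simp
qed

lemma of_real_cut3_cut3:
  "A * B * of_real (cut3_sum (\<lambda>a b c. cut3_sum (\<lambda>a' b' c'. F a b c a' b' c') w') w) =
    (\<Sum>(a, b, c)\<in>cuts3 w. \<Sum>(a', b', c')\<in>cuts3 w'. A * B * (of_real (F a b c a' b' c') :: 'r::{comm_ring_1,real_algebra_1}))"
  by (simp add: cut3_sum_set sum_distrib_left case_prod_unfold)

section \<open>The factor in braces and its product with the double-line transforms\<close>

definition core_series ::
    "('d \<times> 'd \<Rightarrow> 'd \<times> 'd \<Rightarrow> real) \<Rightarrow> 'v mps^'d^'d \<Rightarrow> 'v mps^'d^'d \<Rightarrow> ('v mps, 'd::finite) dmat" where
  "core_series \<sigma> x y = Theta (H \<sigma> x y) + Phi (Gamma_transpose (H \<sigma> x y) **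
     Gamma_transpose (kronecker (G_S \<sigma> x) (G_S \<sigma> y)) ** Gamma_transpose (H \<sigma> x y))"

context
  fixes x y :: "'v mps^'d::finite^'d" and \<sigma> :: "'d \<times> 'd \<Rightarrow> 'd \<times> 'd \<Rightarrow> real"
  assumes x: "\<And>p q. homog (Suc 0) (x $ p $ q)"
    and y: "\<And>p q. homog (Suc 0) (y $ p $ q)"
    and sym: "\<And>c c'. \<sigma> c c' = \<sigma> c' c"
    and swap: "\<And>c c'. \<sigma> (prod.swap c) (prod.swap c') = \<sigma> c c'"
begin

private abbreviation (input) "L \<equiv> line_weight x"
private abbreviation (input) "L' \<equiv> line_weight (transpose y)"
private abbreviation (input) "C \<equiv> core_weight x"
private abbreviation (input) "C' \<equiv> core_weight (transpose y)"
private abbreviation (input) "Ew \<equiv> disc_moment \<sigma>"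
private abbreviation (input) "Dl \<equiv> double_link \<sigma>"

lemma disc_moment_rev_swap: "Ew (rev (map prod.swap w)) = Ew w"
  using disc_moment_rev[of \<sigma> "map prod.swap w", OF sym] disc_moment_map[of \<sigma> prod.swap w, OF sym swap]
  by simp

lemma bij_rev_swap: "bij (\<lambda>w. rev (map prod.swap w) :: ('d \<times> 'd) list)"
  by (rule o_bij[of "\<lambda>w. rev (map prod.swap w)"]) (auto simp: rev_map comp_def)

lemma lf_L: "lfin (\<lambda>w. L w p q) UNIV" and lf_L': "lfin (\<lambda>w. L' w p q) UNIV"
  and lf_C: "lfin (\<lambda>w. C w p q) UNIV" and lf_C': "lfin (\<lambda>w. C' w p q) UNIV"
  by (intro locally_finite_line_weight locally_finite_core_weight mps_homogeneous_transpose x y)+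

text \<open>Reversing a word and swapping its pairs is a bijection that preserves disc moments, so
  \<open>G_S\<close> of \<open>y\<close> can be read along the second line, in the opposite
  direction.\<close>

lemma G_S_transposed:
  "G_S \<sigma> y $ h $ f = mps_sum (\<lambda>t. L' t f h * of_real (Ew t)) UNIV"
proof -
  have "G_S \<sigma> y $ h $ f = mps_sum (\<lambda>w. L' (rev (map prod.swap w)) f h * of_real (Ew (rev (map prod.swap w)))) UNIV"
    unfolding G_S_words[OF y sym] line_weight_transpose disc_moment_rev_swap ..
  also have "\<dots> = mps_sum (\<lambda>t. L' t f h * of_real (Ew t)) UNIV"
    by (rule mps_sum_reindex[OF bij_rev_swap, symmetric])
  finally show ?thesis .
qed

text \<open>The transposed second argument cancels the transposition built into
  \<open>kappa_double\<close>. Both lines then carry \<open>x\<close>: they are the parts of one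
  circle before its first and after its last through string.\<close>

lemma G_D_left:
  "G_D \<sigma> x (transpose x) $ (p, q) $ (a0, b0) =
    mps_sum (\<lambda>z. L (fst z) p a0 * L (snd z) b0 q * of_real (Ew (fst z @ snd z))) UNIV"
proof -
  show ?thesis
    using G_D_words[of x "transpose x" \<sigma>, OF x mps_homogeneous_transpose[OF x] sym] by (simp add: transpose_transpose)
qed

text \<open>The second circle is read backwards. Reversal exchanges its initial and final parts, and
  with them the two lines of \<open>G_D\<close>.\<close>

lemma G_D_right:
  "G_D \<sigma> y (transpose y) $ (r, s) $ (c0, d0) =
    mps_sum (\<lambda>z. L' (snd z) c0 r * L' (fst z) s d0 * of_real (Ew (fst z @ snd z))) UNIV"
proof -
  let ?r = "\<lambda>w. rev (map prod.swap w) :: ('d \<times> 'd) list"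
  let ?f = "\<lambda>z. L' (snd z) c0 r * L' (fst z) s d0 * of_real (Ew (fst z @ snd z))"
  have b: "bij (\<lambda>z. (?r (snd z), ?r (fst z)))"
    by (rule o_bij[of "\<lambda>z. (?r (snd z), ?r (fst z))"]) (auto simp: rev_map comp_def)
  have "Ew (?r v @ ?r u) = Ew (u @ v)" for u v using disc_moment_rev_swap[of "u @ v"] by simp
  moreover have "G_D \<sigma> y (transpose y) $ (r, s) $ (c0, d0) =
      mps_sum (\<lambda>z. line_weight y (fst z) r c0 * line_weight y (snd z) d0 s * of_real (Ew (fst z @ snd z))) UNIV"
    using G_D_words[of y "transpose y" \<sigma>, OF y mps_homogeneous_transpose[OF y] sym] by (simp add: transpose_transpose)
  ultimately have "G_D \<sigma> y (transpose y) $ (r, s) $ (c0, d0) = mps_sum (\<lambda>z. ?f (?r (snd z), ?r (fst z))) UNIV"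
    by (simp add: line_weight_transpose)
  also have "\<dots> = mps_sum ?f UNIV" by (rule mps_sum_reindex[OF b, symmetric])
  finally show ?thesis .
qed

lemma core_words:
  assumes "m1 \<noteq> []" "m2 \<noteq> []" "m1' \<noteq> []" "m2' \<noteq> []"
  shows "C (m1 @ k @ m2) a0 b0 * C' (m1' @ k' @ m2') d0 c0 =
    (\<Sum>z\<in>UNIV. \<Sum>e\<in>UNIV. (C m1 a0 (fst e) * L k (fst e) (fst z) * C m2 (fst z) b0) *
      (C' m1' d0 (snd e) * L' k' (snd e) (snd z) * C' m2' (snd z) c0))"
  unfolding core_weight_append[OF assms(1,2)] core_weight_append[OF assms(3,4)] by (rule sum_product_pairs)

lemma core_series_words:
  "core_series \<sigma> x y $ (a0, b0) $ (c0, d0) =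
    mps_sum (\<lambda>z. C (fst z) a0 b0 * C' (snd z) d0 c0 * of_real (annular_core \<sigma> (fst z) (snd z))) UNIV"
proof -
  define cc where "cc m m' = cut3_sum (\<lambda>m1 a m2. cut3_sum (\<lambda>m1' b m2'.
    Dl m1 m1' * Ew a * Ew b * Dl m2 m2') m') m" for m m'
  have Hw: "H \<sigma> x y $ (p, r) $ (q, s) = mps_sum (\<lambda>z. C (fst z) p q * C' (snd z) s r * of_real (Dl (fst z) (snd z))) UNIV"
    for p r q s by (rule H_words[OF x y sym])
  define f where "f e u = C (fst u) a0 (fst e) * C' (snd u) d0 (snd e) * of_real (Dl (fst u) (snd u))" for e u
  define g where "g z e u = (L (fst u) (fst e) (fst z) * of_real (Ew (fst u))) *
    (L' (snd u) (snd e) (snd z) * of_real (Ew (snd u)))" for z e u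
  define k where "k z u = C (fst u) (fst z) b0 * C' (snd u) (snd z) c0 * of_real (Dl (fst u) (snd u))" for z u
  define h where "h a b c = (\<Sum>z\<in>UNIV. \<Sum>e\<in>UNIV. f e a * g z e b * k z c)" for a b c
  have lf: "lfin (f e) UNIV" "lfin (g z e) UNIV" "lfin (k z) UNIV" for z e
    unfolding f_def[abs_def] g_def[abs_def] k_def[abs_def]
    by (intro mps_locally_finite_scale locally_finite_pair lf_L lf_L' lf_C lf_C')+
  let ?N = "Gamma_transpose (H \<sigma> x y) ** Gamma_transpose (kronecker (G_S \<sigma> x) (G_S \<sigma> y)) ** Gamma_transpose (H \<sigma> x y)"
  \<comment> \<open>Along the first circle the indices are \<open>a0\<close>, \<open>fst e\<close>,
    \<open>fst z\<close>, \<open>b0\<close>, along the second \<open>d0\<close>,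
    \<open>snd e\<close>, \<open>snd z\<close>, \<open>c0\<close>. The second circle meets
    \<open>G_S \<sigma> y\<close> against its direction, hence
    \<open>G_S_transposed\<close>.\<close>
  have "Phi ?N $ (a0, b0) $ (c0, d0) = (\<Sum>z\<in>UNIV. \<Sum>e\<in>UNIV.
      H \<sigma> x y $ (a0, snd e) $ (fst e, d0) * (G_S \<sigma> x $ fst e $ fst z * G_S \<sigma> y $ snd z $ snd e) *
      H \<sigma> x y $ (fst z, c0) $ (b0, snd z))"
    by (simp add: Phi_def Theta_def Gamma_transpose_def kronecker_def dmatrix_def dentry_def
        matrix_matrix_mult_def sum_distrib_right)
  also have "\<dots> = (\<Sum>z\<in>UNIV. \<Sum>e\<in>UNIV. mps_sum (\<lambda>t. f e (fst (fst t)) * g z e (snd (fst t)) * k z (snd t)) UNIV)"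
  proof (intro sum.cong refl)
    fix z e :: "'d \<times> 'd"
    have "G_S \<sigma> x $ fst e $ fst z * G_S \<sigma> y $ snd z $ snd e = mps_sum (g z e) UNIV"
      unfolding G_S_words[OF x sym] G_S_transposed g_def[abs_def]
      by (rule mps_sum_pair; intro mps_locally_finite_scale lf_L lf_L')
    moreover have "H \<sigma> x y $ (a0, snd e) $ (fst e, d0) = mps_sum (f e) UNIV"
      "H \<sigma> x y $ (fst z, c0) $ (b0, snd z) = mps_sum (k z) UNIV"
      by (simp_all add: Hw f_def[abs_def] k_def[abs_def])
    ultimately show "H \<sigma> x y $ (a0, snd e) $ (fst e, d0) * (G_S \<sigma> x $ fst e $ fst z * G_S \<sigma> y $ snd z $ snd e) *
        H \<sigma> x y $ (fst z, c0) $ (b0, snd z) =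
      mps_sum (\<lambda>t. f e (fst (fst t)) * g z e (snd (fst t)) * k z (snd t)) UNIV"
      using mps_sum_triple[OF lf] by (simp only:)
  qed
  also have "\<dots> = mps_sum (\<lambda>t. h (fst (fst t)) (snd (fst t)) (snd t)) UNIV"
    unfolding h_def by (rule mps_sum_sum2(1)) (rule locally_finite_triple[OF lf])
  also have "\<dots> = mps_sum (\<lambda>z. C (fst z) a0 b0 * C' (snd z) d0 c0 * of_real (cc (fst z) (snd z))) UNIV"
  proof (rule mps_sum_cuts3)
    show "lfin (\<lambda>t. h (fst (fst t)) (snd (fst t)) (snd t)) UNIV"
      unfolding h_def by (rule mps_sum_sum2(2)) (rule locally_finite_triple[OF lf])
    show "lfin (\<lambda>z. C (fst z) a0 b0 * C' (snd z) d0 c0 * of_real (cc (fst z) (snd z))) UNIV"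
      by (intro mps_locally_finite_scale locally_finite_pair lf_C lf_C')
    fix w w' :: "('d \<times> 'd) list"
    have "C w a0 b0 * C' w' d0 c0 * of_real (Dl m1 m1' * Ew l * Ew l' * Dl m2 m2') = h (m1, m1') (l, l') (m2, m2')"
      if "w = m1 @ l @ m2" "w' = m1' @ l' @ m2'" for m1 l m2 m1' l' m2'
    proof (cases "m1 = [] \<or> m1' = [] \<or> m2 = [] \<or> m2' = []")
      case True
      \<comment> \<open>An empty block makes both sides 0, through \<open>double_link\<close> on the
        left and through \<open>f\<close> or \<open>k\<close> on the right.\<close>
      then show ?thesis by (auto simp: h_def f_def k_def)
    next
      case False
      then show ?thesis
        unfolding that h_def f_def g_def k_def using core_words[of m1 m2 m1' m2' l a0 b0 l' d0 c0]
        by (simp add: sum_distrib_left sum_distrib_right mult_ac)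
    qed
    then show "C (fst (w, w')) a0 b0 * C' (snd (w, w')) d0 c0 * of_real (cc (fst (w, w')) (snd (w, w'))) =
        (\<Sum>(a, b, c)\<in>cuts3 w. \<Sum>(a', b', c')\<in>cuts3 w'. h (a, a') (b, b') (c, c'))"
      unfolding cc_def fst_conv snd_conv of_real_cut3_cut3
      by (intro sum.cong refl) (auto simp: cuts3_def intro!: sum.cong)
  qed
  finally have Phi: "Phi ?N $ (a0, b0) $ (c0, d0) =
      mps_sum (\<lambda>z. C (fst z) a0 b0 * C' (snd z) d0 c0 * of_real (cc (fst z) (snd z))) UNIV" .
  have "Theta (H \<sigma> x y) $ (a0, b0) $ (c0, d0) =
      mps_sum (\<lambda>z. C (fst z) a0 b0 * C' (snd z) d0 c0 * of_real (Dl (fst z) (snd z))) UNIV"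
    by (simp add: Theta_def dmatrix_def dentry_def Hw)
  then have "core_series \<sigma> x y $ (a0, b0) $ (c0, d0) =
      mps_sum (\<lambda>z. C (fst z) a0 b0 * C' (snd z) d0 c0 * of_real (Dl (fst z) (snd z))) UNIV +
      mps_sum (\<lambda>z. C (fst z) a0 b0 * C' (snd z) d0 c0 * of_real (cc (fst z) (snd z))) UNIV"
    by (simp only: core_series_def vector_add_component Phi)
  also have "\<dots> = mps_sum (\<lambda>z. C (fst z) a0 b0 * C' (snd z) d0 c0 * of_real (Dl (fst z) (snd z)) +
      C (fst z) a0 b0 * C' (snd z) d0 c0 * of_real (cc (fst z) (snd z))) UNIV"
    by (rule mps_sum_add; intro mps_locally_finite_scale locally_finite_pair lf_C lf_C')
  finally show ?thesis by (simp add: annular_core_def cc_def distrib_left)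
qed

lemma annular_core_Nil: "annular_core \<sigma> [] m' = 0" "annular_core \<sigma> m [] = 0"
  by (simp_all add: annular_core_def cut3_sum_def cut_sum_eq)

lemma annular_series:
  "G_A \<sigma> x y = Theta (G_D \<sigma> x (transpose x) ** core_series \<sigma> x y ** transpose (G_D \<sigma> y (transpose y)))"
proof -
  have entry: "G_A \<sigma> x y $ (p, r) $ (q, s) =
    Theta (G_D \<sigma> x (transpose x) ** core_series \<sigma> x y ** transpose (G_D \<sigma> y (transpose y))) $ (p, r) $ (q, s)"
    for p q r s :: 'd
  proof -
    define h where "h a b c = (\<Sum>z\<in>UNIV. \<Sum>e\<in>UNIV.
      (L (fst a) p (fst e) * L (fst c) (snd e) q * of_real (Ew (fst a @ fst c))) *
      (C (fst b) (fst e) (snd e) * C' (snd b) (snd z) (fst z) * of_real (annular_core \<sigma> (fst b) (snd b))) *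
      (L' (snd c) (fst z) r * L' (snd a) s (snd z) * of_real (Ew (snd a @ snd c))))" for a b c
    let ?u = "\<lambda>e u. L (fst u) p (fst e) * L (snd u) (snd e) q * of_real (Ew (fst u @ snd u))"
    let ?m = "\<lambda>z e u. C (fst u) (fst e) (snd e) * C' (snd u) (snd z) (fst z) * of_real (annular_core \<sigma> (fst u) (snd u))"
    let ?v = "\<lambda>z u. L' (snd u) (fst z) r * L' (fst u) s (snd z) * of_real (Ew (fst u @ snd u))"
    let ?g = "\<lambda>t. \<Sum>z\<in>UNIV. \<Sum>e\<in>UNIV. ?u e (fst (fst t)) * ?m z e (snd (fst t)) * ?v z (snd t)"
    have lfu: "lfin (?u e) UNIV" and lfm: "lfin (?m z e) UNIV" for z e
      by (intro mps_locally_finite_scale locally_finite_pair lf_L lf_C lf_C')+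
    have "lfin (\<lambda>u. L' (fst u) s (snd z) * L' (snd u) (fst z) r) UNIV" for z
      by (intro locally_finite_pair lf_L')
    then have lfv: "lfin (?v z) UNIV" for z
      by (intro mps_locally_finite_scale) (simp add: mult.commute)
    \<comment> \<open>The matrix product groups the outer words by circle, the cutting of words
      groups them by position; \<open>?j\<close> passes from the second grouping to the
      first.\<close>
    let ?j = "\<lambda>t. (((fst (fst (fst t)), fst (snd t)), snd (fst t)), (snd (fst (fst t)), snd (snd t)))"
    have j: "bij (?j :: ((('d \<times> 'd) list \<times> ('d \<times> 'd) list) \<times> (('d \<times> 'd) list \<times> ('d \<times> 'd) list)) \<times>
        (('d \<times> 'd) list \<times> ('d \<times> 'd) list) \<Rightarrow> _)" by (rule o_bij[of ?j]) (auto simp: comp_def)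
    have lfg: "lfin ?g UNIV"
      by (rule mps_sum_sum2(2)) (rule locally_finite_triple[OF lfu lfm lfv])
    have "Theta (G_D \<sigma> x (transpose x) ** core_series \<sigma> x y ** transpose (G_D \<sigma> y (transpose y))) $ (p, r) $ (q, s) =
        (\<Sum>z\<in>UNIV. \<Sum>e\<in>UNIV. G_D \<sigma> x (transpose x) $ (p, q) $ (fst e, snd e) *
          core_series \<sigma> x y $ (fst e, snd e) $ (fst z, snd z) * G_D \<sigma> y (transpose y) $ (r, s) $ (fst z, snd z))"
      by (simp add: Theta_def dmatrix_def dentry_def matrix_matrix_mult_def sum_distrib_right)
        (simp add: transpose_def)
    also have "\<dots> = (\<Sum>z\<in>UNIV. \<Sum>e\<in>UNIV. mps_sum (\<lambda>t. ?u e (fst (fst t)) * ?m z e (snd (fst t)) * ?v z (snd t)) UNIV)"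
      unfolding G_D_left G_D_right core_series_words by (intro sum.cong refl mps_sum_triple lfu lfm lfv)
    also have "\<dots> = mps_sum ?g UNIV" by (rule mps_sum_sum2(1)) (rule locally_finite_triple[OF lfu lfm lfv])
    also have "\<dots> = mps_sum (\<lambda>t. ?g (?j t)) UNIV" by (rule mps_sum_reindex[OF j])
    also have "\<dots> = mps_sum (\<lambda>t. h (fst (fst t)) (snd (fst t)) (snd t)) UNIV" by (simp add: h_def)
    also have "\<dots> = mps_sum (\<lambda>z. L (fst z) p q * L' (snd z) s r * of_real (annular_moment \<sigma> (fst z) (snd z))) UNIV"
    proof (rule mps_sum_cuts3)
      show "lfin (\<lambda>t. h (fst (fst t)) (snd (fst t)) (snd t)) UNIV"
        using mps_locally_finite_reindex[OF lfg bij_is_inj[OF j]] by (simp add: h_def)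
      show "lfin (\<lambda>z. L (fst z) p q * L' (snd z) s r * of_real (annular_moment \<sigma> (fst z) (snd z))) UNIV"
        by (intro mps_locally_finite_scale locally_finite_pair lf_L lf_L')
      fix w w' :: "('d \<times> 'd) list"
      have am: "annular_moment \<sigma> w w' = cut3_sum (\<lambda>u m v. cut3_sum (\<lambda>u' m' v'.
          Ew (u @ v) * (Ew (u' @ v') * annular_core \<sigma> m m')) w') w"
        using annular_moment_eq_cuts[of \<sigma> w w'] disc_moment_rotate[of \<sigma>, OF sym]
        by (simp add: annular_cuts_def annular_half_def cut3_sum_mult_left)
      have "L w p q * L' w' s r * of_real (Ew (u @ v) * (Ew (u' @ v') * annular_core \<sigma> m m')) = h (u, u') (m, m') (v, v')"
        if w: "w = u @ m @ v" "w' = u' @ m' @ v'" for u m v u' m' v'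
      proof (cases "m = [] \<or> m' = []")
        case True
        then show ?thesis by (auto simp: h_def annular_core_Nil)
      next
        case False
        then have "L w p q * L' w' s r =
          (\<Sum>e\<in>UNIV. L u p (fst e) * C m (fst e) (snd e) * L v (snd e) q) *
          (\<Sum>z\<in>UNIV. L' u' s (snd z) * C' m' (snd z) (fst z) * L' v' (fst z) r)" unfolding w
          by (simp add: line_weight_core_append sum_UNIV_prod[where F = "\<lambda>a b. L u p a * C m a b * L v b q"]
              sum_UNIV_prod[where F = "\<lambda>a b. L' u' s b * C' m' b a * L' v' a r"])
            (simp only: sum.swap[of "\<lambda>a b. L' u' s a * C' m' a b * L' v' b r"])
        also have "\<dots> = (\<Sum>z\<in>UNIV. \<Sum>e\<in>UNIV. (L u p (fst e) * C m (fst e) (snd e) * L v (snd e) q) *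
            (L' u' s (snd z) * C' m' (snd z) (fst z) * L' v' (fst z) r))"
          by (simp only: sum_product) (rule sum.swap)
        finally show ?thesis unfolding h_def by (simp add: sum_distrib_left sum_distrib_right mult_ac)
      qed
      then show "L (fst (w, w')) p q * L' (snd (w, w')) s r * of_real (annular_moment \<sigma> (fst (w, w')) (snd (w, w'))) =
          (\<Sum>(a, b, c)\<in>cuts3 w. \<Sum>(a', b', c')\<in>cuts3 w'. h (a, a') (b, b') (c, c'))"
        unfolding am fst_conv snd_conv of_real_cut3_cut3
        by (intro sum.cong refl) (auto simp: cuts3_def intro!: sum.cong)
    qed
    also have "\<dots> = G_A \<sigma> x y $ (p, r) $ (q, s)" by (rule G_A_words[OF x y sym, symmetric])
    finally show ?thesis ..
  qed
  then show ?thesis by (simp add: vec_eq_iff)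
qed

end

lemma NC2_two: "NC2 2 = {{{1, 2}}}"
proof -
  have "{1..2 :: nat} = {1, 2}" by auto
  have "NC2 2 = planar [1, 2]" using NC2_eq_planar[of 2] by (simp add: numeral_2_eq_2)
  also have "\<dots> = {\<pi> \<in> planar [1, 2]. {1, 2} \<in> \<pi>}"
  proof -
    have "{1, 2} \<in> \<pi>" if "\<pi> \<in> planar [1, 2]" for \<pi>
    proof -
      have "\<pi> \<in> pairings_on {1, 2}" using that by (simp add: planar_def)
      from pairings_on_partner[OF this, of 1] show ?thesis by auto
    qed
    then show ?thesis by blast
  qed
  also have "\<dots> = {{{1, 2}}}" using planar_step[of 1 "[]" 2 "[]"] by (simp add: planar_Nil join_pair_def)
  finally show ?thesis .
qed

text \<open>A two-letter word has a single pairing, so \<sigma> is \<phi> of a product of two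
  entries. Traciality then makes \<sigma> symmetric, and the symmetry of \<open>X\<close> makes it
  invariant under swapping indices, which is what reversing lines requires.\<close>

lemma mso_covariance:
  assumes "mso_semicircular star \<phi> \<phi>2 \<sigma> X"
  shows "of_real (\<sigma> c c') = \<phi> (X $ fst c $ snd c * X $ fst c' $ snd c')"
proof -
  let ?c = "\<lambda>t::nat. if t = 1 then c else c'"
  have "\<phi> (entry_word X ?c 2) = (\<Sum>\<pi>\<in>NC2 2. of_real (pairing_weight \<sigma> \<pi> ?c))"
    using assms by (simp add: mso_semicircular_def)
  moreover have "entry_word X ?c 2 = X $ fst c $ snd c * X $ fst c' $ snd c'"
    by (simp add: entry_word_def numeral_2_eq_2)
  ultimately show ?thesis by (simp add: NC2_two pairing_weight_def)
qed

theorem theorem39: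
  fixes scale :: "complex \<Rightarrow> 'a::ring_1 \<Rightarrow> 'a"
    and star :: "'a \<Rightarrow> 'a"
    and \<phi> :: "'a \<Rightarrow> complex"
    and \<phi>2 :: "'a \<Rightarrow> 'a \<Rightarrow> complex"
    and \<sigma> :: "'d::finite \<times> 'd \<Rightarrow> 'd \<times> 'd \<Rightarrow> real"
    and X :: "'a^'d^'d"
  assumes "second_order_probability_space scale star \<phi> \<phi>2"
    and "mso_semicircular star \<phi> \<phi>2 \<sigma> X"
  shows "G_A \<sigma> a_inv b_inv =
    Theta (G_D \<sigma> a_inv (transpose a_inv) **
      (Theta (H \<sigma> a_inv b_inv) +
       Phi (Gamma_transpose (H \<sigma> a_inv b_inv) **
            Gamma_transpose (kronecker (G_S \<sigma> a_inv) (G_S \<sigma> b_inv)) **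
            Gamma_transpose (H \<sigma> a_inv b_inv))) **
      transpose (G_D \<sigma> b_inv (transpose b_inv)))"
proof -
  have "complex_of_real (\<sigma> c c') = of_real (\<sigma> c' c)" for c c'
    unfolding mso_covariance[OF assms(2)] by (rule second_order_probability_space.phi_tracial[OF assms(1)])
  then have sym: "\<sigma> c c' = \<sigma> c' c" for c c' by simp
  have "X $ p $ q = X $ q $ p" for p q using assms(2) by (simp add: mso_semicircular_def)
  then have "complex_of_real (\<sigma> (prod.swap c) (prod.swap c')) = of_real (\<sigma> c c')" for c c'
    unfolding mso_covariance[OF assms(2)] by simp
  then have swap: "\<sigma> (prod.swap c) (prod.swap c') = \<sigma> c c'" for c c' by simp
  have a: "mps_homogeneous (Suc 0) (a_inv $ p $ q)" and b: "mps_homogeneous (Suc 0) (b_inv $ p $ q)" for p q :: 'd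
    by (simp_all add: a_inv_def b_inv_def mps_homogeneous_var)
  have "G_A \<sigma> a_inv b_inv = Theta (G_D \<sigma> a_inv (transpose a_inv) ** core_series \<sigma> a_inv b_inv **
      transpose (G_D \<sigma> b_inv (transpose b_inv)))"
    by (rule annular_series) (rule a b sym swap)+
  then show ?thesis by (simp only: core_series_def)
qed

end
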